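(* Let $X$ be a $\mathbb{Z}^n$-periodic discrete metric space and $A\in\mathcal{W}(X)$. Then for $p\in(1,\infty)$, $A$ is Fredholm on $l^p(X)$ if and only if there is $p_0\in[1,\infty]$ such that all limit operators of $A$ are invertible on $l^{p_0}(X)$. Moreover, the essential spectrum of $A$ on $l^p(X)$ does not depend on $p\in(1,\infty)$, and $\mathrm{sp}_{ess}A=\bigcup_{A_h\in\mathrm{op}(A)}\mathrm{sp}\,A_h$.
   Context: A discrete metric space is a countable set $X$ with a metric $\rho$ such that every ball is finite. It is $\mathbb{Z}^n$-periodic if $\mathbb{Z}^n$ acts on $X$ by $\rho$-isometries, $(\alpha,x)\mapsto\alpha\cdot x$ (a group action), freely, with finitely many orbits; $x_1,\dots,x_N$ are fixed orbit representatives. For a linear operator $A$ with generating function $k_A$ (i.e. $(Au)(x)=\sum_y k_A(x,y)u(y)$ for finitely supported $u$), set $r_A^{ij}(\alpha,\beta)=k_A(\alpha\cdot x_i,\beta\cdot x_j)$. $\mathcal{W}(X)$ is the set of such operators for which some $h_A\in l^1(\mathbb{Z}^n)$ satisfies $\max_{j}\sum_{i=1}^N|r_A^{ij}(\alpha,\beta)|\le h_A(\alpha-\beta)$ for all $\alpha,\beta$; such operators act boundedly on every $l^p(X)$, $p\in[1,\infty]$. $(T_\alpha u)(x)=u((-\alpha)\cdot x)$. For $p\in(1,\infty)$ and a sequence $h:\mathbb{N}\to\mathbb{Z}^n$ tending to infinity, $A_h$ is the limit operator of $A$ w.r.t. $h$ if $T_{h(m)}^{-1}AT_{h(m)}\to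 A_h$ strongly on $l^p(X)$ and $T_{h(m)}^{-1}A^*T_{h(m)}\to A_h^*$ strongly on $l^q(X)$, $1/p+1/q=1$. For $A\in\mathcal{W}(X)$ the set of limit operators does not depend on $p\in(1,\infty)$ and consists of operators in $\mathcal{W}(X)$; it is denoted $\mathrm{op}(A)$. $\mathrm{sp}_{ess}A$ is the set of $\lambda\in\mathbb{C}$ with $A-\lambda I$ not Fredholm; spectra $\mathrm{sp}\,A_h$ are taken on $l^p(X)$. *)

theory Defs
  imports "HOL-Analysis.Analysis"
begin

definition discrete_metric_space :: "('x \<Rightarrow> 'x \<Rightarrow> real) \<Rightarrow> bool" where
  "discrete_metric_space \<rho> \<longleftrightarrow>
     countable (UNIV :: 'x set) \<and>
     (\<forall>x y. 0 \<le> \<rho> x y) \<and> (\<forall>x y. \<rho> x y = 0 \<longleftrightarrow> x = y) \<and>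
     (\<forall>x y. \<rho> x y = \<rho> y x) \<and> (\<forall>x y z. \<rho> x z \<le> \<rho> x y + \<rho> y z) \<and>
     (\<forall>x r. finite {y. \<rho> x y \<le> r})"

definition orbit :: "(int^'n \<Rightarrow> 'x \<Rightarrow> 'x) \<Rightarrow> 'x \<Rightarrow> 'x set" where
  "orbit act x = range (\<lambda>\<alpha>. act \<alpha> x)"

definition periodic_dms :: "('x \<Rightarrow> 'x \<Rightarrow> real) \<Rightarrow> (int^'n \<Rightarrow> 'x \<Rightarrow> 'x) \<Rightarrow> bool" where
  "periodic_dms \<rho> act \<longleftrightarrow>
     discrete_metric_space \<rho> \<and>
     (\<forall>x. act 0 x = x) \<and> (\<forall>\<alpha> \<beta> x. act (\<alpha> + \<beta>) x = act \<alpha> (act \<beta> x)) \<and>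
     (\<forall>\<alpha> x y. \<rho> (act \<alpha> x) (act \<alpha> y) = \<rho> x y) \<and>
     (\<forall>\<alpha> x. act \<alpha> x = x \<longrightarrow> \<alpha> = 0) \<and>
     finite (range (orbit act))"

definition orbit_reps :: "(int^'n \<Rightarrow> 'x \<Rightarrow> 'x) \<Rightarrow> 'x set \<Rightarrow> bool" where
  "orbit_reps act R \<longleftrightarrow> (\<forall>x. \<exists>!r. r \<in> R \<and> r \<in> orbit act x)"

definition kop :: "('x \<Rightarrow> 'x \<Rightarrow> complex) \<Rightarrow> ('x \<Rightarrow> complex) \<Rightarrow> ('x \<Rightarrow> complex)" where
  "kop k u = (\<lambda>x. \<Sum>\<^sub>\<infinity>y. k x y * u y)"

definition in_W :: "(int^'n \<Rightarrow> 'x \<Rightarrow> 'x) \<Rightarrow> 'x set \<Rightarrow> ('x \<Rightarrow> 'x \<Rightarrow> complex) \<Rightarrow> bool" where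
  "in_W act R k \<longleftrightarrow>
     (\<exists>h :: int^'n \<Rightarrow> real. (\<lambda>\<alpha>. norm (h \<alpha>)) summable_on UNIV \<and>
        (\<forall>\<alpha> \<beta>. \<forall>j\<in>R. (\<Sum>i\<in>R. norm (k (act \<alpha> i) (act \<beta> j))) \<le> h (\<alpha> - \<beta>)))"

definition lp :: "ereal \<Rightarrow> ('x \<Rightarrow> complex) set" where
  "lp p = (if p = \<infinity> then {u. bdd_above (range (\<lambda>x. norm (u x)))}
           else {u. (\<lambda>x. norm (u x) powr real_of_ereal p) summable_on UNIV})"

definition lp_norm :: "ereal \<Rightarrow> ('x \<Rightarrow> complex) \<Rightarrow> real" where
  "lp_norm p u = (if p = \<infinity> then (SUP x. norm (u x))
                  else (\<Sum>\<^sub>\<infinity>x. norm (u x) powr real_of_ereal p) powr (1 / real_of_ereal p))"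

definition bounded_op :: "ereal \<Rightarrow> (('x \<Rightarrow> complex) \<Rightarrow> ('x \<Rightarrow> complex)) \<Rightarrow> bool" where
  "bounded_op p B \<longleftrightarrow>
     (\<forall>u\<in>lp p. B u \<in> lp p) \<and>
     (\<forall>u\<in>lp p. \<forall>v\<in>lp p. B (\<lambda>x. u x + v x) = (\<lambda>x. B u x + B v x)) \<and>
     (\<forall>u\<in>lp p. \<forall>c. B (\<lambda>x. c * u x) = (\<lambda>x. c * B u x)) \<and>
     (\<exists>C. \<forall>u\<in>lp p. lp_norm p (B u) \<le> C * lp_norm p u)"

definition invertible_on :: "ereal \<Rightarrow> (('x \<Rightarrow> complex) \<Rightarrow> ('x \<Rightarrow> complex)) \<Rightarrow> bool" where
  "invertible_on p B \<longleftrightarrow> bounded_op p B \<and>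
     (\<exists>B'. bounded_op p B' \<and> (\<forall>u\<in>lp p. B' (B u) = u \<and> B (B' u) = u))"

definition fin_span :: "('x \<Rightarrow> complex) set \<Rightarrow> ('x \<Rightarrow> complex) set" where
  "fin_span F = {(\<lambda>x. \<Sum>f\<in>F. c f * f x) | c. True}"

definition fredholm_on :: "ereal \<Rightarrow> (('x \<Rightarrow> complex) \<Rightarrow> ('x \<Rightarrow> complex)) \<Rightarrow> bool" where
  "fredholm_on p B \<longleftrightarrow> bounded_op p B \<and>
     (\<exists>F. finite F \<and> {u \<in> lp p. B u = (\<lambda>x. 0)} \<subseteq> fin_span F) \<and>
     (\<forall>v w. (\<forall>m::nat. v m \<in> B ` lp p) \<longrightarrow> w \<in> lp p \<longrightarrow>
            (\<lambda>m. lp_norm p (\<lambda>x. v m x - w x)) \<longlonglongrightarrow> 0 \<longrightarrow> w \<in> B ` lp p) \<and>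
     (\<exists>F. finite F \<and> F \<subseteq> lp p \<and>
          lp p \<subseteq> {(\<lambda>x. r x + s x) | r s. r \<in> B ` lp p \<and> s \<in> fin_span F})"

definition spectrum_on :: "ereal \<Rightarrow> (('x \<Rightarrow> complex) \<Rightarrow> ('x \<Rightarrow> complex)) \<Rightarrow> complex set" where
  "spectrum_on p B = {z. \<not> invertible_on p (\<lambda>u x. B u x - z * u x)}"

definition ess_spectrum_on :: "ereal \<Rightarrow> (('x \<Rightarrow> complex) \<Rightarrow> ('x \<Rightarrow> complex)) \<Rightarrow> complex set" where
  "ess_spectrum_on p B = {z. \<not> fredholm_on p (\<lambda>u x. B u x - z * u x)}"

definition shift :: "(int^'n \<Rightarrow> 'x \<Rightarrow> 'x) \<Rightarrow> int^'n \<Rightarrow> ('x \<Rightarrow> complex) \<Rightarrow> ('x \<Rightarrow> complex)" where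
  "shift act \<alpha> u = (\<lambda>x. u (act (- \<alpha>) x))"

definition shift_conj :: "(int^'n \<Rightarrow> 'x \<Rightarrow> 'x) \<Rightarrow> int^'n \<Rightarrow>
     (('x \<Rightarrow> complex) \<Rightarrow> ('x \<Rightarrow> complex)) \<Rightarrow> (('x \<Rightarrow> complex) \<Rightarrow> ('x \<Rightarrow> complex))" where
  "shift_conj act \<alpha> B = (\<lambda>u. shift act (- \<alpha>) (B (shift act \<alpha> u)))"

definition strong_conv :: "ereal \<Rightarrow> (nat \<Rightarrow> ('x \<Rightarrow> complex) \<Rightarrow> ('x \<Rightarrow> complex)) \<Rightarrow>
     (('x \<Rightarrow> complex) \<Rightarrow> ('x \<Rightarrow> complex)) \<Rightarrow> bool" where
  "strong_conv p Bs B \<longleftrightarrow> (\<forall>u\<in>lp p. (\<lambda>m. lp_norm p (\<lambda>x. Bs m u x - B u x)) \<longlonglongrightarrow> 0)"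

definition tends_to_infinity :: "(nat \<Rightarrow> int^'n) \<Rightarrow> bool" where
  "tends_to_infinity h \<longleftrightarrow> (\<forall>F. finite F \<longrightarrow> (\<forall>\<^sub>F m in sequentially. h m \<notin> F))"

text \<open>Adjoint of an operator with generating function k (w.r.t. the bilinear
  pairing of l^p and l^q) has generating function (x,y) \<mapsto> k y x.\<close>
definition adj_kernel :: "('x \<Rightarrow> 'x \<Rightarrow> complex) \<Rightarrow> ('x \<Rightarrow> 'x \<Rightarrow> complex)" where
  "adj_kernel k = (\<lambda>x y. k y x)"

definition conj_exp :: "real \<Rightarrow> real" where
  "conj_exp p = p / (p - 1)"

text \<open>k' is (the generating function of) the limit operator of A = kop k w.r.t. h on l^p.
  Limit operators of operators in W(X) lie in W(X), hence are given by generating functions.\<close>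
definition is_limit_op :: "(int^'n \<Rightarrow> 'x \<Rightarrow> 'x) \<Rightarrow> 'x set \<Rightarrow> real \<Rightarrow> ('x \<Rightarrow> 'x \<Rightarrow> complex) \<Rightarrow>
     (nat \<Rightarrow> int^'n) \<Rightarrow> ('x \<Rightarrow> 'x \<Rightarrow> complex) \<Rightarrow> bool" where
  "is_limit_op act R p k h k' \<longleftrightarrow>
     in_W act R k' \<and> tends_to_infinity h \<and>
     strong_conv (ereal p) (\<lambda>m. shift_conj act (h m) (kop k)) (kop k') \<and>
     strong_conv (ereal (conj_exp p)) (\<lambda>m. shift_conj act (h m) (kop (adj_kernel k)))
        (kop (adj_kernel k'))"

definition limit_ops :: "(int^'n \<Rightarrow> 'x \<Rightarrow> 'x) \<Rightarrow> 'x set \<Rightarrow> real \<Rightarrow> ('x \<Rightarrow> 'x \<Rightarrow> complex) \<Rightarrow>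
     ('x \<Rightarrow> 'x \<Rightarrow> complex) set" where
  "limit_ops act R p k = {k'. \<exists>h. is_limit_op act R p k h k'}"

end

(*
The group translates of a function are compared through the cell map, which sends a point to the
position of its orbit coordinate in Z^n; the kernel of A is dominated by h(cell x - cell y).

Everything is reduced to lower bounds of A and of its transpose. Conjugating with slowly varying weights
shows that a lower bound on l^p for functions supported in a set Y implies a lower bound on l^infinity, and
that the latter implies |u| <= g * |A u| for some summable g; this makes lower bounds independent of p and
replaces Wiener's lemma on inverse closedness. If A and its transpose have lower bounds off a finite set,
then inverting P A A* P + (I - P) on l^2 yields regularizers with summable decay, so A is Fredholm on every
l^p. Conversely Fredholmness gives these bounds, by the open mapping theorem for A and by duality for the
transpose.

Lower bounds off a finite set pass to limit operators, which are therefore invertible. If instead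
no lower bound held off any finite set, translating almost null functions escaping to infinity would
produce, by compactness, a limit operator with a bounded null function, which is impossible
when all limit operators are invertible on some l^p.
*)
theory Submission
  imports Defs "HOL-Complex_Analysis.Great_Picard"
begin

subsection \<open>Unordered sums\<close>

text \<open>The hub is the lower bound in the supremum norm. Its failure is witnessed at a single
  point, which a translation moves into the finite set of representatives; a value bounded away from
  0 then survives in the limit, whereas almost null functions in l^p could spread out their mass and
  tend to 0 pointwise. The price is a limit function that is merely bounded, so invertibility on one
  l^p (where p may be 1 or infinity) has to become injectivity on all bounded functions, for the
  kernel and for its transpose. This forces the passage from l^p to l^infinity, and forces inverses
  to be kernels with decay again. The weights serve both purposes. Being exponentials of a small
  multiple of the l^1 length, they are summable, which brings bounded functions into l^p, and their
  increments are small relative to themselves, which lets commutators be absorbed. The inverse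
  itself is constructed from l^2, where coercivity yields a contraction. Sums of nonnegative terms
  are taken in \<open>ennreal\<close>, so that they always exist and can be interchanged
  freely.\<close>

abbreviation nsum :: "('a \<Rightarrow> ennreal) \<Rightarrow> ennreal" where
  "nsum f \<equiv> \<integral>\<^sup>+x. f x \<partial>count_space UNIV"

abbreviation absum :: "('a \<Rightarrow> complex) \<Rightarrow> bool" where
  "absum f \<equiv> integrable (count_space UNIV) f"

abbreviation en :: "complex \<Rightarrow> ennreal" where
  "en z \<equiv> ennreal (norm z)"

lemma nsum_swap: "nsum (\<lambda>x. nsum (\<lambda>y. f x y)) = nsum (\<lambda>y. nsum (\<lambda>x. f x y))"
  using nn_integral_fst_count_space[of "\<lambda>(x,y). f x y"] nn_integral_snd_count_space[of "\<lambda>(x,y). f x y"]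
  by simp

lemma nsum_reflect:
  fixes f :: "'g::ab_group_add \<Rightarrow> ennreal"
  shows "nsum (\<lambda>\<gamma>. f (\<alpha> - \<gamma>)) = nsum f"
  by (rule nn_integral_bij_count_space) (rule bij_betwI[of _ _ _ "\<lambda>\<gamma>. \<alpha> - \<gamma>"], auto)

lemma nsum_translate:
  fixes f :: "'g::ab_group_add \<Rightarrow> ennreal"
  shows "nsum (\<lambda>\<gamma>. f (\<gamma> - \<alpha>)) = nsum f"
  by (rule nn_integral_bij_count_space) (rule bij_betwI[of _ _ _ "\<lambda>\<gamma>. \<gamma> + \<alpha>"], auto)

lemma nsum_uminus:
  fixes f :: "'g::ab_group_add \<Rightarrow> ennreal"
  shows "nsum (\<lambda>\<gamma>. f (- \<gamma>)) = nsum f"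
  using nsum_reflect[of f 0] by simp

lemma nsum_ge: "f x \<le> nsum f"
proof -
  have "f x = nsum (\<lambda>y. f y * indicator {x} y)"
    by (simp add: nn_integral_count_space_indicator[symmetric] nn_integral_count_space_finite)
  also have "\<dots> \<le> nsum f"
    by (rule nn_integral_mono) (auto split: split_indicator)
  finally show ?thesis .
qed

lemma nsum_single: "nsum (\<lambda>y. if y = x then f y else 0) = f x"
proof -
  have "nsum (\<lambda>y. if y = x then f y else 0) = nsum (\<lambda>y. f y * indicator {x} y)"
    by (rule nn_integral_cong) (auto split: split_indicator)
  also have "\<dots> = f x"
    by (simp add: nn_integral_count_space_indicator[symmetric] nn_integral_count_space_finite)
  finally show ?thesis .
qed

lemma nsum_finite_support:
  assumes "finite S" "\<And>x. x \<notin> S \<Longrightarrow> f x = 0"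
  shows "nsum f = (\<Sum>x\<in>S. f x)"
proof -
  have "nsum f = nsum (\<lambda>y. f y * indicator S y)"
    by (rule nn_integral_cong) (use assms in \<open>auto split: split_indicator\<close>)
  also have "\<dots> = (\<Sum>x\<in>S. f x)"
    using assms(1) by (simp add: nn_integral_count_space_indicator[symmetric] nn_integral_count_space_finite)
  finally show ?thesis .
qed

lemma absum_iff: "absum f \<longleftrightarrow> nsum (\<lambda>x. en (f x)) < top"
  by (simp add: integrable_iff_bounded)

lemma absum_iff_abs_summable: "absum f \<longleftrightarrow> (\<lambda>x. norm (f x)) summable_on UNIV"
  using abs_summable_equivalent[of f UNIV] by (simp add: abs_summable_on_def)

lemma absum_iff_summable: "absum f \<longleftrightarrow> f summable_on UNIV"
  by (simp add: absum_iff_abs_summable flip: summable_on_iff_abs_summable_on_complex)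

lemma infsum_eq_integral: "absum f \<Longrightarrow> infsum f UNIV = (\<integral>x. f x \<partial>count_space UNIV)"
  using infsetsum_infsum[of f UNIV] by (simp add: abs_summable_on_def infsetsum_def)

text \<open>Without summability the unordered sum is 0 by convention, so the bound also holds for
  divergent families and can be used without a case distinction.\<close>

lemma en_infsum_le: "en (infsum f UNIV) \<le> nsum (\<lambda>x. en (f x))"
proof (cases "absum f")
  case True
  then show ?thesis
    by (simp add: infsum_eq_integral integral_norm_bound_ennreal)
next
  case False
  then show ?thesis
    by (simp add: absum_iff_summable infsum_not_exists)
qed

text \<open>The value formula covers divergence as well: the left side is then 0 by convention, and
  \<open>enn2real\<close> sends infinity to 0.\<close>

lemma summable_on_nonneg_iff:
  fixes f :: "'a \<Rightarrow> real"
  assumes "\<And>x. 0 \<le> f x"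
  shows "f summable_on UNIV \<longleftrightarrow> nsum (\<lambda>x. ennreal (f x)) < top"
    and "infsum f UNIV = enn2real (nsum (\<lambda>x. ennreal (f x)))"
proof -
  have eq: "f summable_on UNIV \<longleftrightarrow> integrable (count_space UNIV) f"
    using abs_summable_equivalent[of f UNIV] assms by (simp add: abs_summable_on_def)
  then show 1: "f summable_on UNIV \<longleftrightarrow> nsum (\<lambda>x. ennreal (f x)) < top"
    using assms by (simp add: integrable_iff_bounded)
  show "infsum f UNIV = enn2real (nsum (\<lambda>x. ennreal (f x)))"
  proof (cases "f summable_on UNIV")
    case True
    then have "integrable (count_space UNIV) f" using eq by simp
    then show ?thesis
      using infsetsum_infsum[of f UNIV] assms
      by (simp add: abs_summable_on_def infsetsum_def integral_eq_nn_integral)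
  next
    case False
    then have "nsum (\<lambda>x. ennreal (f x)) = top" using 1 False less_top by blast
    then show ?thesis using False by (simp add: infsum_not_exists)
  qed
qed

lemma absum_bounded_mult:
  assumes "absum f" "\<And>x. norm (g x) \<le> U"
  shows "absum (\<lambda>x. f x * g x)"
proof -
  have "nsum (\<lambda>x. en (f x * g x)) \<le> nsum (\<lambda>x. ennreal U * en (f x))"
  proof (rule nn_integral_mono)
    fix x
    have "0 \<le> U" using assms(2)[of x] norm_ge_zero order_trans by blast
    then show "en (f x * g x) \<le> ennreal U * en (f x)"
      using mult_right_mono[OF assms(2)[of x], of "norm (f x)"]
      by (auto simp: norm_mult ennreal_mult[symmetric] mult.commute intro!: ennreal_leI)
  qed
  also have "\<dots> = ennreal U * nsum (\<lambda>x. en (f x))"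
    by (rule nn_integral_cmult) simp
  also have "\<dots> < top"
    using assms(1) by (simp add: absum_iff ennreal_mult_less_top)
  finally show ?thesis by (simp add: absum_iff)
qed

lemma infsum_swap_absum:
  fixes f :: "'a \<Rightarrow> 'b \<Rightarrow> complex"
  assumes "nsum (\<lambda>x. nsum (\<lambda>y. en (f x y))) < top"
  shows "(\<Sum>\<^sub>\<infinity>x. \<Sum>\<^sub>\<infinity>y. f x y) = (\<Sum>\<^sub>\<infinity>y. \<Sum>\<^sub>\<infinity>x. f x y)"
proof (rule infsum_swap_banach)
  have "nsum (\<lambda>z. en (case z of (x, y) \<Rightarrow> f x y)) < top"
    using nn_integral_fst_count_space[of "\<lambda>z. en (case z of (x, y) \<Rightarrow> f x y)"] assms by simp
  then show "(\<lambda>(x, y). f x y) summable_on UNIV \<times> UNIV"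
    using absum_iff[of "\<lambda>(x, y). f x y"] absum_iff_summable[of "\<lambda>(x, y). f x y"] by simp
qed

text \<open>Convexity of the power in tangent-line form; summed against weights \<open>w\<close> of total mass at most \<open>W\<close>
  at \<open>m = z / W\<close>, it gives Jensen's inequality below.\<close>

lemma young_tangent:
  fixes p m v :: real
  assumes "1 \<le> p" "0 < m" "0 \<le> v"
  shows "p * m powr (p - 1) * v \<le> v powr p + (p - 1) * m powr p"
proof (cases "p = 1")
  case True
  then show ?thesis using assms by (simp add: powr_mult_base)
next
  case False
  define q where "q = p / (p - 1)"
  have p: "p > 1" using False assms by simp
  have q: "q > 1" "1 / p + 1 / q = 1" "(p - 1) * q = p" "p / q = p - 1"
    using p by (auto simp: q_def field_simps)
  have "v * m powr (p - 1) \<le> v powr p / p + (m powr (p - 1)) powr q / q"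
    by (rule Youngs_inequality) (use p q assms in auto)
  then have "p * (v * m powr (p - 1)) \<le> p * (v powr p / p + m powr p / q)"
    using p q by (simp add: powr_powr)
  also have "\<dots> = v powr p + (p / q) * m powr p"
    using p by (simp add: field_simps)
  finally show ?thesis using q by (simp add: mult_ac)
qed

text \<open>Only inequalities are required of \<open>z\<close> and \<open>W\<close>, so it applies
  directly to a value of \<open>kop k u\<close> with a row of the kernel as weights.\<close>

lemma weighted_power_mean:
  fixes w v :: "'a \<Rightarrow> real" and W z p :: real
  assumes p: "1 \<le> p" and w: "\<And>y. 0 \<le> w y" and v: "\<And>y. 0 \<le> v y" and z: "0 \<le> z" and W: "0 \<le> W"
    and wW: "nsum (\<lambda>y. ennreal (w y)) \<le> ennreal W"
    and zle: "ennreal z \<le> nsum (\<lambda>y. ennreal (w y * v y))"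
  shows "ennreal (z powr p) \<le> ennreal (W powr (p - 1)) * nsum (\<lambda>y. ennreal (w y * v y powr p))"
proof (cases "z = 0")
  case True
  then show ?thesis using p by simp
next
  case False
  then have z0: "z > 0" using z by simp
  have W0: "W > 0"
  proof (rule ccontr)
    assume "\<not> W > 0"
    then have "W = 0" using W by simp
    then have "nsum (\<lambda>y. ennreal (w y)) = 0" using wW by simp
    then have "\<And>y. w y = 0"
      using nsum_ge[of "\<lambda>y. ennreal (w y)"] w by (metis ennreal_eq_0_iff le_zero_eq order_antisym)
    then show False using zle z0 by simp
  qed
  define m where "m = z / W"
  have m: "m > 0" "z = m * W" using z0 W0 by (auto simp: m_def)
  have "ennreal (p * m powr (p - 1)) * ennreal z \<le> ennreal (p * m powr (p - 1)) * nsum (\<lambda>y. ennreal (w y * v y))"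
    by (rule mult_left_mono[OF zle]) simp
  also have "\<dots> = nsum (\<lambda>y. ennreal (p * m powr (p - 1)) * ennreal (w y * v y))"
    by (rule nn_integral_cmult[symmetric]) simp
  also have "\<dots> \<le> nsum (\<lambda>y. ennreal (w y * v y powr p) + ennreal ((p - 1) * m powr p) * ennreal (w y))"
  proof (rule nn_integral_mono)
    fix y
    have "w y * (p * m powr (p - 1) * v y) \<le> w y * (v y powr p + (p - 1) * m powr p)"
      by (rule mult_left_mono[OF young_tangent]) (use p m v w in auto)
    then have "p * m powr (p - 1) * (w y * v y) \<le> w y * v y powr p + (p - 1) * m powr p * w y"
      by (simp add: algebra_simps)
    then show "ennreal (p * m powr (p - 1)) * ennreal (w y * v y)
        \<le> ennreal (w y * v y powr p) + ennreal ((p - 1) * m powr p) * ennreal (w y)"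
      using p w v m by (simp add: ennreal_mult[symmetric] ennreal_plus[symmetric] del: ennreal_plus)
  qed
  also have "\<dots> = nsum (\<lambda>y. ennreal (w y * v y powr p)) + ennreal ((p - 1) * m powr p) * nsum (\<lambda>y. ennreal (w y))"
    by (simp add: nn_integral_add nn_integral_cmult)
  also have "\<dots> \<le> nsum (\<lambda>y. ennreal (w y * v y powr p)) + ennreal ((p - 1) * m powr p) * ennreal W"
    by (intro add_left_mono mult_left_mono wW) simp
  finally have "ennreal (p * m powr (p - 1) * z) \<le> nsum (\<lambda>y. ennreal (w y * v y powr p)) + ennreal ((p - 1) * m powr p * W)"
    using p z W by (simp add: ennreal_mult[symmetric])
  \<comment> \<open>The second summand is exactly the contribution of the intercept of the tangent;
    being finite, it cancels.\<close>
  moreover have "p * m powr (p - 1) * z = m powr p * W + (p - 1) * m powr p * W"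
  proof -
    have "m powr (p - 1) * m = m powr p" using m by (metis add.commute diff_add_cancel less_eq_real_def mult.commute powr_mult_base)
    then show ?thesis by (simp add: m(2) algebra_simps)
  qed
  ultimately have "ennreal (m powr p * W) + ennreal ((p - 1) * m powr p * W)
      \<le> nsum (\<lambda>y. ennreal (w y * v y powr p)) + ennreal ((p - 1) * m powr p * W)"
    using p W by (simp add: ennreal_plus[symmetric] del: ennreal_plus)
  then have "ennreal (m powr p * W) \<le> nsum (\<lambda>y. ennreal (w y * v y powr p))"
    by (subst (asm) (1 2) add.commute) (simp add: ennreal_add_left_cancel_le)
  then have "ennreal (W powr (p - 1)) * ennreal (m powr p * W) \<le> ennreal (W powr (p - 1)) * nsum (\<lambda>y. ennreal (w y * v y powr p))"
    by (rule mult_left_mono) simp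
  moreover have "W powr (p - 1) * (m powr p * W) = z powr p"
  proof -
    have "W powr (p - 1) * W = W powr p" using W0 by (metis add.commute diff_add_cancel less_eq_real_def mult.commute powr_mult_base)
    then have "W powr (p - 1) * (m powr p * W) = m powr p * W powr p" by (simp add: mult_ac)
    also have "\<dots> = z powr p" using m W0 by (simp add: powr_mult)
    finally show ?thesis .
  qed
  ultimately show ?thesis using W by (simp add: ennreal_mult[symmetric])
qed

subsection \<open>Kernels with summable off-diagonal decay\<close>

definition bdd :: "('x \<Rightarrow> complex) \<Rightarrow> bool" where
  "bdd u \<longleftrightarrow> (\<exists>U. \<forall>x. norm (u x) \<le> U)"

definition kmul :: "('x \<Rightarrow> 'x \<Rightarrow> complex) \<Rightarrow> ('x \<Rightarrow> 'x \<Rightarrow> complex) \<Rightarrow> ('x \<Rightarrow> 'x \<Rightarrow> complex)" where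
  "kmul k l = (\<lambda>x y. \<Sum>\<^sub>\<infinity>z. k x z * l z y)"

text \<open>Besides being the identity kernel, its row \<open>kid y\<close> serves as the unit
  vector at \<open>y\<close>.\<close>

definition kid :: "'x \<Rightarrow> 'x \<Rightarrow> complex" where
  "kid = (\<lambda>x y. if x = y then 1 else 0)"

definition conv :: "('g::ab_group_add \<Rightarrow> ennreal) \<Rightarrow> ('g \<Rightarrow> ennreal) \<Rightarrow> 'g \<Rightarrow> ennreal" where
  "conv f g = (\<lambda>\<alpha>. nsum (\<lambda>\<beta>. f \<beta> * g (\<alpha> - \<beta>)))"

text \<open>The \<open>p\<close>-th power of the l^p norm, infinite off l^p, so that estimates can
  be stated for arbitrary functions. The supremum norm is treated separately through
  \<open>bdd\<close>.\<close>

definition pn :: "real \<Rightarrow> ('x \<Rightarrow> complex) \<Rightarrow> ennreal" where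
  "pn p u = nsum (\<lambda>x. ennreal (norm (u x) powr p))"

lemma nsum_conv: "nsum (conv f g) = nsum f * nsum g"
proof -
  have "nsum (conv f g) = nsum (\<lambda>\<beta>. nsum (\<lambda>\<alpha>. f \<beta> * g (\<alpha> - \<beta>)))"
    unfolding conv_def by (rule nsum_swap)
  also have "\<dots> = nsum (\<lambda>\<beta>. f \<beta> * nsum g)"
    by (simp add: nn_integral_cmult nsum_translate)
  finally show ?thesis by (simp add: nn_integral_multc)
qed

lemma conv_assoc: "conv e (conv f b) = conv (conv e f) b"
proof
  fix \<alpha>
  have "conv (conv e f) b \<alpha> = nsum (\<lambda>\<gamma>. nsum (\<lambda>\<beta>. e \<beta> * f (\<gamma> - \<beta>) * b (\<alpha> - \<gamma>)))"
    by (simp add: conv_def nn_integral_multc)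
  also have "\<dots> = nsum (\<lambda>\<beta>. nsum (\<lambda>\<gamma>. e \<beta> * f (\<gamma> - \<beta>) * b (\<alpha> - \<gamma>)))"
    by (rule nsum_swap)
  also have "\<dots> = nsum (\<lambda>\<beta>. e \<beta> * conv f b (\<alpha> - \<beta>))"
  proof (rule nn_integral_cong)
    fix \<beta>
    have "nsum (\<lambda>\<gamma>. e \<beta> * f (\<gamma> - \<beta>) * b (\<alpha> - \<gamma>)) = e \<beta> * nsum (\<lambda>\<gamma>. f (\<gamma> - \<beta>) * b (\<alpha> - \<beta> - (\<gamma> - \<beta>)))"
      by (simp add: nn_integral_cmult[symmetric] mult.assoc)
    also have "nsum (\<lambda>\<gamma>. f (\<gamma> - \<beta>) * b (\<alpha> - \<beta> - (\<gamma> - \<beta>))) = conv f b (\<alpha> - \<beta>)"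
      unfolding conv_def by (rule nsum_translate)
    finally show "nsum (\<lambda>\<gamma>. e \<beta> * f (\<gamma> - \<beta>) * b (\<alpha> - \<gamma>)) = e \<beta> * conv f b (\<alpha> - \<beta>)" .
  qed
  finally show "conv e (conv f b) \<alpha> = conv (conv e f) b \<alpha>"
    by (simp add: conv_def)
qed

lemma conv_mono: "(\<And>\<gamma>. f \<gamma> \<le> f' \<gamma>) \<Longrightarrow> (\<And>\<gamma>. g \<gamma> \<le> g' \<gamma>) \<Longrightarrow> conv f g \<alpha> \<le> conv f' g' \<alpha>"
  unfolding conv_def by (intro nn_integral_mono mult_mono) auto

lemma of_nat_less_top_ennreal [simp]: "of_nat n < (top :: ennreal)"
  by (simp add: ennreal_of_nat_eq_real_of_nat)

lemma adj_adj [simp]: "adj_kernel (adj_kernel k) = k"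
  by (simp add: adj_kernel_def)

lemma bddI: "(\<And>x. norm (u x) \<le> U) \<Longrightarrow> bdd u"
  by (auto simp: bdd_def)

lemma bdd_add: "bdd u \<Longrightarrow> bdd v \<Longrightarrow> bdd (\<lambda>x. u x + v x)"
  unfolding bdd_def by (meson add_mono norm_triangle_le)

lemma bdd_cmult: "bdd u \<Longrightarrow> bdd (\<lambda>x. c * u x)"
  unfolding bdd_def by (metis mult_left_mono norm_ge_zero norm_mult)

lemma bdd_mono: "bdd u \<Longrightarrow> (\<And>x. norm (v x) \<le> norm (u x)) \<Longrightarrow> bdd v"
  unfolding bdd_def by (meson order_trans)

lemma bdd_cnj: "bdd u \<Longrightarrow> bdd (\<lambda>x. cnj (u x))"
  unfolding bdd_def by simp

lemma bdd_pos_bound: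
  assumes "bdd u"
  obtains U where "0 < U" "\<And>x. norm (u x) \<le> U"
proof -
  obtain U where U: "\<And>x. norm (u x) \<le> U" using assms by (auto simp: bdd_def)
  show ?thesis by (rule that[of "max U 1"]) (auto intro: max.coboundedI1 U)
qed

lemma bdd_finite_support:
  assumes "finite {x. u x \<noteq> 0}"
  shows "bdd u"
proof -
  have "norm (u x) \<le> (\<Sum>x\<in>{x. u x \<noteq> 0}. norm (u x))" for x
    using member_le_sum[of x "{x. u x \<noteq> 0}" "\<lambda>x. norm (u x)"] assms
    by (cases "u x = 0") (auto intro: sum_nonneg)
  then show ?thesis by (rule bddI)
qed

lemma kop_finite_support:
  assumes "finite S" "\<And>y. y \<notin> S \<Longrightarrow> u y = 0"
  shows "kop k u x = (\<Sum>y\<in>S. k x y * u y)"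
proof -
  have "kop k u x = (\<Sum>\<^sub>\<infinity>y\<in>S. k x y * u y)"
    unfolding kop_def by (rule infsum_cong_neutral) (use assms in auto)
  then show ?thesis using assms by simp
qed

lemma kop_kid [simp]: "kop kid u = u"
proof
  fix x
  have "kop kid u x = (\<Sum>\<^sub>\<infinity>y\<in>{x}. kid x y * u y)"
    unfolding kop_def by (rule infsum_cong_neutral) (auto simp: kid_def)
  then show "kop kid u x = u x" by (simp add: kid_def)
qed

lemma en_kop_le: "en (kop k u x) \<le> nsum (\<lambda>y. ennreal (norm (k x y) * norm (u y)))"
  using en_infsum_le[of "\<lambda>y. k x y * u y"] by (simp add: kop_def norm_mult)

section \<open>Kernels dominated by a summable function of the difference of cells\<close>

locale cells =
  fixes \<pi> :: "'x \<Rightarrow> int^'n" and N :: nat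
  assumes finite_cell: "finite {x. \<pi> x = \<alpha>}"
    and card_cell: "card {x. \<pi> x = \<alpha>} \<le> N"
begin

text \<open>An entrywise form of the estimate that defines the class; passing between the two costs
  at most the number of orbit representatives as a factor.\<close>

definition domk :: "(int^'n \<Rightarrow> ennreal) \<Rightarrow> ('x \<Rightarrow> 'x \<Rightarrow> complex) \<Rightarrow> bool" where
  "domk h k \<longleftrightarrow> nsum h < top \<and> (\<forall>x y. en (k x y) \<le> h (\<pi> x - \<pi> y))"

definition Wk :: "('x \<Rightarrow> 'x \<Rightarrow> complex) \<Rightarrow> bool" where
  "Wk k \<longleftrightarrow> (\<exists>h. domk h k)"

lemma countable_points: "countable (A :: 'x set)"
proof -
  have "(UNIV :: 'x set) = (\<Union>\<alpha>. {x. \<pi> x = \<alpha>})" by auto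
  moreover have "countable (\<Union>\<alpha>. {x. \<pi> x = \<alpha>})"
    by (rule countable_UN) (auto simp: countable_finite finite_cell)
  ultimately show ?thesis using countable_subset by (metis top_greatest)
qed

text \<open>Sorting the points by cell counts each value \<open>f \<gamma>\<close> at most
  \<open>N\<close> times. All row and column sums are reduced to sums over the group in this
  way.\<close>

lemma nsum_cell: "nsum (\<lambda>y. f (\<pi> y)) \<le> of_nat N * nsum f"
proof -
  have "nsum (\<lambda>y. f (\<pi> y)) = nsum (\<lambda>y. nsum (\<lambda>\<gamma>. if \<gamma> = \<pi> y then f \<gamma> else 0))"
    by (simp only: nsum_single)
  also have "\<dots> = nsum (\<lambda>\<gamma>. nsum (\<lambda>y. if \<gamma> = \<pi> y then f \<gamma> else 0))"
    by (rule nsum_swap)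
  also have "\<dots> = nsum (\<lambda>\<gamma>. of_nat (card {y. \<pi> y = \<gamma>}) * f \<gamma>)"
    by (intro nn_integral_cong, subst nsum_finite_support[OF finite_cell]) auto
  also have "\<dots> \<le> nsum (\<lambda>\<gamma>. of_nat N * f \<gamma>)"
    by (intro nn_integral_mono mult_right_mono) (simp_all add: card_cell)
  finally show ?thesis by (simp add: nn_integral_cmult)
qed

lemma nsum_row: "nsum (\<lambda>y. f (\<alpha> - \<pi> y)) \<le> of_nat N * nsum f"
  using nsum_cell[of "\<lambda>\<gamma>. f (\<alpha> - \<gamma>)"] by (simp add: nsum_reflect)

lemma nsum_col: "nsum (\<lambda>x. f (\<pi> x - \<alpha>)) \<le> of_nat N * nsum f"
  using nsum_cell[of "\<lambda>\<gamma>. f (\<gamma> - \<alpha>)"] by (simp add: nsum_translate)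

lemma domk_total:
  assumes "domk h k"
  obtains W where "0 < W" "of_nat N * nsum h \<le> ennreal W"
proof -
  have "of_nat N * nsum h < top" using assms by (simp add: domk_def ennreal_mult_less_top)
  then obtain w where "0 \<le> w" "of_nat N * nsum h = ennreal w"
    by (cases "of_nat N * nsum h") auto
  then show ?thesis by (intro that[of "w + 1"]) (auto intro: ennreal_leI)
qed

lemma domk_row: "domk h k \<Longrightarrow> nsum (\<lambda>y. en (k x y)) \<le> of_nat N * nsum h"
  by (rule order_trans[OF nn_integral_mono nsum_row[of h "\<pi> x"]]) (simp add: domk_def)

lemma domk_col: "domk h k \<Longrightarrow> nsum (\<lambda>x. en (k x y)) \<le> of_nat N * nsum h"
  by (rule order_trans[OF nn_integral_mono nsum_col[of h "\<pi> y"]]) (simp add: domk_def)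

lemma domk_adj: "domk h k \<Longrightarrow> domk (\<lambda>\<gamma>. h (- \<gamma>)) (adj_kernel k)"
  by (simp add: domk_def adj_kernel_def nsum_uminus)

lemma Wk_adj: "Wk k \<Longrightarrow> Wk (adj_kernel k)"
  using domk_adj unfolding Wk_def by blast

lemma Wk_bounds:
  assumes "Wk k"
  obtains W where "0 < W" "\<And>x. nsum (\<lambda>y. en (k x y)) \<le> ennreal W" "\<And>y. nsum (\<lambda>x. en (k x y)) \<le> ennreal W"
proof -
  obtain h where h: "domk h k" using assms by (auto simp: Wk_def)
  obtain W where "0 < W" "of_nat N * nsum h \<le> ennreal W" using h by (rule domk_total)
  then show ?thesis by (intro that[of W]) (auto intro: order_trans domk_row[OF h] domk_col[OF h])
qed

lemma Wk_mono: "Wk k \<Longrightarrow> (\<And>x y. norm (l x y) \<le> norm (k x y)) \<Longrightarrow> Wk l"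
  unfolding Wk_def domk_def by (meson ennreal_leI order_trans)

lemma Wk_cnj: "Wk k \<Longrightarrow> Wk (\<lambda>x y. cnj (k x y))"
  by (rule Wk_mono) auto

lemma Wk_cmult:
  assumes "Wk k"
  shows "Wk (\<lambda>x y. c * k x y)"
proof -
  obtain h where h: "domk h k" using assms by (auto simp: Wk_def)
  have "domk (\<lambda>\<gamma>. en c * h \<gamma>) (\<lambda>x y. c * k x y)"
    using h by (auto simp: domk_def norm_mult ennreal_mult nn_integral_cmult ennreal_mult_less_top intro: mult_left_mono)
  then show ?thesis by (auto simp: Wk_def)
qed

lemma Wk_add:
  assumes "Wk k" "Wk l"
  shows "Wk (\<lambda>x y. k x y + l x y)"
proof -
  obtain h h' where h: "domk h k" "domk h' l" using assms by (auto simp: Wk_def)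
  have "en (k x y + l x y) \<le> h (\<pi> x - \<pi> y) + h' (\<pi> x - \<pi> y)" for x y
  proof -
    have "en (k x y + l x y) \<le> en (k x y) + en (l x y)"
      by (simp add: ennreal_plus[symmetric] norm_triangle_ineq del: ennreal_plus)
    also have "\<dots> \<le> h (\<pi> x - \<pi> y) + h' (\<pi> x - \<pi> y)"
      using h by (intro add_mono) (auto simp: domk_def)
    finally show ?thesis .
  qed
  then have "domk (\<lambda>\<gamma>. h \<gamma> + h' \<gamma>) (\<lambda>x y. k x y + l x y)"
    using h by (auto simp: domk_def nn_integral_add)
  then show ?thesis by (auto simp: Wk_def)
qed

lemma Wk_kid: "Wk kid"
proof -
  have "nsum (\<lambda>\<gamma>::int^'n. if \<gamma> = 0 then 1 else 0 :: ennreal) = 1"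
    by (rule nsum_single)
  then have "domk (\<lambda>\<gamma>. if \<gamma> = 0 then 1 else 0) kid"
    by (auto simp: domk_def kid_def)
  then show ?thesis by (auto simp: Wk_def)
qed

text \<open>The convolution of the two dominating functions dominates the product; the factor
  \<open>N\<close> accounts for the intermediate points sharing a cell.\<close>

lemma Wk_kmul:
  assumes "Wk k" "Wk l"
  shows "Wk (kmul k l)"
proof -
  obtain h h' where h: "domk h k" "domk h' l" using assms by (auto simp: Wk_def)
  have "en (kmul k l x y) \<le> of_nat N * conv h h' (\<pi> x - \<pi> y)" for x y
  proof -
    have "en (kmul k l x y) \<le> nsum (\<lambda>z. en (k x z * l z y))"
      unfolding kmul_def by (rule en_infsum_le)
    also have "\<dots> \<le> nsum (\<lambda>z. h (\<pi> x - \<pi> z) * h' (\<pi> z - \<pi> y))"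
      using h by (intro nn_integral_mono) (auto simp: norm_mult ennreal_mult domk_def intro: mult_mono)
    also have "\<dots> \<le> of_nat N * nsum (\<lambda>\<gamma>. h (\<pi> x - \<gamma>) * h' (\<gamma> - \<pi> y))"
      by (rule nsum_cell)
    also have "nsum (\<lambda>\<gamma>. h (\<pi> x - \<gamma>) * h' (\<gamma> - \<pi> y)) = conv h h' (\<pi> x - \<pi> y)"
      using nsum_reflect[of "\<lambda>\<beta>. h \<beta> * h' (\<pi> x - \<pi> y - \<beta>)" "\<pi> x"]
      by (simp add: conv_def algebra_simps)
    finally show ?thesis .
  qed
  moreover have "nsum (\<lambda>\<gamma>. of_nat N * conv h h' \<gamma>) < top"
    using h by (simp add: nn_integral_cmult nsum_conv domk_def ennreal_mult_less_top)
  ultimately have "domk (\<lambda>\<gamma>. of_nat N * conv h h' \<gamma>) (kmul k l)"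
    by (auto simp: domk_def)
  then show ?thesis by (auto simp: Wk_def)
qed

lemma absum_row: "Wk k \<Longrightarrow> absum (\<lambda>y. k x y)"
  by (erule Wk_bounds) (metis absum_iff ennreal_less_top le_less_trans)

lemma absum_row_mult: "Wk k \<Longrightarrow> bdd u \<Longrightarrow> absum (\<lambda>y. k x y * u y)"
  unfolding bdd_def by (metis absum_bounded_mult absum_row)

lemma kop_summable: "Wk k \<Longrightarrow> bdd u \<Longrightarrow> (\<lambda>y. k x y * u y) summable_on UNIV"
  by (simp add: absum_row_mult flip: absum_iff_summable)

lemma kop_add: "Wk k \<Longrightarrow> bdd u \<Longrightarrow> bdd v \<Longrightarrow> kop k (\<lambda>x. u x + v x) = (\<lambda>x. kop k u x + kop k v x)"
  by (rule ext) (simp add: kop_def distrib_left infsum_add kop_summable)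

lemma kop_cmult: "kop k (\<lambda>x. c * u x) = (\<lambda>x. c * kop k u x)"
  by (rule ext) (simp add: kop_def infsum_cmult_right'[symmetric] mult.left_commute)

lemma kop_diff: "Wk k \<Longrightarrow> bdd u \<Longrightarrow> bdd v \<Longrightarrow> kop k (\<lambda>x. u x - v x) = (\<lambda>x. kop k u x - kop k v x)"
  using kop_add[of k u "\<lambda>x. (-1) * v x"] kop_cmult[of k "-1" v] bdd_cmult[of v "-1"] by simp

lemma kop_zero [simp]: "kop k (\<lambda>x. 0) = (\<lambda>x. 0)"
  by (simp add: kop_def)

lemma kop_kernel_add:
  "Wk k \<Longrightarrow> Wk l \<Longrightarrow> bdd u \<Longrightarrow> kop (\<lambda>x y. k x y + l x y) u = (\<lambda>x. kop k u x + kop l u x)"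
  by (rule ext) (simp add: kop_def distrib_right infsum_add kop_summable)

lemma kop_kernel_cmult: "kop (\<lambda>x y. c * k x y) u = (\<lambda>x. c * kop k u x)"
  by (rule ext) (simp add: kop_def infsum_cmult_right'[symmetric] mult.assoc)

lemma kop_kernel_diff:
  "Wk k \<Longrightarrow> Wk l \<Longrightarrow> bdd u \<Longrightarrow> kop (\<lambda>x y. k x y - l x y) u = (\<lambda>x. kop k u x - kop l u x)"
  using kop_kernel_add[of k "\<lambda>x y. (-1) * l x y" u] Wk_cmult[of l "-1"] kop_kernel_cmult[of "-1" l u]
  by simp

lemma norm_kop_le:
  assumes "nsum (\<lambda>y. en (k x y)) \<le> ennreal W" "\<And>y. norm (u y) \<le> U" "0 \<le> W"
  shows "norm (kop k u x) \<le> W * U"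
proof -
  have U: "0 \<le> U" using assms(2) norm_ge_zero order_trans by blast
  have "en (kop k u x) \<le> nsum (\<lambda>y. ennreal (norm (k x y) * norm (u y)))"
    by (rule en_kop_le)
  also have "\<dots> \<le> nsum (\<lambda>y. en (k x y) * ennreal U)"
    using assms(2) U by (intro nn_integral_mono) (auto simp: ennreal_mult[symmetric] intro!: ennreal_leI mult_left_mono)
  also have "\<dots> = nsum (\<lambda>y. en (k x y)) * ennreal U"
    by (simp add: nn_integral_multc)
  also have "\<dots> \<le> ennreal W * ennreal U"
    by (rule mult_right_mono[OF assms(1)]) simp
  finally show ?thesis using assms(3) U by (simp add: ennreal_mult[symmetric])
qed

lemma bdd_kop:
  assumes "Wk k" "bdd u"
  shows "bdd (kop k u)"
proof -
  obtain W where W: "0 < W" "\<And>x. nsum (\<lambda>y. en (k x y)) \<le> ennreal W" using Wk_bounds[OF assms(1)] by metis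
  obtain U where U: "\<And>x. norm (u x) \<le> U" using assms(2) by (auto simp: bdd_def)
  show ?thesis using W U by (intro bddI[of _ "W * U"] norm_kop_le) auto
qed

text \<open>Row sums alone dominate the double series by \<open>V * W * U\<close>, so the sums may
  be interchanged for every bounded \<open>u\<close>.\<close>

lemma kop_kop:
  assumes k: "Wk k" and l: "Wk l" and u: "bdd u"
  shows "kop k (kop l u) = kop (kmul k l) u"
proof
  fix x
  obtain V where V: "0 < V" "\<And>x. nsum (\<lambda>y. en (k x y)) \<le> ennreal V" using Wk_bounds[OF k] by metis
  obtain W where W: "0 < W" "\<And>x. nsum (\<lambda>y. en (l x y)) \<le> ennreal W" using Wk_bounds[OF l] by metis
  obtain U where U: "0 < U" "\<And>x. norm (u x) \<le> U" using bdd_pos_bound[OF u] by metis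
  have "nsum (\<lambda>z. nsum (\<lambda>y. en (k x z * (l z y * u y)))) \<le> nsum (\<lambda>z. en (k x z) * ennreal (W * U))"
  proof (rule nn_integral_mono)
    fix z
    have "nsum (\<lambda>y. en (k x z * (l z y * u y))) = en (k x z) * nsum (\<lambda>y. en (l z y * u y))"
      by (simp add: norm_mult ennreal_mult nn_integral_cmult)
    also have "nsum (\<lambda>y. en (l z y * u y)) \<le> nsum (\<lambda>y. en (l z y) * ennreal U)"
      using U by (intro nn_integral_mono) (auto simp: norm_mult ennreal_mult intro!: ennreal_leI mult_left_mono)
    also have "\<dots> = nsum (\<lambda>y. en (l z y)) * ennreal U"
      by (simp add: nn_integral_multc)
    also have "\<dots> \<le> ennreal (W * U)"
      using W U by (auto simp: ennreal_mult intro: mult_right_mono)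
    finally show "nsum (\<lambda>y. en (k x z * (l z y * u y))) \<le> en (k x z) * ennreal (W * U)"
      by (simp add: mult_left_mono)
  qed
  also have "\<dots> = nsum (\<lambda>z. en (k x z)) * ennreal (W * U)"
    by (simp add: nn_integral_multc)
  also have "\<dots> \<le> ennreal V * ennreal (W * U)"
    by (rule mult_right_mono[OF V(2)]) simp
  also have "\<dots> < top" by (simp add: ennreal_mult_less_top)
  finally have fin: "nsum (\<lambda>z. nsum (\<lambda>y. en (k x z * (l z y * u y)))) < top" .
  have "kop k (kop l u) x = (\<Sum>\<^sub>\<infinity>z. \<Sum>\<^sub>\<infinity>y. k x z * (l z y * u y))"
    by (simp add: kop_def infsum_cmult_right')
  also have "\<dots> = (\<Sum>\<^sub>\<infinity>y. \<Sum>\<^sub>\<infinity>z. k x z * (l z y * u y))"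
    by (rule infsum_swap_absum[OF fin])
  also have "\<dots> = kop (kmul k l) u x"
    by (simp add: kop_def kmul_def infsum_cmult_left'[symmetric] mult.assoc)
  finally show "kop k (kop l u) x = kop (kmul k l) u x" .
qed

lemma kop_pairing:
  assumes "nsum (\<lambda>x. nsum (\<lambda>y. en (v x * (k x y * u y)))) < top"
  shows "(\<Sum>\<^sub>\<infinity>x. v x * kop k u x) = (\<Sum>\<^sub>\<infinity>y. kop (adj_kernel k) v y * u y)"
proof -
  have "(\<Sum>\<^sub>\<infinity>x. v x * kop k u x) = (\<Sum>\<^sub>\<infinity>x. \<Sum>\<^sub>\<infinity>y. v x * (k x y * u y))"
    by (simp add: kop_def infsum_cmult_right')
  also have "\<dots> = (\<Sum>\<^sub>\<infinity>y. \<Sum>\<^sub>\<infinity>x. v x * (k x y * u y))"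
    by (rule infsum_swap_absum[OF assms])
  also have "\<dots> = (\<Sum>\<^sub>\<infinity>y. kop (adj_kernel k) v y * u y)"
    by (simp add: kop_def adj_kernel_def infsum_cmult_right'[symmetric] mult_ac)
  finally show ?thesis .
qed

text \<open>Jensen's inequality in each row costs \<open>W powr (p - 1)\<close> and leaves the
  kernel to the first power; the column sums then contribute the last factor \<open>W\<close>. As
  \<open>v\<close> is only dominated, the test applies to pointwise estimates and not just to
  \<open>kop k u\<close>.\<close>

lemma schur_test:
  assumes p: "1 \<le> p" and W: "0 \<le> W"
    and row: "\<And>x. nsum (\<lambda>y. en (k x y)) \<le> ennreal W"
    and col: "\<And>y. nsum (\<lambda>x. en (k x y)) \<le> ennreal W"
    and le: "\<And>x. en (v x) \<le> nsum (\<lambda>y. ennreal (norm (k x y) * norm (u y)))"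
  shows "pn p v \<le> ennreal (W powr p) * pn p u"
proof -
  have "pn p v \<le> nsum (\<lambda>x. ennreal (W powr (p - 1)) * nsum (\<lambda>y. ennreal (norm (k x y) * norm (u y) powr p)))"
    unfolding pn_def
    by (intro nn_integral_mono weighted_power_mean p row W le) auto
  also have "\<dots> = ennreal (W powr (p - 1)) * nsum (\<lambda>x. nsum (\<lambda>y. ennreal (norm (k x y) * norm (u y) powr p)))"
    by (simp add: nn_integral_cmult)
  also have "nsum (\<lambda>x. nsum (\<lambda>y. ennreal (norm (k x y) * norm (u y) powr p)))
      = nsum (\<lambda>y. nsum (\<lambda>x. ennreal (norm (k x y) * norm (u y) powr p)))"
    by (rule nsum_swap)
  also have "\<dots> = nsum (\<lambda>y. nsum (\<lambda>x. en (k x y)) * ennreal (norm (u y) powr p))"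
    by (simp add: ennreal_mult nn_integral_multc)
  also have "\<dots> \<le> nsum (\<lambda>y. ennreal W * ennreal (norm (u y) powr p))"
    by (intro nn_integral_mono mult_right_mono col) simp
  also have "\<dots> = ennreal W * pn p u"
    by (simp add: pn_def nn_integral_cmult)
  finally have "pn p v \<le> ennreal (W powr (p - 1)) * (ennreal W * pn p u)"
    by (simp add: mult_left_mono)
  also have "\<dots> = ennreal (W powr p) * pn p u"
  proof -
    have "W powr (p - 1) * W = W powr p"
      using W powr_mult_base[of W "p - 1"] by (simp add: mult.commute)
    then show ?thesis using W by (simp add: mult.assoc[symmetric] ennreal_mult[symmetric])
  qed
  finally show ?thesis .
qed

lemma pn_kop_le:
  assumes "1 \<le> p" "0 \<le> W"
    "\<And>x. nsum (\<lambda>y. en (k x y)) \<le> ennreal W" "\<And>y. nsum (\<lambda>x. en (k x y)) \<le> ennreal W"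
  shows "pn p (kop k u) \<le> ennreal (W powr p) * pn p u"
  by (rule schur_test) (use assms in \<open>auto intro: en_kop_le\<close>)

end

subsection \<open>Slowly varying weights\<close>

lemma nsum_tail:
  assumes "nsum f < top" "0 < e"
  shows "\<exists>S. finite S \<and> nsum (\<lambda>x. if x \<in> S then 0 else f x) \<le> ennreal e"
proof -
  define r where "r x = enn2real (f x)" for x
  have fr: "f x = ennreal (r x)" for x
    using le_less_trans[OF nsum_ge assms(1), of x] by (simp add: r_def)
  have r0: "0 \<le> r x" for x by (simp add: r_def)
  have "r summable_on UNIV"
    using assms(1) r0 by (simp add: summable_on_nonneg_iff(1) flip: fr)
  then have "(r has_sum infsum r UNIV) UNIV" by simp
  then have "\<forall>\<^sub>F S in finite_subsets_at_top UNIV. dist (sum r S) (infsum r UNIV) < e"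
    unfolding has_sum_def using assms(2) by (rule tendstoD)
  then obtain S where S: "finite S" "dist (sum r S) (infsum r UNIV) < e"
    by (metis (mono_tags, lifting) eventually_finite_subsets_at_top subset_UNIV subset_refl)
  have "nsum f = nsum (\<lambda>x. (if x \<in> S then f x else 0) + (if x \<in> S then 0 else f x))"
    by (rule nn_integral_cong) auto
  also have "\<dots> = nsum (\<lambda>x. if x \<in> S then f x else 0) + nsum (\<lambda>x. if x \<in> S then 0 else f x)"
    by (simp add: nn_integral_add)
  also have "nsum (\<lambda>x. if x \<in> S then f x else 0) = ennreal (sum r S)"
    using S(1) r0 by (subst nsum_finite_support[of S]) (auto simp: fr)
  finally have 1: "nsum f = ennreal (sum r S) + nsum (\<lambda>x. if x \<in> S then 0 else f x)" .
  have "nsum f = ennreal (infsum r UNIV)"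
    using assms(1) r0 by (simp add: summable_on_nonneg_iff(2) flip: fr)
  also have "\<dots> \<le> ennreal (sum r S + e)"
    using S(2) by (intro ennreal_leI) (simp add: dist_real_def)
  also have "\<dots> = ennreal (sum r S) + ennreal e"
    using assms(2) r0 by (intro ennreal_plus) (auto intro: sum_nonneg)
  finally show ?thesis
    using S(1) 1 by (intro exI[of _ S]) (simp add: ennreal_add_left_cancel_le)
qed

lemma summable_exp_int:
  assumes "0 < t"
  shows "(\<lambda>m::int. exp (- t * \<bar>real_of_int m\<bar>)) summable_on UNIV"
proof -
  let ?f = "\<lambda>m::int. exp (- t * \<bar>real_of_int m\<bar>)"
  have g: "(\<lambda>n::nat. exp (- t) ^ n) summable_on UNIV"
    using assms by (intro norm_summable_imp_summable_on) (simp add: summable_geometric norm_power)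
  have e: "exp (- t) ^ n = exp (- t * real n)" for n
    by (simp add: exp_of_nat_mult[symmetric] mult.commute)
  have "?f summable_on range int"
    by (subst summable_on_reindex) (use g e in \<open>auto simp: o_def\<close>)
  moreover have "?f summable_on range (\<lambda>n. - int n)"
    by (subst summable_on_reindex) (use g e in \<open>auto simp: o_def inj_on_def\<close>)
  ultimately have "?f summable_on (range int \<union> range (\<lambda>n. - int n))"
    by (rule summable_on_union)
  moreover have "range int \<union> range (\<lambda>n. - int n) = UNIV"
    by (auto, metis int_cases2 rangeI)
  ultimately show ?thesis by simp
qed

text \<open>The exponential of the l^1 length factorizes over the coordinates, so the sum is a
  product of one-dimensional sums.\<close>

lemma summable_exp_vec:
  assumes "0 < t"
  shows "(\<lambda>\<delta>::int^'n. exp (- t * (\<Sum>i\<in>UNIV. \<bar>real_of_int (\<delta> $ i)\<bar>))) summable_on UNIV"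
proof -
  let ?e = "\<lambda>(i::'n) (m::int). exp (- t * \<bar>real_of_int m\<bar>)"
  have "integrable (count_space UNIV) (?e i)" for i :: 'n
    using abs_summable_equivalent[of "?e i" UNIV] summable_exp_int[OF assms] by (simp add: abs_summable_on_def)
  then have "integrable (count_space (PiE UNIV (\<lambda>_::'n. UNIV))) (\<lambda>g. \<Prod>i\<in>UNIV. ?e i (g i))"
    using abs_summable_on_prod_PiE[of "UNIV :: 'n set" "\<lambda>_. UNIV" ?e]
    by (simp add: abs_summable_on_def)
  then have "(\<lambda>g. \<Prod>i\<in>UNIV. ?e i (g i)) summable_on (UNIV :: ('n \<Rightarrow> int) set)"
    using abs_summable_equivalent[of "\<lambda>g. \<Prod>i\<in>UNIV. ?e i (g i)" "UNIV :: ('n \<Rightarrow> int) set"]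
    by (simp add: abs_summable_on_def PiE_UNIV_domain prod_nonneg abs_prod)
  moreover have "bij_betw (\<lambda>\<delta>::int^'n. \<lambda>i. \<delta> $ i) UNIV UNIV"
    by (rule bij_betwI[of _ _ _ vec_lambda]) (auto simp: vec_eq_iff)
  ultimately have "(\<lambda>\<delta>::int^'n. \<Prod>i\<in>UNIV. ?e i (\<delta> $ i)) summable_on UNIV"
    using summable_on_reindex_bij_betw[of "\<lambda>\<delta>::int^'n. \<lambda>i. \<delta> $ i" UNIV UNIV "\<lambda>g. \<Prod>i\<in>UNIV. ?e i (g i)"] by simp
  then show ?thesis
    by (simp add: exp_sum[symmetric] sum_distrib_left sum_negf)
qed

text \<open>The weight is \<open>exp (- t * l \<delta>)\<close> with \<open>l\<close> the l^1
  length. The triangle inequality for \<open>l\<close> bounds the ratio of its values at points that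
  differ by an element of \<Gamma>, and summability holds for every positive
  \<open>t\<close>.\<close>

lemma slow_weight:
  fixes \<Gamma> :: "(int^'n) set"
  assumes "finite \<Gamma>" "0 < \<eta>"
  shows "\<exists>\<psi> :: int^'n \<Rightarrow> real. \<psi> 0 = 1 \<and> (\<forall>\<delta>. 0 < \<psi> \<delta> \<and> \<psi> \<delta> \<le> 1) \<and>
    nsum (\<lambda>\<delta>. ennreal (\<psi> \<delta>)) < top \<and> (\<forall>\<gamma>\<in>\<Gamma>. \<forall>\<delta>. \<bar>\<psi> (\<delta> + \<gamma>) - \<psi> \<delta>\<bar> \<le> \<eta> * \<psi> \<delta>)"
proof -
  define l where "l \<delta> = (\<Sum>i\<in>UNIV. \<bar>real_of_int (\<delta> $ i)\<bar>)" for \<delta> :: "int^'n"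
  have l0: "0 \<le> l \<delta>" for \<delta> by (simp add: l_def sum_nonneg)
  have ltri: "l (\<delta> + \<gamma>) \<le> l \<delta> + l \<gamma>" for \<delta> \<gamma>
    unfolding l_def sum.distrib[symmetric] by (rule sum_mono) simp
  have lneg: "l (- \<gamma>) = l \<gamma>" for \<gamma> by (simp add: l_def)
  \<comment> \<open>A common bound of \<open>l\<close> on \<Gamma>, made positive by the added 1;
    below, \<open>t\<close> is chosen to give \<open>exp (t * M) = 1 + \<eta>\<close>.\<close>
  define M where "M = (\<Sum>\<gamma>\<in>\<Gamma>. l \<gamma>) + 1"
  have M: "0 < M" "\<And>\<gamma>. \<gamma> \<in> \<Gamma> \<Longrightarrow> l \<gamma> \<le> M"
    using l0 assms(1) member_le_sum[of _ \<Gamma> l] by (auto simp: M_def sum_nonneg add_nonneg_pos intro: add_increasing2)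
  define t where "t = ln (1 + \<eta>) / M"
  have t: "0 < t" "exp (t * M) = 1 + \<eta>" using M assms(2) by (auto simp: t_def)
  define \<psi> where "\<psi> \<delta> = exp (- t * l \<delta>)" for \<delta>
  have "\<bar>\<psi> (\<delta> + \<gamma>) - \<psi> \<delta>\<bar> \<le> \<eta> * \<psi> \<delta>" if "\<gamma> \<in> \<Gamma>" for \<gamma> \<delta>
  proof -
    have 1: "l (\<delta> + \<gamma>) \<le> l \<delta> + M" "l \<delta> \<le> l (\<delta> + \<gamma>) + M"
      using ltri[of \<delta> \<gamma>] ltri[of "\<delta> + \<gamma>" "- \<gamma>"] M(2)[OF that] lneg[of \<gamma>] by auto
    have "\<psi> (\<delta> + \<gamma>) \<le> exp (t * M - t * l \<delta>)"
      using mult_left_mono[OF 1(2), of t] t(1) by (simp add: \<psi>_def algebra_simps)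
    also have "\<dots> = (1 + \<eta>) * \<psi> \<delta>"
      using t(2) by (simp add: \<psi>_def exp_diff exp_minus divide_inverse)
    finally have up: "\<psi> (\<delta> + \<gamma>) \<le> (1 + \<eta>) * \<psi> \<delta>" .
    have "exp (- (t * M)) * \<psi> \<delta> \<le> \<psi> (\<delta> + \<gamma>)"
      using mult_left_mono[OF 1(1), of t] t(1) by (simp add: \<psi>_def exp_add[symmetric] algebra_simps)
    \<comment> \<open>This is \<open>(1 - \<eta>) * (1 + \<eta>) \<le> 1\<close>.\<close>
    moreover have "1 - \<eta> \<le> exp (- (t * M))"
      using t(2) assms(2) by (simp add: exp_minus field_simps)
    then have "(1 - \<eta>) * \<psi> \<delta> \<le> exp (- (t * M)) * \<psi> \<delta>"
      by (rule mult_right_mono) (simp add: \<psi>_def)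
    ultimately show ?thesis using up by (simp add: algebra_simps abs_le_iff)
  qed
  moreover have "nsum (\<lambda>\<delta>. ennreal (\<psi> \<delta>)) < top"
    using summable_exp_vec[OF t(1)] by (subst (asm) summable_on_nonneg_iff(1)) (auto simp: \<psi>_def l_def)
  moreover have "\<psi> 0 = 1" by (simp add: \<psi>_def l_def)
  moreover have "0 < \<psi> \<delta> \<and> \<psi> \<delta> \<le> 1" for \<delta>
    using t(1) l0 by (simp add: \<psi>_def)
  ultimately show ?thesis by blast
qed

text \<open>Iteration produces a Neumann series: \<open>G\<close> is the sum of all convolution
  powers of \<epsilon>, has mass at most 2, and is independent of \<open>a\<close> and
  \<open>b\<close>. Boundedness of \<open>a\<close> makes the remainder after \<open>m\<close> steps
  at most \<open>(1/2) ^ m * U\<close>.\<close>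

lemma neumann_domination:
  fixes \<epsilon> :: "'g::ab_group_add \<Rightarrow> ennreal"
  assumes "nsum \<epsilon> \<le> ennreal (1/2)"
  obtains G where "nsum G < top"
    "\<And>a b U \<alpha>. U < top \<Longrightarrow> (\<And>\<alpha>. a \<alpha> \<le> U) \<Longrightarrow> (\<And>\<alpha>. a \<alpha> \<le> b \<alpha> + conv \<epsilon> a \<alpha>) \<Longrightarrow> a \<alpha> \<le> conv G b \<alpha>"
proof -
  define e where "e = rec_nat (\<lambda>\<gamma>::'g. if \<gamma> = 0 then 1 else 0 :: ennreal) (\<lambda>_ f. conv f \<epsilon>)"
  have e0: "e 0 = (\<lambda>\<gamma>. if \<gamma> = 0 then 1 else 0)" and eS: "e (Suc n) = conv (e n) \<epsilon>" for n
    by (simp_all add: e_def)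
  define G where "G \<gamma> = (\<Sum>n. e n \<gamma>)" for \<gamma>
  have ne: "nsum (e n) \<le> ennreal ((1/2) ^ n)" for n
  proof (induction n)
    case 0
    show ?case using nsum_single[of "0::'g" "\<lambda>_. 1 :: ennreal"] by (simp add: e0)
  next
    case (Suc n)
    have "nsum (e (Suc n)) \<le> ennreal ((1/2) ^ n) * ennreal (1/2)"
      unfolding eS nsum_conv by (rule mult_mono[OF Suc assms]) auto
    also have "\<dots> = ennreal ((1/2) ^ Suc n)"
      by (subst ennreal_mult[symmetric]) (auto simp: mult.commute)
    finally show ?case .
  qed
  have "nsum G = (\<Sum>n. nsum (e n))"
    unfolding G_def by (rule nn_integral_suminf) simp
  also have "\<dots> \<le> (\<Sum>n. ennreal ((1/2) ^ n))"
    by (rule suminf_le) (auto simp: ne)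
  also have "\<dots> = ennreal (\<Sum>n. (1/2) ^ n)"
    by (rule suminf_ennreal2) auto
  also have "\<dots> < top" by simp
  finally have G: "nsum G < top" .
  moreover have "a \<alpha> \<le> conv G b \<alpha>"
    if U: "U < top" and aU: "\<And>\<alpha>. a \<alpha> \<le> U" and rec: "\<And>\<alpha>. a \<alpha> \<le> b \<alpha> + conv \<epsilon> a \<alpha>" for a b U \<alpha>
  proof -
    have step: "a \<alpha> \<le> (\<Sum>n<m. conv (e n) b \<alpha>) + conv (e m) a \<alpha>" for m
    proof (induction m)
      case 0
      have "conv (e 0) a \<alpha> = nsum (\<lambda>\<beta>. if \<beta> = 0 then a (\<alpha> - \<beta>) else 0)"
        unfolding conv_def by (rule nn_integral_cong) (simp add: e0)
      then show ?case by (simp add: nsum_single)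
    next
      case (Suc m)
      have "conv (e m) a \<alpha> \<le> conv (e m) (\<lambda>\<alpha>. b \<alpha> + conv \<epsilon> a \<alpha>) \<alpha>"
        by (rule conv_mono) (auto simp: rec)
      also have "\<dots> = conv (e m) b \<alpha> + conv (e m) (conv \<epsilon> a) \<alpha>"
        by (simp add: conv_def distrib_left nn_integral_add)
      also have "conv (e m) (conv \<epsilon> a) = conv (e (Suc m)) a"
        by (simp add: conv_assoc eS)
      finally show ?case
        using Suc by (simp add: add.assoc) (meson add_left_mono order_trans)
    qed
    have "a \<alpha> \<le> conv G b \<alpha> + ennreal ((1/2) ^ m) * U" for m
    proof -
      have "(\<Sum>n<m. conv (e n) b \<alpha>) \<le> (\<Sum>n. conv (e n) b \<alpha>)"
        by (rule sum_le_suminf) auto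
      also have "\<dots> = conv G b \<alpha>"
        by (simp add: conv_def G_def nn_integral_suminf[symmetric])
      finally have 1: "(\<Sum>n<m. conv (e n) b \<alpha>) \<le> conv G b \<alpha>" .
      have "conv (e m) a \<alpha> \<le> nsum (\<lambda>\<beta>. e m \<beta> * U)"
        unfolding conv_def by (intro nn_integral_mono mult_left_mono aU) simp
      also have "\<dots> = nsum (e m) * U" by (simp add: nn_integral_multc)
      also have "\<dots> \<le> ennreal ((1/2) ^ m) * U" by (rule mult_right_mono[OF ne]) simp
      finally show ?thesis using step[of m] 1 by (meson add_mono order_trans)
    qed
    note bound = this
    show ?thesis
    proof (rule ennreal_le_epsilon)
      fix d :: real assume d: "0 < d"
      obtain r where r: "0 \<le> r" "U = ennreal r" using U by (cases U) auto
      obtain m where "(1/2::real) ^ m < d / (r + 1)"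
        using real_arch_pow_inv[of "d / (r + 1)" "1/2"] d r by auto
      then have "(1/2::real) ^ m * (r + 1) < d"
        using r by (simp add: pos_less_divide_eq)
      moreover have "(1/2::real) ^ m * r \<le> (1/2) ^ m * (r + 1)"
        by (rule mult_left_mono) auto
      ultimately have "(1/2::real) ^ m * r \<le> d" by linarith
      then have "ennreal ((1/2) ^ m) * U \<le> ennreal d"
        unfolding r(2) by (subst ennreal_mult[symmetric]) (use r in \<open>auto intro!: ennreal_leI\<close>)
      then show "a \<alpha> \<le> conv G b \<alpha> + ennreal d"
        using bound[of m] by (meson add_left_mono order_trans)
    qed
  qed
  ultimately show ?thesis by (rule that)
qed

subsection \<open>Lower bounds\<close>

text \<open>The number \<open>t\<close> stands for the supremum norm of \<open>kop k u\<close>;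
  quantifying over upper bounds avoids handling suprema.\<close>

definition LBinf :: "'x set \<Rightarrow> ('x \<Rightarrow> 'x \<Rightarrow> complex) \<Rightarrow> bool" where
  "LBinf Y k \<longleftrightarrow> (\<exists>c>0. \<forall>u t. bdd u \<longrightarrow> (\<forall>x. x \<notin> Y \<longrightarrow> u x = 0) \<longrightarrow>
     (\<forall>x. norm (kop k u x) \<le> t) \<longrightarrow> (\<forall>x. c * norm (u x) \<le> t))"

text \<open>Finite supports are the cheapest class to test; truncation extends the bound to all of
  l^p on \<open>Y\<close> in \<open>LBp_extend\<close>.\<close>

definition LBp :: "real \<Rightarrow> 'x set \<Rightarrow> ('x \<Rightarrow> 'x \<Rightarrow> complex) \<Rightarrow> bool" where
  "LBp p Y k \<longleftrightarrow> (\<exists>c>0. \<forall>u. finite {x. u x \<noteq> 0} \<longrightarrow> (\<forall>x. x \<notin> Y \<longrightarrow> u x = 0) \<longrightarrow>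
     ennreal c * pn p u \<le> pn p (kop k u))"

text \<open>The crude constant is good enough wherever only finiteness or some unspecified constant
  matters; the sharp triangle inequality is \<open>lp_norm_triangle\<close>.\<close>

lemma pn_add_le:
  assumes "1 \<le> p"
  shows "pn p (\<lambda>x. u x + v x) \<le> ennreal (2 powr p) * (pn p u + pn p v)"
proof -
  have "ennreal (norm (u x + v x) powr p) \<le> ennreal (2 powr p) * (ennreal (norm (u x) powr p) + ennreal (norm (v x) powr p))" for x
  proof -
    let ?m = "max (norm (u x)) (norm (v x))"
    have "norm (u x + v x) \<le> 2 * ?m"
      using norm_triangle_ineq[of "u x" "v x"] by linarith
    then have "norm (u x + v x) powr p \<le> (2 * ?m) powr p"
      using assms by (intro powr_mono2) auto
    also have "\<dots> = 2 powr p * ?m powr p"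
      by (simp add: powr_mult)
    also have "\<dots> \<le> 2 powr p * (norm (u x) powr p + norm (v x) powr p)"
      by (intro mult_left_mono) (auto simp: max_def)
    finally have "ennreal (norm (u x + v x) powr p) \<le> ennreal (2 powr p * (norm (u x) powr p + norm (v x) powr p))"
      by (rule ennreal_leI)
    then show ?thesis by (simp add: ennreal_mult)
  qed
  then have "pn p (\<lambda>x. u x + v x) \<le> nsum (\<lambda>x. ennreal (2 powr p) * (ennreal (norm (u x) powr p) + ennreal (norm (v x) powr p)))"
    unfolding pn_def by (rule nn_integral_mono)
  then show ?thesis
    by (simp add: pn_def nn_integral_cmult nn_integral_add)
qed

lemma bdd_pn:
  assumes "pn p u < top" "0 < p"
  shows "bdd u"
proof -
  have "norm (u x) \<le> enn2real (pn p u) powr (1/p)" for x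
  proof -
    have "ennreal (norm (u x) powr p) \<le> pn p u"
      unfolding pn_def by (rule nsum_ge)
    then have "norm (u x) powr p \<le> enn2real (pn p u)"
      using assms(1) by (metis enn2real_ennreal enn2real_mono powr_ge_zero)
    then have "(norm (u x) powr p) powr (1/p) \<le> enn2real (pn p u) powr (1/p)"
      using assms(2) by (intro powr_mono2) auto
    then show ?thesis using assms(2) by (simp add: powr_powr)
  qed
  then show ?thesis by (rule bddI)
qed

context cells
begin

text \<open>The subtracted sum is the commutator of the operator with multiplication by
  \<open>f\<close>. It is the error made when a lower bound is applied to a weighted
  function.\<close>

lemma kop_weight:
  assumes k: "Wk k" and u: "bdd u" and f: "\<And>x. \<bar>f x\<bar> \<le> (1::real)"
  shows "kop k (\<lambda>y. of_real (f y) * u y) x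
    = of_real (f x) * kop k u x - (\<Sum>\<^sub>\<infinity>y. k x y * (of_real (f x - f y) * u y))"
proof -
  have b: "bdd (\<lambda>y. of_real (f y) * u y)"
    using f by (intro bdd_mono[OF u]) (simp add: norm_mult mult_left_le_one_le)
  have "(\<Sum>\<^sub>\<infinity>y. k x y * (of_real (f x - f y) * u y)) = kop k (\<lambda>y. of_real (f x) * u y - of_real (f y) * u y) x"
    by (simp add: kop_def algebra_simps)
  also have "\<dots> = of_real (f x) * kop k u x - kop k (\<lambda>y. of_real (f y) * u y) x"
    by (simp add: kop_diff[OF k bdd_cmult[OF u] b] kop_cmult)
  finally show ?thesis by simp
qed

lemma small_tail:
  assumes "nsum h < top" "0 < e"
  shows "\<exists>\<Gamma>. finite \<Gamma> \<and> of_nat N * nsum (\<lambda>\<gamma>. if \<gamma> \<in> \<Gamma> then 0 else h \<gamma>) \<le> ennreal e"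
proof -
  \<comment> \<open>Dividing by \<open>real N + 1\<close> absorbs the factor \<open>N\<close> also
    when \<open>N\<close> is 0.\<close>
  obtain \<Gamma> where G: "finite \<Gamma>" "nsum (\<lambda>x. if x \<in> \<Gamma> then 0 else h x) \<le> ennreal (e / (real N + 1))"
    using nsum_tail[OF assms(1), of "e / (real N + 1)"] assms(2) by auto
  have "of_nat N * nsum (\<lambda>\<gamma>. if \<gamma> \<in> \<Gamma> then 0 else h \<gamma>) \<le> ennreal (real N) * ennreal (e / (real N + 1))"
    unfolding ennreal_of_nat_eq_real_of_nat by (rule mult_left_mono[OF G(2)]) simp
  also have "\<dots> = ennreal (real N * (e / (real N + 1)))"
    using assms(2) by (subst ennreal_mult) auto
  also have "\<dots> \<le> ennreal e"
    using assms(2) by (intro ennreal_leI) (simp add: field_simps)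
  finally show ?thesis using G(1) by blast
qed

text \<open>With slowly varying weights centred at \<open>\<alpha>\<close>, the suprema \<open>a \<alpha>\<close> of the weighted function satisfy
  \<open>a \<le> b + \<epsilon> * a\<close> where \<open>\<epsilon>\<close> has small mass: near the diagonal the weights vary little, and far from
  it the kernel has little mass.\<close>

theorem LBinf_domination:
  assumes dk: "domk h k" and lb: "LBinf Y k"
  obtains g where "nsum g < top"
    "\<And>u x. bdd u \<Longrightarrow> (\<And>x. x \<notin> Y \<Longrightarrow> u x = 0) \<Longrightarrow> en (u x) \<le> nsum (\<lambda>y. g (\<pi> x - \<pi> y) * en (kop k u y))"
proof -
  have Wkk: "Wk k" using dk by (auto simp: Wk_def)
  obtain c where c: "0 < c" and lb: "\<And>u t x. bdd u \<Longrightarrow> (\<And>x. x \<notin> Y \<Longrightarrow> u x = 0) \<Longrightarrow>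
     (\<And>x. norm (kop k u x) \<le> t) \<Longrightarrow> c * norm (u x) \<le> t"
    using lb unfolding LBinf_def by blast
  obtain W where W: "0 < W" "of_nat N * nsum h \<le> ennreal W" using domk_total[OF dk] by metis
  have hfin: "nsum h < top" using dk by (simp add: domk_def)
  \<comment> \<open>Half of \<open>c\<close> is reserved for errors proportional to
    \<open>a \<alpha>\<close>: one quarter for the part of the kernel far from the diagonal, fixed
    here, and one quarter for the variation of the weights near it, fixed through \<eta>.\<close>
  obtain \<Gamma> where \<Gamma>: "finite \<Gamma>" "of_nat N * nsum (\<lambda>\<gamma>. if \<gamma> \<in> \<Gamma> then 0 else h \<gamma>) \<le> ennreal (c/4)"
    using small_tail[OF hfin, of "c/4"] c by auto
  define h' where "h' \<gamma> = (if \<gamma> \<in> \<Gamma> then 0 else h \<gamma>)" for \<gamma>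
  have h': "of_nat N * nsum h' \<le> ennreal (c/4)" using \<Gamma>(2) by (simp add: h'_def[abs_def])
  define \<eta> where "\<eta> = c / (4 * W)"
  have \<eta>: "0 < \<eta>" "W * \<eta> = c/4" using c W by (auto simp: \<eta>_def)
  obtain \<psi> :: "int^'n \<Rightarrow> real" where \<psi>: "\<psi> 0 = 1" "\<And>\<delta>. 0 < \<psi> \<delta>" "\<And>\<delta>. \<psi> \<delta> \<le> 1"
    "nsum (\<lambda>\<delta>. ennreal (\<psi> \<delta>)) < top" "\<And>\<gamma> \<delta>. \<gamma> \<in> \<Gamma> \<Longrightarrow> \<bar>\<psi> (\<delta> + \<gamma>) - \<psi> \<delta>\<bar> \<le> \<eta> * \<psi> \<delta>"
    using slow_weight[OF \<Gamma>(1) \<eta>(1)] by blast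
  \<comment> \<open>The factor \<open>2/c\<close> comes from dividing the final inequality by the
    remaining \<open>c/2\<close>; together with the quarter above it gives mass at most 1/2.\<close>
  define \<epsilon> where "\<epsilon> \<gamma> = ennreal (2/c) * (of_nat N * h' \<gamma>)" for \<gamma>
  have "nsum \<epsilon> = ennreal (2/c) * (of_nat N * nsum h')"
    by (simp add: \<epsilon>_def nn_integral_cmult)
  also have "\<dots> \<le> ennreal (2/c) * ennreal (c/4)"
    by (rule mult_left_mono[OF h']) simp
  also have "\<dots> = ennreal (1/2)"
    using c by (subst ennreal_mult[symmetric]) auto
  finally have "nsum \<epsilon> \<le> ennreal (1/2)" .
  then obtain G where G: "nsum G < top" "\<And>a b U \<alpha>. U < top \<Longrightarrow> (\<And>\<alpha>. a \<alpha> \<le> U) \<Longrightarrow> (\<And>\<alpha>. a \<alpha> \<le> b \<alpha> + conv \<epsilon> a \<alpha>) \<Longrightarrow> a \<alpha> \<le> conv G b \<alpha>"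
    using neumann_domination by metis
  \<comment> \<open>The right side of the recursion is a sum of weighted values of
    \<open>kop k u\<close>. Exchanging it with the convolution by \<open>G\<close> collects the
    weights in this kernel.\<close>
  define g where "g \<gamma> = ennreal (2/c) * nsum (\<lambda>\<beta>. G \<beta> * ennreal (\<psi> (\<beta> - \<gamma>)))" for \<gamma>
  have "nsum g = ennreal (2/c) * nsum (\<lambda>\<beta>. nsum (\<lambda>\<gamma>. G \<beta> * ennreal (\<psi> (\<beta> - \<gamma>))))"
    unfolding g_def by (simp add: nn_integral_cmult nsum_swap[of "\<lambda>\<gamma> \<beta>. G \<beta> * ennreal (\<psi> (\<beta> - \<gamma>))"])
  also have "\<dots> = ennreal (2/c) * (nsum G * nsum (\<lambda>\<delta>. ennreal (\<psi> \<delta>)))"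
    by (simp add: nn_integral_cmult nn_integral_multc nsum_reflect[of "\<lambda>\<delta>. ennreal (\<psi> \<delta>)"])
  also have "\<dots> < top" using G(1) \<psi>(4) by (simp add: ennreal_mult_less_top)
  finally have "nsum g < top" .
  moreover have "en (u x) \<le> nsum (\<lambda>y. g (\<pi> x - \<pi> y) * en (kop k u y))"
    if u: "bdd u" and uY: "\<And>x. x \<notin> Y \<Longrightarrow> u x = 0" for u x
  proof -
    obtain U where U: "0 < U" "\<And>x. norm (u x) \<le> U" using bdd_pos_bound[OF u] by metis
    obtain V where V: "0 < V" "\<And>x. norm (kop k u x) \<le> V"
      using bdd_pos_bound[OF bdd_kop[OF Wkk u]] by metis
    define f where "f \<alpha> x = \<psi> (\<pi> x - \<alpha>)" for \<alpha> x
    define a where "a \<alpha> = (SUP x. ennreal (f \<alpha> x * norm (u x)))" for \<alpha>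
    define b where "b \<alpha> = nsum (\<lambda>y. ennreal (f \<alpha> y * norm (kop k u y)))" for \<alpha>
    have f01: "0 < f \<alpha> x" "f \<alpha> x \<le> 1" for \<alpha> x using \<psi> by (auto simp: f_def)
    have fabs: "\<bar>f \<alpha> x\<bar> \<le> 1" for \<alpha> x using f01[of \<alpha> x] by simp
    have ale: "ennreal (f \<alpha> x * norm (u x)) \<le> a \<alpha>" for \<alpha> x
      unfolding a_def by (rule SUP_upper) simp
    have aU: "a \<alpha> \<le> ennreal U" for \<alpha>
      unfolding a_def
    proof (rule SUP_least, rule ennreal_leI)
      fix x show "f \<alpha> x * norm (u x) \<le> U"
        using mult_mono[of "f \<alpha> x" 1 "norm (u x)" U] f01[of \<alpha> x] U by auto
    qed
    have bfin: "b \<alpha> < top" for \<alpha>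
    proof -
      have "b \<alpha> \<le> nsum (\<lambda>y. ennreal (\<psi> (\<pi> y - \<alpha>)) * ennreal V)"
        unfolding b_def using V \<psi>(2)
        by (intro nn_integral_mono) (auto simp: f_def ennreal_mult[symmetric] less_imp_le intro!: ennreal_leI mult_left_mono)
      also have "\<dots> = nsum (\<lambda>y. ennreal (\<psi> (\<pi> y - \<alpha>))) * ennreal V"
        by (rule nn_integral_multc) simp
      also have "\<dots> \<le> (of_nat N * nsum (\<lambda>\<delta>. ennreal (\<psi> \<delta>))) * ennreal V"
        by (rule mult_right_mono[OF nsum_col]) simp
      also have "\<dots> < top" using \<psi>(4) by (simp add: ennreal_mult_less_top)
      finally show ?thesis .
    qed
    have comm: "nsum (\<lambda>y. ennreal (norm (k x y) * (\<bar>f \<alpha> x - f \<alpha> y\<bar> * norm (u y))))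
        \<le> ennreal (c/2) * a \<alpha> + of_nat N * conv h' a \<alpha>" for x \<alpha>
    proof -
      \<comment> \<open>The terms account for the variation of the weight when \<gamma> lies in
        \<Gamma> and, otherwise, for the weight at \<open>y\<close> and the weight at
        \<open>x\<close>.\<close>
      define F where "F \<gamma> = (ennreal \<eta> * a \<alpha>) * h \<gamma> + a \<alpha> * h' \<gamma> + h' \<gamma> * a (\<alpha> - \<gamma>)" for \<gamma>
      have "ennreal (norm (k x y) * (\<bar>f \<alpha> x - f \<alpha> y\<bar> * norm (u y))) \<le> F (\<pi> x - \<pi> y)" for y
      proof -
        define \<gamma> where "\<gamma> = \<pi> x - \<pi> y"
        have kh: "en (k x y) \<le> h \<gamma>" using dk by (simp add: domk_def \<gamma>_def)
        \<comment> \<open>The weight at \<open>x\<close> is, seen from \<open>y\<close>, the weight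
          with centre moved by \<gamma>. This turns the far terms into the convolution of
          \<open>h'\<close> with \<open>a\<close>.\<close>
        have fx: "f \<alpha> x = \<psi> ((\<pi> y - \<alpha>) + \<gamma>)" "f \<alpha> x = f (\<alpha> - \<gamma>) y"
          by (simp_all add: f_def \<gamma>_def algebra_simps)
        show ?thesis
        proof (cases "\<gamma> \<in> \<Gamma>")
          case True
          have "\<bar>f \<alpha> x - f \<alpha> y\<bar> \<le> \<eta> * f \<alpha> y"
            using \<psi>(5)[OF True, of "\<pi> y - \<alpha>"] by (simp add: fx(1)) (simp add: f_def)
          then have "\<bar>f \<alpha> x - f \<alpha> y\<bar> * norm (u y) \<le> \<eta> * (f \<alpha> y * norm (u y))"
            by (metis mult.assoc mult_right_mono norm_ge_zero)
          then have "ennreal (\<bar>f \<alpha> x - f \<alpha> y\<bar> * norm (u y)) \<le> ennreal \<eta> * ennreal (f \<alpha> y * norm (u y))"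
            using \<eta>(1) by (simp add: ennreal_mult'[symmetric] ennreal_leI)
          also have "\<dots> \<le> ennreal \<eta> * a \<alpha>" by (rule mult_left_mono[OF ale]) simp
          finally have "en (k x y) * ennreal (\<bar>f \<alpha> x - f \<alpha> y\<bar> * norm (u y)) \<le> h \<gamma> * (ennreal \<eta> * a \<alpha>)"
            by (intro mult_mono kh) auto
          also have "\<dots> \<le> F \<gamma>" by (simp add: F_def mult_ac add_increasing2)
          finally show ?thesis by (simp add: ennreal_mult' \<gamma>_def)
        next
          case False
          have "\<bar>f \<alpha> x - f \<alpha> y\<bar> \<le> f \<alpha> y + f (\<alpha> - \<gamma>) y"
            using f01[of \<alpha> x] f01[of \<alpha> y] fx(2) by linarith
          then have "\<bar>f \<alpha> x - f \<alpha> y\<bar> * norm (u y) \<le> f \<alpha> y * norm (u y) + f (\<alpha> - \<gamma>) y * norm (u y)"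
            by (metis distrib_right mult_right_mono norm_ge_zero)
          then have "ennreal (\<bar>f \<alpha> x - f \<alpha> y\<bar> * norm (u y)) \<le> ennreal (f \<alpha> y * norm (u y)) + ennreal (f (\<alpha> - \<gamma>) y * norm (u y))"
            using f01[of \<alpha> y] f01[of "\<alpha> - \<gamma>" y] by (simp add: ennreal_plus[symmetric] ennreal_leI del: ennreal_plus)
          also have "\<dots> \<le> a \<alpha> + a (\<alpha> - \<gamma>)" by (intro add_mono ale)
          finally have "en (k x y) * ennreal (\<bar>f \<alpha> x - f \<alpha> y\<bar> * norm (u y)) \<le> h \<gamma> * (a \<alpha> + a (\<alpha> - \<gamma>))"
            by (intro mult_mono kh) auto
          also have "\<dots> \<le> F \<gamma>" using False by (simp add: F_def h'_def distrib_left mult_ac add_increasing add.assoc)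
          finally show ?thesis by (simp add: ennreal_mult' \<gamma>_def)
        qed
      qed
      then have "nsum (\<lambda>y. ennreal (norm (k x y) * (\<bar>f \<alpha> x - f \<alpha> y\<bar> * norm (u y)))) \<le> nsum (\<lambda>y. F (\<pi> x - \<pi> y))"
        by (rule nn_integral_mono)
      also have "\<dots> \<le> of_nat N * nsum F" by (rule nsum_row)
      also have "nsum F = (ennreal \<eta> * a \<alpha>) * nsum h + a \<alpha> * nsum h' + conv h' a \<alpha>"
        by (simp add: F_def conv_def nn_integral_add nn_integral_cmult)
      also have "of_nat N * \<dots> = (ennreal \<eta> * a \<alpha>) * (of_nat N * nsum h) + a \<alpha> * (of_nat N * nsum h') + of_nat N * conv h' a \<alpha>"
        by (simp add: distrib_left mult_ac)
      also have "\<dots> \<le> (ennreal \<eta> * a \<alpha>) * ennreal W + a \<alpha> * ennreal (c/4) + of_nat N * conv h' a \<alpha>"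
        by (intro add_mono mult_left_mono W h') auto
      also have "(ennreal \<eta> * a \<alpha>) * ennreal W = a \<alpha> * (ennreal W * ennreal \<eta>)" by (simp add: mult_ac)
      also have "ennreal W * ennreal \<eta> = ennreal (c/4)"
        using W \<eta> by (subst ennreal_mult[symmetric]) auto
      also have "a \<alpha> * ennreal (c/4) + a \<alpha> * ennreal (c/4) = a \<alpha> * (ennreal (c/4) + ennreal (c/4))"
        by (simp add: distrib_left)
      also have "ennreal (c/4) + ennreal (c/4) = ennreal (c/2)"
        using c by (subst ennreal_plus[symmetric]) auto
      finally show ?thesis by (simp add: mult.commute)
    qed
    have convfin: "of_nat N * conv h' a \<alpha> < top" for \<alpha>
    proof -
      have "conv h' a \<alpha> \<le> nsum (\<lambda>\<beta>. h' \<beta> * ennreal U)"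
        unfolding conv_def by (intro nn_integral_mono mult_left_mono aU) simp
      also have "\<dots> = nsum h' * ennreal U" by (simp add: nn_integral_multc)
      finally have "of_nat N * conv h' a \<alpha> \<le> of_nat N * (nsum h' * ennreal U)" by (rule mult_left_mono) simp
      also have "\<dots> = (of_nat N * nsum h') * ennreal U" by (simp add: mult.assoc)
      also have "\<dots> \<le> ennreal (c/4) * ennreal U" by (rule mult_right_mono[OF h']) simp
      also have "\<dots> < top" by (simp add: ennreal_mult_less_top)
      finally show ?thesis .
    qed
    have rec: "a \<alpha> \<le> ennreal (2/c) * b \<alpha> + conv \<epsilon> a \<alpha>" for \<alpha>
    proof -
      define T where "T = b \<alpha> + (ennreal (c/2) * a \<alpha> + of_nat N * conv h' a \<alpha>)"
      have Tfin: "T < top" unfolding T_def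
        using bfin convfin le_less_trans[OF aU ennreal_less_top] by (simp add: ennreal_mult_less_top)
      let ?w = "\<lambda>y. of_real (f \<alpha> y) * u y"
      have kw: "norm (kop k ?w x) \<le> enn2real T" for x
      proof -
        let ?z = "\<Sum>\<^sub>\<infinity>y. k x y * (of_real (f \<alpha> x - f \<alpha> y) * u y)"
        have "kop k ?w x = of_real (f \<alpha> x) * kop k u x - ?z"
          by (rule kop_weight[OF Wkk u fabs])
        then have "norm (kop k ?w x) \<le> f \<alpha> x * norm (kop k u x) + norm ?z"
          using norm_triangle_ineq4[of "of_real (f \<alpha> x) * kop k u x" ?z] f01(1)[of \<alpha> x] by (simp add: norm_mult)
        then have "en (kop k ?w x) \<le> ennreal (f \<alpha> x * norm (kop k u x)) + en ?z"
          using f01(1)[of \<alpha> x] by (simp add: ennreal_plus[symmetric] ennreal_leI del: ennreal_plus)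
        also have "\<dots> \<le> T"
          unfolding T_def
        proof (rule add_mono)
          show "ennreal (f \<alpha> x * norm (kop k u x)) \<le> b \<alpha>" unfolding b_def by (rule nsum_ge)
          have "en ?z \<le> nsum (\<lambda>y. en (k x y * (of_real (f \<alpha> x - f \<alpha> y) * u y)))"
            by (rule en_infsum_le)
          also have "\<dots> = nsum (\<lambda>y. ennreal (norm (k x y) * (\<bar>f \<alpha> x - f \<alpha> y\<bar> * norm (u y))))"
            by (simp add: norm_mult del: of_real_diff)
          finally show "en ?z \<le> ennreal (c/2) * a \<alpha> + of_nat N * conv h' a \<alpha>" using comm order_trans by blast
        qed
        finally show ?thesis using Tfin by (metis enn2real_ennreal enn2real_mono norm_ge_zero)
      qed
      have "ennreal c * a \<alpha> \<le> T"
      proof -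
        have "ennreal c * ennreal (f \<alpha> x * norm (u x)) \<le> T" for x
        proof -
          have "c * norm (?w x) \<le> enn2real T"
            by (rule lb[OF _ _ kw]) (use fabs uY in \<open>auto simp: norm_mult intro!: bdd_mono[OF u] mult_left_le_one_le\<close>)
          then have "ennreal (c * (f \<alpha> x * norm (u x))) \<le> ennreal (enn2real T)"
            using f01(1)[of \<alpha> x] by (intro ennreal_leI) (simp add: norm_mult)
          then show ?thesis using Tfin c by (simp add: ennreal_mult')
        qed
        then show ?thesis unfolding a_def by (simp add: SUP_mult_left_ennreal SUP_le_iff)
      qed
      moreover have "ennreal c * a \<alpha> = ennreal (c/2) * a \<alpha> + ennreal (c/2) * a \<alpha>"
        using c by (simp add: distrib_right[symmetric] ennreal_plus[symmetric] del: ennreal_plus)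
      ultimately have "ennreal (c/2) * a \<alpha> + ennreal (c/2) * a \<alpha> \<le> ennreal (c/2) * a \<alpha> + (b \<alpha> + of_nat N * conv h' a \<alpha>)"
        by (simp add: T_def add_ac)
      \<comment> \<open>Finiteness is what permits the cancellation, and it comes from the
        boundedness of \<open>u\<close>.\<close>
      moreover have "ennreal (c/2) * a \<alpha> \<noteq> top"
        using le_less_trans[OF aU[of \<alpha>] ennreal_less_top] by (simp add: ennreal_mult_eq_top_iff)
      ultimately have "ennreal (c/2) * a \<alpha> \<le> b \<alpha> + of_nat N * conv h' a \<alpha>"
        by (simp add: ennreal_add_left_cancel_le)
      then have "ennreal (2/c) * (ennreal (c/2) * a \<alpha>) \<le> ennreal (2/c) * (b \<alpha> + of_nat N * conv h' a \<alpha>)"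
        by (rule mult_left_mono) simp
      moreover have "ennreal (2/c) * (ennreal (c/2) * a \<alpha>) = a \<alpha>"
        using c by (simp add: mult.assoc[symmetric] ennreal_mult'[symmetric] del: ennreal_divide_numeral)
      moreover have "ennreal (2/c) * (of_nat N * conv h' a \<alpha>) = conv \<epsilon> a \<alpha>"
        by (simp add: conv_def \<epsilon>_def nn_integral_cmult[symmetric] mult.assoc)
      ultimately show ?thesis by (simp add: distrib_left)
    qed
    have "en (u x) \<le> a (\<pi> x)" using ale[of "\<pi> x" x] \<psi>(1) by (simp add: f_def)
    also have "\<dots> \<le> conv G (\<lambda>\<alpha>. ennreal (2/c) * b \<alpha>) (\<pi> x)"
      by (rule G(2)[OF _ aU rec]) simp
    also have "\<dots> = nsum (\<lambda>\<beta>. nsum (\<lambda>y. ennreal (2/c) * G \<beta> * ennreal (\<psi> (\<beta> - (\<pi> x - \<pi> y))) * en (kop k u y)))"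
      unfolding conv_def b_def f_def using \<psi>(2)
      by (simp add: nn_integral_cmult[symmetric] ennreal_mult less_imp_le mult_ac algebra_simps)
    also have "\<dots> = nsum (\<lambda>y. nsum (\<lambda>\<beta>. ennreal (2/c) * G \<beta> * ennreal (\<psi> (\<beta> - (\<pi> x - \<pi> y))) * en (kop k u y)))"
      by (rule nsum_swap)
    also have "\<dots> = nsum (\<lambda>y. g (\<pi> x - \<pi> y) * en (kop k u y))"
      by (simp add: g_def nn_integral_cmult[symmetric] nn_integral_multc[symmetric] mult.assoc)
    finally show ?thesis .
  qed
  ultimately show ?thesis by (rule that)
qed

end

section \<open>From lower bounds on l^p to lower bounds on l^infinity\<close>

lemma ennreal_pos_bound:
  assumes "x < (top :: ennreal)"
  shows "\<exists>r>0. x \<le> ennreal r"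
proof -
  obtain r where "0 \<le> r" "x = ennreal r" using assms by (cases x) auto
  then show ?thesis by (intro exI[of _ "r + 1"]) (auto intro: ennreal_leI)
qed

lemma pn_cmult: "pn p (\<lambda>x. c * u x) = ennreal (norm c powr p) * pn p u"
  by (simp add: pn_def norm_mult powr_mult ennreal_mult nn_integral_cmult)

lemma pn_uminus: "pn p (\<lambda>x. - u x) = pn p u"
  by (simp add: pn_def)

lemma pn_mono: "0 \<le> p \<Longrightarrow> (\<And>x. norm (u x) \<le> norm (v x)) \<Longrightarrow> pn p u \<le> pn p v"
  unfolding pn_def by (intro nn_integral_mono ennreal_leI powr_mono2) auto

lemma pn_diff_le:
  assumes "1 \<le> p"
  shows "pn p (\<lambda>x. u x - v x) \<le> ennreal (2 powr p) * (pn p u + pn p v)"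
  using pn_add_le[OF assms, of u "\<lambda>x. - v x"] by (simp add: pn_uminus)

context cells
begin

text \<open>Truncate \<open>w\<close> to a finite set that carries nearly all of its
  \<open>p\<close>-mass; boundedness of the operator controls the discarded part. The factor
  \<open>2 powr p\<close> lost here stems from \<open>pn_diff_le\<close>.\<close>

lemma LBp_extend:
  assumes k: "Wk k" and p: "1 \<le> p" and lb: "LBp p Y k"
  shows "\<exists>c>0. \<forall>w. pn p w < top \<longrightarrow> (\<forall>x. x \<notin> Y \<longrightarrow> w x = 0) \<longrightarrow> ennreal c * pn p w \<le> pn p (kop k w)"
proof -
  obtain c where c: "0 < c" and lb: "\<And>u. finite {x. u x \<noteq> 0} \<Longrightarrow> (\<And>x. x \<notin> Y \<Longrightarrow> u x = 0) \<Longrightarrow> ennreal c * pn p u \<le> pn p (kop k u)"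
    using lb unfolding LBp_def by blast
  obtain W where W: "0 < W" "\<And>x. nsum (\<lambda>y. en (k x y)) \<le> ennreal W" "\<And>y. nsum (\<lambda>x. en (k x y)) \<le> ennreal W"
    using Wk_bounds[OF k] by metis
  \<comment> \<open>Collects the two ways in which the discarded part enters: through its image, and
    through the splitting of \<open>pn p w\<close>.\<close>
  define B where "B = 2 powr p * W powr p + c"
  have B: "0 < B" using c W by (simp add: B_def add_pos_pos)
  have "ennreal c * pn p w \<le> ennreal (2 powr p) * pn p (kop k w)"
    if w: "pn p w < top" and wY: "\<And>x. x \<notin> Y \<Longrightarrow> w x = 0" for w
  proof (rule ennreal_le_epsilon)
    fix e :: real assume e: "0 < e"
    have "0 < e / B" using e B by simp
    then obtain S where S: "finite S" "nsum (\<lambda>x. if x \<in> S then 0 else ennreal (norm (w x) powr p)) \<le> ennreal (e / B)"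
      using nsum_tail[OF w[unfolded pn_def]] by blast
    define v where "v x = (if x \<in> S then w x else 0)" for x
    define r where "r x = (if x \<in> S then 0 else w x)" for x
    have rs: "pn p r \<le> ennreal (e / B)"
    proof -
      have "pn p r = nsum (\<lambda>x. if x \<in> S then 0 else ennreal (norm (w x) powr p))"
        unfolding pn_def r_def using p by (intro nn_integral_cong) auto
      then show ?thesis using S(2) by simp
    qed
    have bw: "bdd w" using bdd_pn[OF w] p by simp
    have br: "bdd r" by (rule bdd_mono[OF bw]) (simp add: r_def)
    have vr: "v = (\<lambda>x. w x - r x)" by (auto simp: v_def r_def)
    have "pn p w = pn p v + pn p r"
      unfolding pn_def using p by (subst nn_integral_add[symmetric]) (auto intro!: nn_integral_cong simp: v_def r_def)
    then have "ennreal c * pn p w = ennreal c * pn p v + ennreal c * pn p r" by (simp add: distrib_left)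
    also have "ennreal c * pn p v \<le> pn p (kop k v)"
      by (rule lb) (use S wY in \<open>auto simp: v_def intro: finite_subset\<close>)
    also have "kop k v = (\<lambda>x. kop k w x - kop k r x)"
      unfolding vr by (rule kop_diff[OF k bw br])
    also have "pn p \<dots> \<le> ennreal (2 powr p) * (pn p (kop k w) + pn p (kop k r))"
      by (rule pn_diff_le[OF p])
    also have "pn p (kop k r) \<le> ennreal (W powr p) * pn p r"
      by (rule pn_kop_le) (use p W in auto)
    finally have "ennreal c * pn p w \<le> ennreal (2 powr p) * (pn p (kop k w) + ennreal (W powr p) * pn p r) + ennreal c * pn p r"
      by (simp add: mult_left_mono add_left_mono add_right_mono)
    also have "\<dots> = ennreal (2 powr p) * pn p (kop k w) + ennreal B * pn p r"
      using c W by (simp add: B_def distrib_left distrib_right ennreal_mult ennreal_plus mult.assoc add.assoc)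
    also have "ennreal B * pn p r \<le> ennreal B * ennreal (e / B)"
      by (rule mult_left_mono[OF rs]) simp
    also have "\<dots> = ennreal e" using B e by (subst ennreal_mult[symmetric]) auto
    finally show "ennreal c * pn p w \<le> ennreal (2 powr p) * pn p (kop k w) + ennreal e"
      by (simp add: add_left_mono)
  qed note main = this
  have "ennreal (c / 2 powr p) * pn p w \<le> pn p (kop k w)"
    if "pn p w < top" "\<And>x. x \<notin> Y \<Longrightarrow> w x = 0" for w
  proof -
    have "ennreal (1 / 2 powr p) * (ennreal c * pn p w) \<le> ennreal (1 / 2 powr p) * (ennreal (2 powr p) * pn p (kop k w))"
      by (rule mult_left_mono[OF main[OF that]]) auto
    then show ?thesis using c by (simp add: mult.assoc[symmetric] ennreal_mult'[symmetric])
  qed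
  then show ?thesis using c by (intro exI[of _ "c / 2 powr p"]) auto
qed

text \<open>A bounded \<open>u\<close> need not be \<open>p\<close>-summable, but its product with a
  translated summable weight is. The lower bound is applied to these products, and the commutator is
  absorbed by the supremum \<open>s\<close> of their \<open>p\<close>-masses over all centres. A
  weight equals 1 at its centre, so \<open>s\<close> controls each value of
  \<open>u\<close>.\<close>

theorem LBp_imp_LBinf:
  assumes dk: "domk h k" and p: "1 \<le> p" and lb: "LBp p Y k"
  shows "LBinf Y k"
proof -
  have Wkk: "Wk k" using dk by (auto simp: Wk_def)
  obtain c where c: "0 < c" and lb: "\<And>w. pn p w < top \<Longrightarrow> (\<And>x. x \<notin> Y \<Longrightarrow> w x = 0) \<Longrightarrow> ennreal c * pn p w \<le> pn p (kop k w)"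
    using LBp_extend[OF Wkk p lb] by blast
  obtain W where W: "0 < W" "of_nat N * nsum h \<le> ennreal W" using domk_total[OF dk] by metis
  have row: "nsum (\<lambda>y. en (k x y)) \<le> ennreal W" for x using domk_row[OF dk] W(2) by (rule order_trans)
  have hfin: "nsum h < top" using dk by (simp add: domk_def)
  \<comment> \<open>The commutator yields three terms of size \<open>d * s\<close>: variation of the
    weight near the diagonal and, far from it, the weights at both points. With the factors from
    \<open>pn_diff_le\<close> and Jensen's inequality they add up to
    \<open>c / 2 * s\<close>.\<close>
  define d where "d = c / (6 * 2 powr p * W powr (p - 1))"
  have d: "0 < d" "2 powr p * (W powr (p - 1) * (3 * d)) = c / 2"
    using c W by (auto simp: d_def field_simps)
  obtain \<Gamma> where \<Gamma>: "finite \<Gamma>" "of_nat N * nsum (\<lambda>\<gamma>. if \<gamma> \<in> \<Gamma> then 0 else h \<gamma>) \<le> ennreal d"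
    using small_tail[OF hfin d(1)] by auto
  define h' where "h' \<gamma> = (if \<gamma> \<in> \<Gamma> then 0 else h \<gamma>)" for \<gamma>
  have h': "of_nat N * nsum h' \<le> ennreal d" using \<Gamma>(2) by (simp add: h'_def[abs_def])
  \<comment> \<open>The minimum with 1 ensures \<open>\<eta> powr p \<le> \<eta>\<close> when the
    variation is raised to the power \<open>p\<close>.\<close>
  define \<eta> where "\<eta> = min 1 (d / W)"
  have \<eta>: "0 < \<eta>" "\<eta> \<le> 1" "W * \<eta> \<le> d" using d W by (auto simp: \<eta>_def min_def field_simps)
  obtain \<psi> :: "int^'n \<Rightarrow> real" where \<psi>: "\<psi> 0 = 1" "\<And>\<delta>. 0 < \<psi> \<delta>" "\<And>\<delta>. \<psi> \<delta> \<le> 1"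
    "nsum (\<lambda>\<delta>. ennreal (\<psi> \<delta>)) < top" "\<And>\<gamma> \<delta>. \<gamma> \<in> \<Gamma> \<Longrightarrow> \<bar>\<psi> (\<delta> + \<gamma>) - \<psi> \<delta>\<bar> \<le> \<eta> * \<psi> \<delta>"
    using slow_weight[OF \<Gamma>(1) \<eta>(1)] by blast
  have "of_nat N * nsum (\<lambda>\<delta>. ennreal (\<psi> \<delta>)) < top" using \<psi>(4) by (simp add: ennreal_mult_less_top)
  then obtain Q where Q: "0 < Q" "of_nat N * nsum (\<lambda>\<delta>. ennreal (\<psi> \<delta>)) \<le> ennreal Q"
    using ennreal_pos_bound by blast
  define f where "f \<alpha> x = \<psi> (\<pi> x - \<alpha>)" for \<alpha> x
  have f01: "0 < f \<alpha> x" "f \<alpha> x \<le> 1" for \<alpha> x using \<psi> by (auto simp: f_def)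
  have fabs: "\<bar>f \<alpha> x\<bar> \<le> 1" for \<alpha> x using f01[of \<alpha> x] by simp
  have weighted: "pn p (\<lambda>x. of_real (f \<alpha> x) * v x) \<le> ennreal (Q * V powr p)"
    if V: "\<And>x. norm (v x) \<le> V" for \<alpha> v V
  proof -
    have V0: "0 \<le> V" using V norm_ge_zero order_trans by blast
    have "pn p (\<lambda>x. of_real (f \<alpha> x) * v x) \<le> nsum (\<lambda>x. ennreal (\<psi> (\<pi> x - \<alpha>)) * ennreal (V powr p))"
      unfolding pn_def
    proof (rule nn_integral_mono)
      fix x
      have "(f \<alpha> x) powr p \<le> f \<alpha> x powr 1" using f01[of \<alpha> x] p by (intro powr_mono') auto
      then have "(f \<alpha> x) powr p * norm (v x) powr p \<le> f \<alpha> x * V powr p"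
        using f01[of \<alpha> x] V p by (intro mult_mono powr_mono2) auto
      then show "ennreal (norm (of_real (f \<alpha> x) * v x) powr p) \<le> ennreal (\<psi> (\<pi> x - \<alpha>)) * ennreal (V powr p)"
        using f01[of \<alpha> x] by (simp add: norm_mult powr_mult ennreal_mult[symmetric] f_def[symmetric] ennreal_leI)
    qed
    also have "\<dots> = nsum (\<lambda>x. ennreal (\<psi> (\<pi> x - \<alpha>))) * ennreal (V powr p)"
      by (rule nn_integral_multc) simp
    also have "\<dots> \<le> (of_nat N * nsum (\<lambda>\<delta>. ennreal (\<psi> \<delta>))) * ennreal (V powr p)"
      by (rule mult_right_mono[OF nsum_col]) simp
    also have "\<dots> \<le> ennreal Q * ennreal (V powr p)" by (rule mult_right_mono[OF Q(2)]) simp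
    also have "\<dots> = ennreal (Q * V powr p)" using Q V0 by (simp add: ennreal_mult)
    finally show ?thesis .
  qed
  \<comment> \<open>The constant of the final estimate \<open>s \<le> M * t powr p\<close>: division
    by \<open>c / 2\<close>, the factor from \<open>pn_diff_le\<close>, and the total weight
    \<open>Q\<close>.\<close>
  define M where "M = (2 / c) * (2 powr p * Q)"
  have M: "0 < M" using c Q by (simp add: M_def)
  have "M powr (- 1 / p) * norm (u x) \<le> t"
    if u: "bdd u" and uY: "\<And>x. x \<notin> Y \<Longrightarrow> u x = 0" and ut: "\<And>x. norm (kop k u x) \<le> t" for u t x
  proof -
    have t0: "0 \<le> t" using ut norm_ge_zero order_trans by blast
    obtain U where U: "0 < U" "\<And>x. norm (u x) \<le> U" using bdd_pos_bound[OF u] by metis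
    define A where "A \<alpha> y = ennreal ((f \<alpha> y * norm (u y)) powr p)" for \<alpha> y
    define a where "a \<alpha> = nsum (A \<alpha>)" for \<alpha>
    have a_pn: "a \<alpha> = pn p (\<lambda>x. of_real (f \<alpha> x) * u x)" for \<alpha>
      using f01(1) by (simp add: a_def A_def[abs_def] pn_def norm_mult less_imp_le)
    define s where "s = (SUP \<alpha>. a \<alpha>)"
    have as: "a \<alpha> \<le> s" for \<alpha> unfolding s_def by (rule SUP_upper) simp
    have "s \<le> ennreal (Q * U powr p)"
      unfolding s_def by (rule SUP_least) (simp add: a_pn weighted U)
    \<comment> \<open>Without finiteness the term \<open>c / 2 * s\<close> could not be moved to the
      left side.\<close>
    then have sfin: "s < top" using ennreal_less_top le_less_trans by blast
    let ?z = "\<lambda>\<alpha> x. \<Sum>\<^sub>\<infinity>y. k x y * (of_real (f \<alpha> x - f \<alpha> y) * u y)"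
    have comm: "pn p (?z \<alpha>) \<le> ennreal (W powr (p - 1)) * (ennreal (3 * d) * s)" for \<alpha>
    proof -
      define F where "F \<gamma> y = (ennreal \<eta> * h \<gamma>) * A \<alpha> y + h' \<gamma> * A \<alpha> y + h' \<gamma> * A (\<alpha> - \<gamma>) y" for \<gamma> y
      have pt: "ennreal (norm (k x y) * (\<bar>f \<alpha> x - f \<alpha> y\<bar> * norm (u y)) powr p) \<le> F (\<pi> x - \<pi> y) y" for x y
      proof -
        define \<gamma> where "\<gamma> = \<pi> x - \<pi> y"
        have kh: "en (k x y) \<le> h \<gamma>" using dk by (simp add: domk_def \<gamma>_def)
        have fx: "f \<alpha> x = \<psi> ((\<pi> y - \<alpha>) + \<gamma>)" "f \<alpha> x = f (\<alpha> - \<gamma>) y"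
          by (simp_all add: f_def \<gamma>_def algebra_simps)
        show ?thesis
        proof (cases "\<gamma> \<in> \<Gamma>")
          case True
          have "\<bar>f \<alpha> x - f \<alpha> y\<bar> \<le> \<eta> * f \<alpha> y"
            using \<psi>(5)[OF True, of "\<pi> y - \<alpha>"] by (simp add: fx(1)) (simp add: f_def)
          then have "\<bar>f \<alpha> x - f \<alpha> y\<bar> * norm (u y) \<le> \<eta> * (f \<alpha> y * norm (u y))"
            by (metis mult.assoc mult_right_mono norm_ge_zero)
          then have "(\<bar>f \<alpha> x - f \<alpha> y\<bar> * norm (u y)) powr p \<le> (\<eta> * (f \<alpha> y * norm (u y))) powr p"
            using p by (intro powr_mono2) auto
          also have "\<dots> = \<eta> powr p * (f \<alpha> y * norm (u y)) powr p"
            by (rule powr_mult)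
          also have "\<dots> \<le> \<eta> * (f \<alpha> y * norm (u y)) powr p"
            using powr_mono'[of 1 p \<eta>] \<eta> p by (intro mult_right_mono) auto
          finally have "ennreal ((\<bar>f \<alpha> x - f \<alpha> y\<bar> * norm (u y)) powr p) \<le> ennreal \<eta> * A \<alpha> y"
            using \<eta>(1) by (simp add: A_def ennreal_mult'[symmetric] ennreal_leI)
          then have "en (k x y) * ennreal ((\<bar>f \<alpha> x - f \<alpha> y\<bar> * norm (u y)) powr p) \<le> h \<gamma> * (ennreal \<eta> * A \<alpha> y)"
            by (intro mult_mono kh) auto
          also have "\<dots> \<le> F \<gamma> y" by (simp add: F_def mult_ac add_increasing2)
          finally show ?thesis by (simp add: ennreal_mult' \<gamma>_def)
        next
          case False
          have "\<bar>f \<alpha> x - f \<alpha> y\<bar> \<le> max (f \<alpha> y) (f (\<alpha> - \<gamma>) y)"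
            using f01[of \<alpha> x] f01[of \<alpha> y] fx(2) by linarith
          then have "\<bar>f \<alpha> x - f \<alpha> y\<bar> * norm (u y) \<le> max (f \<alpha> y) (f (\<alpha> - \<gamma>) y) * norm (u y)"
            by (rule mult_right_mono) simp
          then have "(\<bar>f \<alpha> x - f \<alpha> y\<bar> * norm (u y)) powr p \<le> (max (f \<alpha> y) (f (\<alpha> - \<gamma>) y) * norm (u y)) powr p"
            using p by (intro powr_mono2) auto
          also have "\<dots> \<le> (f \<alpha> y * norm (u y)) powr p + (f (\<alpha> - \<gamma>) y * norm (u y)) powr p"
            by (auto simp: max_def)
          finally have "ennreal ((\<bar>f \<alpha> x - f \<alpha> y\<bar> * norm (u y)) powr p) \<le> A \<alpha> y + A (\<alpha> - \<gamma>) y"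
            by (simp add: A_def ennreal_plus[symmetric] ennreal_leI del: ennreal_plus)
          then have "en (k x y) * ennreal ((\<bar>f \<alpha> x - f \<alpha> y\<bar> * norm (u y)) powr p) \<le> h \<gamma> * (A \<alpha> y + A (\<alpha> - \<gamma>) y)"
            by (intro mult_mono kh) auto
          also have "\<dots> \<le> F \<gamma> y" using False by (simp add: F_def h'_def distrib_left mult_ac add_increasing add.assoc)
          finally show ?thesis by (simp add: ennreal_mult' \<gamma>_def)
        qed
      qed
      have "pn p (?z \<alpha>) \<le> nsum (\<lambda>x. ennreal (W powr (p - 1)) * nsum (\<lambda>y. ennreal (norm (k x y) * (\<bar>f \<alpha> x - f \<alpha> y\<bar> * norm (u y)) powr p)))"
        unfolding pn_def
      proof (rule nn_integral_mono, rule weighted_power_mean[OF p])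
        fix x
        have "en (?z \<alpha> x) \<le> nsum (\<lambda>y. en (k x y * (of_real (f \<alpha> x - f \<alpha> y) * u y)))"
          by (rule en_infsum_le)
        then show "en (?z \<alpha> x) \<le> nsum (\<lambda>y. ennreal (norm (k x y) * (\<bar>f \<alpha> x - f \<alpha> y\<bar> * norm (u y))))"
          by (simp add: norm_mult del: of_real_diff)
      qed (use W row in auto)
      also have "\<dots> = ennreal (W powr (p - 1)) * nsum (\<lambda>x. nsum (\<lambda>y. ennreal (norm (k x y) * (\<bar>f \<alpha> x - f \<alpha> y\<bar> * norm (u y)) powr p)))"
        by (rule nn_integral_cmult) simp
      also have "nsum (\<lambda>x. nsum (\<lambda>y. ennreal (norm (k x y) * (\<bar>f \<alpha> x - f \<alpha> y\<bar> * norm (u y)) powr p))) \<le> ennreal (3 * d) * s"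
      proof -
        have "nsum (\<lambda>x. nsum (\<lambda>y. ennreal (norm (k x y) * (\<bar>f \<alpha> x - f \<alpha> y\<bar> * norm (u y)) powr p))) \<le> nsum (\<lambda>x. nsum (\<lambda>y. F (\<pi> x - \<pi> y) y))"
          by (intro nn_integral_mono pt)
        also have "\<dots> = nsum (\<lambda>y. nsum (\<lambda>x. F (\<pi> x - \<pi> y) y))" by (rule nsum_swap)
        also have "\<dots> \<le> nsum (\<lambda>y. of_nat N * nsum (\<lambda>\<gamma>. F \<gamma> y))"
          by (intro nn_integral_mono nsum_col)
        also have "\<dots> = of_nat N * nsum (\<lambda>\<gamma>. nsum (\<lambda>y. F \<gamma> y))"
          by (simp add: nn_integral_cmult nsum_swap[of "\<lambda>y \<gamma>. F \<gamma> y"])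
        also have "\<dots> = of_nat N * nsum (\<lambda>\<gamma>. (ennreal \<eta> * h \<gamma>) * a \<alpha> + h' \<gamma> * a \<alpha> + h' \<gamma> * a (\<alpha> - \<gamma>))"
          by (simp add: F_def a_def nn_integral_add nn_integral_cmult)
        \<comment> \<open>Replacing every centre by the supremum closes the inequality in the single
          number \<open>s\<close>.\<close>
        also have "\<dots> \<le> of_nat N * nsum (\<lambda>\<gamma>. (ennreal \<eta> * h \<gamma>) * s + h' \<gamma> * s + h' \<gamma> * s)"
          by (intro mult_left_mono nn_integral_mono add_mono as) auto
        also have "\<dots> = (ennreal \<eta> * (of_nat N * nsum h) + of_nat N * nsum h' + of_nat N * nsum h') * s"
          by (simp add: nn_integral_add nn_integral_cmult nn_integral_multc distrib_left distrib_right mult_ac)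
        also have "\<dots> \<le> (ennreal \<eta> * ennreal W + ennreal d + ennreal d) * s"
          by (intro mult_right_mono add_mono mult_left_mono W h') auto
        also have "\<dots> \<le> (ennreal d + ennreal d + ennreal d) * s"
          using \<eta> W by (intro mult_right_mono add_mono) (auto simp: ennreal_mult[symmetric] mult.commute intro: ennreal_leI)
        also have "ennreal d + ennreal d + ennreal d = ennreal (3 * d)"
          using d by (simp add: ennreal_plus[symmetric] del: ennreal_plus)
        finally show ?thesis .
      qed
      finally show ?thesis by (simp add: mult_left_mono)
    qed
    have "ennreal c * a \<alpha> \<le> ennreal (2 powr p * (Q * t powr p)) + ennreal (c/2) * s" for \<alpha>
    proof -
      let ?w = "\<lambda>y. of_real (f \<alpha> y) * u y"
      have kw: "kop k ?w = (\<lambda>x. of_real (f \<alpha> x) * kop k u x - ?z \<alpha> x)"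
        by (rule ext, rule kop_weight[OF Wkk u fabs])
      have "ennreal c * a \<alpha> \<le> pn p (kop k ?w)"
        unfolding a_pn
      proof (rule lb)
        show "pn p ?w < top" using as[of \<alpha>] sfin by (simp add: a_pn[symmetric] le_less_trans)
      qed (simp add: uY)
      also have "\<dots> \<le> ennreal (2 powr p) * (pn p (\<lambda>x. of_real (f \<alpha> x) * kop k u x) + pn p (?z \<alpha>))"
        unfolding kw by (rule pn_diff_le[OF p])
      also have "\<dots> \<le> ennreal (2 powr p) * (ennreal (Q * t powr p) + ennreal (W powr (p - 1)) * (ennreal (3 * d) * s))"
        by (intro mult_left_mono add_mono comm weighted ut) auto
      also have "\<dots> = ennreal (2 powr p * (Q * t powr p)) + ennreal (2 powr p * (W powr (p - 1) * (3 * d))) * s"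
        using Q d by (simp add: distrib_left ennreal_mult mult.assoc)
      finally show ?thesis using d(2) by simp
    qed
    then have "ennreal c * s \<le> ennreal (2 powr p * (Q * t powr p)) + ennreal (c/2) * s"
      unfolding s_def[of ] by (simp add: SUP_mult_left_ennreal SUP_le_iff)
    moreover have "ennreal c * s = ennreal (c/2) * s + ennreal (c/2) * s"
      using c by (simp add: distrib_right[symmetric] ennreal_plus[symmetric] del: ennreal_plus)
    ultimately have "ennreal (c/2) * s + ennreal (c/2) * s \<le> ennreal (c/2) * s + ennreal (2 powr p * (Q * t powr p))"
      by (simp add: add.commute)
    moreover have "ennreal (c/2) * s \<noteq> top" using sfin by (simp add: ennreal_mult_eq_top_iff)
    ultimately have "ennreal (c/2) * s \<le> ennreal (2 powr p * (Q * t powr p))"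
      by (simp add: ennreal_add_left_cancel_le)
    then have "ennreal (2/c) * (ennreal (c/2) * s) \<le> ennreal (2/c) * ennreal (2 powr p * (Q * t powr p))"
      by (rule mult_left_mono) simp
    moreover have "ennreal (2/c) * (ennreal (c/2) * s) = s"
      using c by (simp add: mult.assoc[symmetric] ennreal_mult'[symmetric] del: ennreal_divide_numeral)
    ultimately have "s \<le> ennreal (M * t powr p)"
      using c Q by (simp add: M_def ennreal_mult[symmetric] mult.assoc)
    moreover have "ennreal (norm (u x) powr p) \<le> s"
    proof -
      have "ennreal (norm (u x) powr p) = A (\<pi> x) x" using \<psi>(1) by (simp add: A_def f_def)
      also have "\<dots> \<le> a (\<pi> x)" unfolding a_def by (rule nsum_ge)
      finally show ?thesis using as order_trans by blast
    qed
    ultimately have "ennreal (norm (u x) powr p) \<le> ennreal (M * t powr p)" by (rule order_trans[rotated])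
    then have "norm (u x) powr p \<le> M * t powr p" using M t0 by simp
    then have "(norm (u x) powr p) powr (1/p) \<le> (M * t powr p) powr (1/p)"
      using p by (intro powr_mono2) auto
    then have "norm (u x) \<le> M powr (1/p) * t"
      using p t0 by (simp add: powr_powr powr_mult)
    then have "M powr (- 1/p) * norm (u x) \<le> M powr (- 1/p) * (M powr (1/p) * t)"
      by (rule mult_left_mono) simp
    also have "\<dots> = t" using M by (simp add: mult.assoc[symmetric] powr_add[symmetric])
    finally show ?thesis by simp
  qed
  then show ?thesis
    unfolding LBinf_def using M by (intro exI[of _ "M powr (- 1/p)"]) auto
qed

end

subsection \<open>Inversion of coercive kernels\<close>

text \<open>The Hilbert space adjoint, as opposed to the bilinear transpose
  \<open>adj_kernel\<close>; positivity on l^2 requires it.\<close>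

definition cstar :: "('x \<Rightarrow> 'x \<Rightarrow> complex) \<Rightarrow> ('x \<Rightarrow> 'x \<Rightarrow> complex)" where
  "cstar k = (\<lambda>x y. cnj (k y x))"

lemma kop_cstar: "kop (cstar k) u x = cnj (kop (adj_kernel k) (\<lambda>y. cnj (u y)) x)"
  by (simp add: kop_def cstar_def adj_kernel_def flip: infsum_cnj)

lemma absum_bdd: "absum v \<Longrightarrow> bdd v"
  by (rule bdd_pn[of 1]) (simp_all add: pn_def absum_iff)

lemma absum_mult_bdd: "absum f \<Longrightarrow> bdd g \<Longrightarrow> absum (\<lambda>x. f x * g x)"
  unfolding bdd_def by (metis absum_bounded_mult)

lemma absum_sq: "absum v \<Longrightarrow> integrable (count_space UNIV) (\<lambda>x. (norm (v x))\<^sup>2)"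
  using integrable_norm[OF absum_mult_bdd[of v v]] absum_bdd[of v]
  by (simp add: norm_mult power2_eq_square)

lemma pn2_eq: "absum v \<Longrightarrow> pn 2 v = ennreal (\<integral>x. (norm (v x))\<^sup>2 \<partial>count_space UNIV)"
  unfolding pn_def using absum_sq by (subst nn_integral_eq_integral[symmetric]) auto

context cells
begin

lemma Wk_cstar: "Wk k \<Longrightarrow> Wk (cstar k)"
  unfolding cstar_def using Wk_cnj[OF Wk_adj, of k] by (simp add: adj_kernel_def)

lemma absum_kop: "Wk k \<Longrightarrow> absum v \<Longrightarrow> absum (kop k v)"
proof -
  assume k: "Wk k" and v: "absum v"
  obtain W where W: "0 < W" "\<And>x. nsum (\<lambda>y. en (k x y)) \<le> ennreal W" "\<And>y. nsum (\<lambda>x. en (k x y)) \<le> ennreal W"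
    using Wk_bounds[OF k] by metis
  have "pn 1 (kop k v) \<le> ennreal (W powr 1) * pn 1 v"
    by (rule pn_kop_le) (use W in auto)
  also have "\<dots> < top" using v by (simp add: pn_def absum_iff ennreal_mult_less_top)
  finally show ?thesis by (simp add: pn_def absum_iff)
qed

text \<open>The dominating \<open>g\<close> is the same for all exponents, so the Schur test for the
  kernel that it defines gives the estimate for every \<open>p\<close>.\<close>

lemma LBinf_imp_pn_bound:
  assumes "domk h k" "LBinf Y k" "1 \<le> p"
  shows "\<exists>C>0. \<forall>u. bdd u \<longrightarrow> (\<forall>x. x \<notin> Y \<longrightarrow> u x = 0) \<longrightarrow> pn p u \<le> ennreal C * pn p (kop k u)"
proof -
  obtain g where g: "nsum g < top"
    "\<And>u x. bdd u \<Longrightarrow> (\<And>x. x \<notin> Y \<Longrightarrow> u x = 0) \<Longrightarrow> en (u x) \<le> nsum (\<lambda>y. g (\<pi> x - \<pi> y) * en (kop k u y))"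
    using LBinf_domination[OF assms(1,2)] by metis
  define b where "b x y = complex_of_real (enn2real (g (\<pi> x - \<pi> y)))" for x y
  have gb: "g (\<pi> x - \<pi> y) = en (b x y)" for x y
    using le_less_trans[OF nsum_ge g(1)] by (simp add: b_def)
  have "Wk b" unfolding Wk_def using g(1) by (intro exI[of _ g]) (simp add: domk_def gb)
  then obtain W where W: "0 < W" "\<And>x. nsum (\<lambda>y. en (b x y)) \<le> ennreal W" "\<And>y. nsum (\<lambda>x. en (b x y)) \<le> ennreal W"
    using Wk_bounds by metis
  have "pn p u \<le> ennreal (W powr p) * pn p (kop k u)" if "bdd u" "\<And>x. x \<notin> Y \<Longrightarrow> u x = 0" for u
  proof (rule schur_test[of _ _ b])
    fix x
    show "en (u x) \<le> nsum (\<lambda>y. ennreal (norm (b x y) * norm (kop k u y)))"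
      using g(2)[OF that] by (simp add: gb ennreal_mult)
  qed (use W assms(3) in auto)
  then show ?thesis using W(1) by (intro exI[of _ "W powr p"]) auto
qed

text \<open>Domination applied to the solution of \<open>kop T u = kid y\<close> bounds its value at
  \<open>x\<close> by \<open>g (\<pi> x - \<pi> y)\<close>, so the solutions are the columns of a
  kernel with summable decay.\<close>

lemma inverse_kernel:
  assumes "domk h T" "LBinf UNIV T" "\<And>y. \<exists>u. bdd u \<and> kop T u = kid y"
  shows "\<exists>b. Wk b \<and> kmul T b = kid"
proof -
  obtain g where g: "nsum g < top"
    "\<And>u x. bdd u \<Longrightarrow> (\<And>x. x \<notin> UNIV \<Longrightarrow> u x = 0) \<Longrightarrow> en (u x) \<le> nsum (\<lambda>y. g (\<pi> x - \<pi> y) * en (kop T u y))"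
    using LBinf_domination[OF assms(1,2)] by metis
  obtain c where c: "\<And>y. bdd (c y)" "\<And>y. kop T (c y) = kid y"
    using assms(3) by metis
  define b where "b x y = c y x" for x y
  have "en (b x y) \<le> g (\<pi> x - \<pi> y)" for x y
  proof -
    have "en (b x y) \<le> nsum (\<lambda>z. g (\<pi> x - \<pi> z) * en (kid y z))"
      using g(2)[OF c(1), of y x] by (simp add: c(2) b_def)
    also have "\<dots> = nsum (\<lambda>z. if z = y then g (\<pi> x - \<pi> z) else 0)"
      by (rule nn_integral_cong) (simp add: kid_def)
    finally show ?thesis by (simp add: nsum_single)
  qed
  then have "Wk b" using g(1) by (auto simp: Wk_def domk_def)
  moreover have "kmul T b x y = kid x y" for x y
  proof -
    have "kmul T b x y = kop T (c y) x" by (simp add: kmul_def kop_def b_def)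
    then show ?thesis by (simp add: c(2) kid_def)
  qed
  ultimately show ?thesis by blast
qed

text \<open>Since \<open>\<parallel>v - t T v\<parallel>\<^sup>2 = \<parallel>v\<parallel>\<^sup>2 - 2 t Re \<langle>v, T v\<rangle> + t\<^sup>2 \<parallel>T v\<parallel>\<^sup>2\<close>, the operator \<open>I - t T\<close> is a strict
  contraction of \<open>l\<^sup>2\<close> for small \<open>t\<close>.\<close>

lemma coercive_contraction:
  assumes T: "Wk T" and c: "0 < c"
    and co: "\<And>v. absum v \<Longrightarrow> c * (\<integral>x. (norm (v x))\<^sup>2 \<partial>count_space UNIV) \<le> Re (\<integral>x. cnj (v x) * kop T v x \<partial>count_space UNIV)"
  shows "\<exists>t>0. \<exists>\<rho>\<ge>0. \<rho> < 1 \<and> (\<forall>v. absum v \<longrightarrow> pn 2 (\<lambda>x. v x - of_real t * kop T v x) \<le> ennreal \<rho> * pn 2 v)"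
proof -
  obtain W where W: "0 < W" "\<And>x. nsum (\<lambda>y. en (T x y)) \<le> ennreal W" "\<And>y. nsum (\<lambda>x. en (T x y)) \<le> ennreal W"
    using Wk_bounds[OF T] by metis
  define C where "C = max (W\<^sup>2) c"
  have C: "0 < C" "W\<^sup>2 \<le> C" "c \<le> C" using W c by (auto simp: C_def)
  define W' where "W' = max C 1"
  have W': "C \<le> W'" "1 \<le> W'" "c \<le> W'" "0 < W'" using C by (auto simp: W'_def)
  \<comment> \<open>As \<open>C \<le> W'\<close>, this gives
    \<open>t\<^sup>2 * C \<le> t * c\<close>, so the quadratic term takes back at most half of the
    gain \<open>2 * t * c\<close>. The maximum with 0 in \<rho> only keeps it nonnegative.\<close>
  define t where "t = c / W'"
  have t: "0 < t" using c W' by (simp add: t_def)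
  define \<rho> where "\<rho> = max 0 (1 - 2 * t * c + t\<^sup>2 * C)"
  have tc: "0 < t * c" using t c by simp
  have "t\<^sup>2 * C \<le> t * c"
  proof -
    have "t * C \<le> t * W'" using t W' by simp
    also have "\<dots> = c" using W' by (simp add: t_def)
    finally have "t * (t * C) \<le> t * c" using t by simp
    then show ?thesis by (simp add: power2_eq_square mult.assoc)
  qed
  then have \<rho>: "0 \<le> \<rho>" "\<rho> < 1" "1 - 2 * t * c + t\<^sup>2 * C \<le> \<rho>" using tc by (auto simp: \<rho>_def)
  have "pn 2 (\<lambda>x. v x - of_real t * kop T v x) \<le> ennreal \<rho> * pn 2 v" if v: "absum v" for v
  proof -
    let ?I = "\<lambda>f. \<integral>x. f x \<partial>count_space UNIV"
    have Tv: "absum (kop T v)" by (rule absum_kop[OF T v])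
    have d: "absum (\<lambda>x. v x - of_real t * kop T v x)" using v Tv by simp
    have i1: "absum (\<lambda>x. cnj (v x) * kop T v x)"
      using absum_mult_bdd[OF Tv bdd_cnj[OF absum_bdd[OF v]]] by (simp add: mult.commute)
    have "ennreal (?I (\<lambda>x. (norm (kop T v x))\<^sup>2)) \<le> ennreal (W powr 2) * ennreal (?I (\<lambda>x. (norm (v x))\<^sup>2))"
      using pn_kop_le[of 2 W T v] W by (simp add: pn2_eq[OF Tv] pn2_eq[OF v])
    then have TT: "?I (\<lambda>x. (norm (kop T v x))\<^sup>2) \<le> W\<^sup>2 * ?I (\<lambda>x. (norm (v x))\<^sup>2)"
      using W by (subst (asm) ennreal_mult[symmetric]) (auto simp: integral_nonneg)
    have pt: "(norm (v x - of_real t * kop T v x))\<^sup>2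
      = (norm (v x))\<^sup>2 - 2 * t * Re (cnj (v x) * kop T v x) + t\<^sup>2 * (norm (kop T v x))\<^sup>2" for x
      unfolding cmod_power2 by (simp add: power2_eq_square algebra_simps)
    have "?I (\<lambda>x. (norm (v x - of_real t * kop T v x))\<^sup>2)
      = ?I (\<lambda>x. (norm (v x))\<^sup>2) - 2 * t * ?I (\<lambda>x. Re (cnj (v x) * kop T v x)) + t\<^sup>2 * ?I (\<lambda>x. (norm (kop T v x))\<^sup>2)"
      unfolding pt
      using absum_sq[OF v] absum_sq[OF Tv] integrable_Re[OF i1] by simp
    also have "?I (\<lambda>x. Re (cnj (v x) * kop T v x)) = Re (?I (\<lambda>x. cnj (v x) * kop T v x))"
      by (rule integral_Re[OF i1])
    also have "?I (\<lambda>x. (norm (v x))\<^sup>2) - 2 * t * Re (?I (\<lambda>x. cnj (v x) * kop T v x)) + t\<^sup>2 * ?I (\<lambda>x. (norm (kop T v x))\<^sup>2)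
        \<le> ?I (\<lambda>x. (norm (v x))\<^sup>2) - 2 * t * (c * ?I (\<lambda>x. (norm (v x))\<^sup>2)) + t\<^sup>2 * (C * ?I (\<lambda>x. (norm (v x))\<^sup>2))"
    proof (intro add_mono diff_mono mult_left_mono)
      have "W\<^sup>2 * ?I (\<lambda>x. (norm (v x))\<^sup>2) \<le> C * ?I (\<lambda>x. (norm (v x))\<^sup>2)"
        by (rule mult_right_mono[OF C(2)]) (simp add: integral_nonneg)
      then show "?I (\<lambda>x. (norm (kop T v x))\<^sup>2) \<le> C * ?I (\<lambda>x. (norm (v x))\<^sup>2)" using TT by linarith
    qed (use co[OF v] t in auto)
    also have "\<dots> = (1 - 2 * t * c + t\<^sup>2 * C) * ?I (\<lambda>x. (norm (v x))\<^sup>2)" by (simp add: algebra_simps)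
    also have "\<dots> \<le> \<rho> * ?I (\<lambda>x. (norm (v x))\<^sup>2)"
      by (rule mult_right_mono[OF \<rho>(3)]) (simp add: integral_nonneg)
    finally have "?I (\<lambda>x. (norm (v x - of_real t * kop T v x))\<^sup>2) \<le> \<rho> * ?I (\<lambda>x. (norm (v x))\<^sup>2)" .
    then show ?thesis
      unfolding pn2_eq[OF d] pn2_eq[OF v] using \<rho>
      by (subst ennreal_mult[symmetric]) (auto simp: integral_nonneg intro: ennreal_leI)
  qed
  then show ?thesis using t \<rho> by blast
qed

text \<open>Richardson iteration: the Neumann series of \<open>I - t T\<close> applied to
  \<open>t\<close> times the unit vector. All iterates are summable, as coercivity requires, and the
  contraction enters only through the pointwise bound \<open>vb\<close>. Hence the series converges
  uniformly and its sum is bounded.\<close>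

lemma coercive_solve:
  assumes T: "Wk T" and c: "0 < c"
    and co: "\<And>v. absum v \<Longrightarrow> c * (\<integral>x. (norm (v x))\<^sup>2 \<partial>count_space UNIV) \<le> Re (\<integral>x. cnj (v x) * kop T v x \<partial>count_space UNIV)"
  shows "\<exists>u. bdd u \<and> kop T u = kid y"
proof -
  obtain t \<rho> where t: "0 < t" and \<rho>: "0 \<le> \<rho>" "\<rho> < 1"
    and contr: "\<And>v. absum v \<Longrightarrow> pn 2 (\<lambda>x. v x - of_real t * kop T v x) \<le> ennreal \<rho> * pn 2 v"
    using coercive_contraction[OF T c co] by blast
  obtain W where W: "0 < W" "\<And>x. nsum (\<lambda>y. en (T x y)) \<le> ennreal W"
    using Wk_bounds[OF T] by metis
  define v where "v = rec_nat (\<lambda>x. of_real t * kid y x) (\<lambda>_ v x. v x - of_real t * kop T v x)"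
  have v0: "v 0 = (\<lambda>x. of_real t * kid y x)" and vS: "v (Suc n) = (\<lambda>x. v n x - of_real t * kop T (v n) x)" for n
    by (simp_all add: v_def)
  have p0: "pn 2 (v 0) = ennreal (t\<^sup>2)"
  proof -
    have "pn 2 (v 0) = nsum (\<lambda>x. if x = y then ennreal (t\<^sup>2) else 0)"
      unfolding pn_def v0 using t by (intro nn_integral_cong) (simp add: kid_def)
    then show ?thesis by (simp add: nsum_single)
  qed
  have av: "absum (v n)" for n
  proof (induction n)
    case 0
    have "nsum (\<lambda>x. en (v 0 x)) = nsum (\<lambda>x. if x = y then ennreal t else 0)"
      unfolding v0 using t by (intro nn_integral_cong) (simp add: kid_def)
    then show ?case by (simp add: absum_iff nsum_single)
  next
    case (Suc n)
    then show ?case using absum_kop[OF T Suc] by (simp add: vS)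
  qed
  have pv: "pn 2 (v n) \<le> ennreal (\<rho> ^ n * t\<^sup>2)" for n
  proof (induction n)
    case (Suc n)
    have "pn 2 (v (Suc n)) \<le> ennreal \<rho> * pn 2 (v n)" unfolding vS by (rule contr[OF av])
    also have "\<dots> \<le> ennreal \<rho> * ennreal (\<rho> ^ n * t\<^sup>2)" by (rule mult_left_mono[OF Suc]) simp
    also have "\<dots> = ennreal (\<rho> ^ Suc n * t\<^sup>2)" using \<rho> by (subst ennreal_mult[symmetric]) (auto simp: mult.assoc)
    finally show ?case .
  qed (simp add: p0)
  \<comment> \<open>\<open>pn 2\<close> is a squared norm, so values decay with the square root of
    the contraction factor.\<close>
  define r where "r = sqrt \<rho>"
  have r: "0 \<le> r" "r < 1" "r ^ 2 = \<rho>" using \<rho> by (auto simp: r_def)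
  have vb: "norm (v n x) \<le> t * r ^ n" for n x
  proof -
    have "ennreal (norm (v n x) powr 2) \<le> pn 2 (v n)" unfolding pn_def by (rule nsum_ge)
    also note pv
    finally have "(norm (v n x))\<^sup>2 \<le> \<rho> ^ n * t\<^sup>2" using \<rho> by simp
    also have "\<rho> ^ n = (r ^ n)\<^sup>2" by (metis r(3) power_mult mult.commute)
    also have "(r ^ n)\<^sup>2 * t\<^sup>2 = (t * r ^ n)\<^sup>2" by (subst power_mult_distrib) (rule mult.commute)
    finally show ?thesis by (rule power2_le_imp_le) (use t r(1) in simp)
  qed
  have sm: "summable (\<lambda>n. t * r ^ n)" using r by (intro summable_mult summable_geometric) simp
  have smv: "summable (\<lambda>n. norm (v n x))" for x
    by (rule summable_comparison_test'[OF sm]) (use vb in auto)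
  define u where "u x = (\<Sum>n. v n x)" for x
  define un where "un n x = (\<Sum>i<n. v i x)" for n x
  have ub: "norm (u x - un n x) \<le> t * r ^ n / (1 - r)" for x n
  proof -
    have "u x - un n x = (\<Sum>i. v (i + n) x)"
      unfolding u_def un_def by (subst suminf_minus_initial_segment[OF summable_norm_cancel[OF smv]]) simp
    also have "norm \<dots> \<le> (\<Sum>i. norm (v (i + n) x))"
      by (rule summable_norm) (use summable_ignore_initial_segment[OF smv] in auto)
    also have "\<dots> \<le> (\<Sum>i. t * r ^ n * r ^ i)"
    proof (rule suminf_le)
      show "norm (v (i + n) x) \<le> t * r ^ n * r ^ i" for i using vb[of "i + n" x] by (simp add: power_add mult_ac)
      show "summable (\<lambda>i. norm (v (i + n) x))" by (rule summable_ignore_initial_segment[OF smv])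
      show "summable (\<lambda>i. t * r ^ n * r ^ i)" using r by (intro summable_mult summable_geometric) simp
    qed
    also have "\<dots> = t * r ^ n / (1 - r)"
      using r by (subst suminf_mult) (auto simp: suminf_geometric summable_geometric)
    finally show ?thesis .
  qed
  have bu: "bdd u" by (rule bddI[of _ "t / (1 - r)"]) (use ub[of _ 0] in \<open>simp add: un_def\<close>)
  have bv: "bdd (v n)" for n by (rule absum_bdd[OF av])
  have bun: "bdd (un n)" for n
  proof (induction n)
    case 0
    then show ?case by (auto simp: un_def bdd_def)
  next
    case (Suc n)
    then show ?case using bdd_add[OF Suc bv[of n]] by (simp add: un_def[abs_def])
  qed
  \<comment> \<open>Telescoping, because \<open>t T\<close> maps \<open>v n\<close> to
    \<open>v n - v (Suc n)\<close>.\<close>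
  have Tun: "of_real t * kop T (un n) x = v 0 x - v n x" for n x
  proof (induction n)
    case 0
    have "un 0 = (\<lambda>x. 0)" by (simp add: un_def[abs_def])
    then show ?case by simp
  next
    case (Suc n)
    have "un (Suc n) = (\<lambda>x. un n x + v n x)" by (simp add: un_def[abs_def])
    then have "of_real t * kop T (un (Suc n)) x = of_real t * kop T (un n) x + of_real t * kop T (v n) x"
      by (simp add: kop_add[OF T bun bv] distrib_left)
    then show ?case by (simp add: Suc vS)
  qed
  have "kop T u x = kid y x" for x
  proof -
    define D where "D = of_real t * kop T u x - v 0 x"
    have "norm D \<le> (t * W / (1 - r) * t + t) * r ^ n" for n
    proof -
      have "norm (kop T (\<lambda>x. u x - un n x) x) \<le> W * (t * r ^ n / (1 - r))"
        by (rule norm_kop_le) (use W ub in auto)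
      then have "norm (of_real t * (kop T u x - kop T (un n) x)) \<le> t * (W * (t * r ^ n / (1 - r)))"
        using t mult_left_mono[of _ "W * (t * r ^ n / (1 - r))" t] by (simp add: kop_diff[OF T bu bun] norm_mult)
      moreover have D: "D = of_real t * (kop T u x - kop T (un n) x) - v n x"
        using Tun[of n x] by (simp add: D_def algebra_simps)
      have "norm D \<le> norm (of_real t * (kop T u x - kop T (un n) x)) + norm (v n x)"
        unfolding D by (rule norm_triangle_ineq4)
      ultimately have "norm D \<le> t * (W * (t * r ^ n / (1 - r))) + t * r ^ n"
        using vb[of n x] by linarith
      then show ?thesis by (simp add: algebra_simps)
    qed
    moreover have "(\<lambda>n. (t * W / (1 - r) * t + t) * r ^ n) \<longlonglongrightarrow> (t * W / (1 - r) * t + t) * 0"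
      using r by (intro tendsto_mult tendsto_const LIMSEQ_realpow_zero)
    ultimately have "norm D \<le> 0" by (intro LIMSEQ_le_const[of "\<lambda>n. (t * W / (1 - r) * t + t) * r ^ n"]) auto
    then show ?thesis using t by (simp add: D_def v0)
  qed
  then show ?thesis using bu by auto
qed

end

section \<open>Inverses and regularizers with summable decay\<close>

lemma kmul_column: "kmul k l x y = kop k (\<lambda>z. l z y) x"
  by (simp add: kmul_def kop_def)

lemma absum_finite_support:
  assumes "finite {x. u x \<noteq> 0}"
  shows "absum u"
  unfolding absum_iff using assms by (subst nsum_finite_support[of "{x. u x \<noteq> 0}"]) auto

context cells
begin

lemma Wk_column_bdd:
  assumes "Wk k"
  shows "bdd (\<lambda>z. k z y)"
proof -
  obtain W where W: "0 < W" "\<And>x. nsum (\<lambda>y. en (k x y)) \<le> ennreal W"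
    using Wk_bounds[OF assms] by metis
  have "en (k z y) \<le> ennreal W" for z
    using nsum_ge[of "\<lambda>y. en (k z y)"] W(2) order_trans by blast
  then show ?thesis using W(1) by (intro bddI[of _ W]) simp
qed

text \<open>Coercivity supplies both ingredients of \<open>inverse_kernel\<close>: a lower bound on
  l^2, hence on l^infinity, and solutions for the unit vectors.\<close>

lemma coercive_invertible:
  assumes T: "Wk T" and c: "0 < c"
    and co: "\<And>v. absum v \<Longrightarrow> c * (\<integral>x. (norm (v x))\<^sup>2 \<partial>count_space UNIV) \<le> Re (\<integral>x. cnj (v x) * kop T v x \<partial>count_space UNIV)"
  shows "\<exists>s. Wk s \<and> kmul T s = kid"
proof -
  obtain h where h: "domk h T" using T by (auto simp: Wk_def)
  have "ennreal (c\<^sup>2) * pn 2 v \<le> pn 2 (kop T v)" if fs: "finite {x. v x \<noteq> 0}" for v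
  proof -
    let ?I = "\<lambda>f. \<integral>x. f x \<partial>count_space UNIV"
    have v: "absum v" by (rule absum_finite_support[OF fs])
    have Tv: "absum (kop T v)" by (rule absum_kop[OF T v])
    have i1: "absum (\<lambda>x. cnj (v x) * kop T v x)"
      using absum_mult_bdd[OF Tv bdd_cnj[OF absum_bdd[OF v]]] by (simp add: mult.commute)
    have "c * ?I (\<lambda>x. (norm (v x))\<^sup>2) \<le> Re (?I (\<lambda>x. cnj (v x) * kop T v x))" by (rule co[OF v])
    also have "\<dots> = ?I (\<lambda>x. Re (cnj (v x) * kop T v x))"
      by (rule integral_Re[OF i1, symmetric])
    \<comment> \<open>A pointwise arithmetic-geometric mean; the weights \<open>c/2\<close> and
      \<open>1/(2*c)\<close> leave half of the coercivity term on the left.\<close>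
    also have "\<dots> \<le> ?I (\<lambda>x. (c/2) * (norm (v x))\<^sup>2 + (1/(2*c)) * (norm (kop T v x))\<^sup>2)"
    proof (rule integral_mono)
      fix x
      have "Re (cnj (v x) * kop T v x) \<le> norm (v x) * norm (kop T v x)"
        using complex_Re_le_cmod[of "cnj (v x) * kop T v x"] by (simp add: norm_mult)
      also have "\<dots> \<le> (c/2) * (norm (v x))\<^sup>2 + (1/(2*c)) * (norm (kop T v x))\<^sup>2"
      proof -
        have "0 \<le> (c * norm (v x) - norm (kop T v x))\<^sup>2 / (2 * c)" using c by simp
        also have "\<dots> = (c/2) * (norm (v x))\<^sup>2 + (1/(2*c)) * (norm (kop T v x))\<^sup>2 - norm (v x) * norm (kop T v x)"
          using c by (simp add: power2_eq_square field_simps)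
        finally show ?thesis by simp
      qed
      finally show "Re (cnj (v x) * kop T v x) \<le> (c/2) * (norm (v x))\<^sup>2 + (1/(2*c)) * (norm (kop T v x))\<^sup>2" .
    qed (use absum_sq[OF v] absum_sq[OF Tv] integrable_Re[OF i1] in auto)
    also have "\<dots> = (c/2) * ?I (\<lambda>x. (norm (v x))\<^sup>2) + (1/(2*c)) * ?I (\<lambda>x. (norm (kop T v x))\<^sup>2)"
      using absum_sq[OF v] absum_sq[OF Tv] by simp
    finally have "(c/2) * ?I (\<lambda>x. (norm (v x))\<^sup>2) \<le> (1/(2*c)) * ?I (\<lambda>x. (norm (kop T v x))\<^sup>2)" by simp
    then have "(2*c) * ((c/2) * ?I (\<lambda>x. (norm (v x))\<^sup>2)) \<le> (2*c) * ((1/(2*c)) * ?I (\<lambda>x. (norm (kop T v x))\<^sup>2))"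
      using c by (intro mult_left_mono) auto
    then have "c\<^sup>2 * ?I (\<lambda>x. (norm (v x))\<^sup>2) \<le> ?I (\<lambda>x. (norm (kop T v x))\<^sup>2)"
      using c by (simp add: power2_eq_square)
    then show ?thesis
      unfolding pn2_eq[OF v] pn2_eq[OF Tv]
      by (subst ennreal_mult[symmetric]) (auto simp: integral_nonneg intro: ennreal_leI)
  qed
  then have "LBp 2 UNIV T" unfolding LBp_def using c by (intro exI[of _ "c\<^sup>2"]) auto
  then have "LBinf UNIV T" by (intro LBp_imp_LBinf[OF h]) auto
  then show ?thesis using inverse_kernel[OF h] coercive_solve[OF T c co] by blast
qed

lemma kop_pairing_absum:
  assumes k: "Wk k" and v: "absum v" and w: "bdd w"
  shows "(\<Sum>\<^sub>\<infinity>x. v x * kop k w x) = (\<Sum>\<^sub>\<infinity>y. kop (adj_kernel k) v y * w y)"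
proof (rule kop_pairing)
  obtain W where W: "0 < W" "\<And>x. nsum (\<lambda>y. en (k x y)) \<le> ennreal W"
    using Wk_bounds[OF k] by metis
  obtain U where U: "0 < U" "\<And>x. norm (w x) \<le> U" using bdd_pos_bound[OF w] by metis
  have "nsum (\<lambda>x. nsum (\<lambda>y. en (v x * (k x y * w y)))) \<le> nsum (\<lambda>x. en (v x) * (ennreal W * ennreal U))"
  proof (rule nn_integral_mono)
    fix x
    have "nsum (\<lambda>y. en (v x * (k x y * w y))) \<le> nsum (\<lambda>y. en (v x) * (en (k x y) * ennreal U))"
      using U by (intro nn_integral_mono) (auto simp: norm_mult ennreal_mult[symmetric] intro!: ennreal_leI mult_left_mono)
    also have "\<dots> = en (v x) * (nsum (\<lambda>y. en (k x y)) * ennreal U)"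
      by (simp add: nn_integral_cmult nn_integral_multc)
    also have "\<dots> \<le> en (v x) * (ennreal W * ennreal U)"
      by (intro mult_left_mono mult_right_mono W) auto
    finally show "nsum (\<lambda>y. en (v x * (k x y * w y))) \<le> en (v x) * (ennreal W * ennreal U)" .
  qed
  also have "\<dots> = nsum (\<lambda>x. en (v x)) * (ennreal W * ennreal U)"
    by (simp add: nn_integral_multc)
  also have "\<dots> < top" using v by (simp add: absum_iff ennreal_mult_less_top)
  finally show "nsum (\<lambda>x. nsum (\<lambda>y. en (v x * (k x y * w y)))) < top" .
qed

text \<open>A lower bound of the transpose makes \<open>P A A\<^sup>* P + (I - P)\<close> coercive on \<open>l\<^sup>2\<close>, where \<open>P\<close> is the
  restriction to \<open>Y\<close>. If \<open>S\<close> is its inverse then \<open>A\<^sup>* S\<close> is a right inverse of \<open>A\<close> on \<open>Y\<close>.\<close>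

theorem right_regularizer:
  assumes k: "Wk k" and lb: "LBinf Y (adj_kernel k)"
  shows "\<exists>b. Wk b \<and> (\<forall>x\<in>Y. \<forall>y\<in>Y. kmul k b x y = kid x y)"
proof -
  let ?I = "\<lambda>f. \<integral>x. f x \<partial>count_space UNIV"
  define m where "m = kmul k (cstar k)"
  define T1 where "T1 x y = (if x \<in> Y \<and> y \<in> Y then m x y else 0)" for x y
  define T2 where "T2 x y = (if x \<notin> Y then kid x y else 0)" for x y
  define T where "T x y = T1 x y + T2 x y" for x y
  have Wc: "Wk (cstar k)" by (rule Wk_cstar[OF k])
  have Wm: "Wk m" unfolding m_def by (rule Wk_kmul[OF k Wc])
  have W1: "Wk T1" by (rule Wk_mono[OF Wm]) (simp add: T1_def)
  have W2: "Wk T2" by (rule Wk_mono[OF Wk_kid]) (simp add: T2_def)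
  have WT: "Wk T" unfolding T_def[abs_def] by (rule Wk_add[OF W1 W2])
  have Tv: "kop T v x = (if x \<in> Y then kop m (\<lambda>y. if y \<in> Y then v y else 0) x else v x)" if "bdd v" for v x
  proof -
    have "kop T v x = kop T1 v x + kop T2 v x"
      unfolding T_def[abs_def] by (simp add: kop_kernel_add[OF W1 W2 that])
    moreover have "kop T1 v x = (if x \<in> Y then kop m (\<lambda>y. if y \<in> Y then v y else 0) x else 0)"
      by (auto simp: kop_def T1_def intro!: infsum_cong)
    moreover have "kop T2 v x = (if x \<in> Y then 0 else v x)"
    proof (cases "x \<in> Y")
      case False
      then have "kop T2 v x = kop kid v x" by (simp add: kop_def T2_def)
      then show ?thesis using False by simp
    qed (simp add: kop_def T2_def)
    ultimately show ?thesis by simp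
  qed
  obtain h where h: "domk h (adj_kernel k)" using Wk_adj[OF k] by (auto simp: Wk_def)
  obtain C where C: "0 < C" "\<And>u. bdd u \<Longrightarrow> (\<And>x. x \<notin> Y \<Longrightarrow> u x = 0) \<Longrightarrow> pn 2 u \<le> ennreal C * pn 2 (kop (adj_kernel k) u)"
    using LBinf_imp_pn_bound[OF h lb, of 2] by auto
  \<comment> \<open>\<open>1/C\<close> is the constant for the part of \<open>v\<close> in
    \<open>Y\<close>, and 1 the constant for the rest, where the operator is the identity.\<close>
  define c where "c = min (1/C) 1"
  have c: "0 < c" "c \<le> 1" "c * C \<le> 1" using C(1) by (auto simp: c_def min_def field_simps)
  have co: "c * ?I (\<lambda>x. (norm (v x))\<^sup>2) \<le> Re (?I (\<lambda>x. cnj (v x) * kop T v x))" if v: "absum v" for v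
  proof -
    define v' where "v' x = (if x \<in> Y then v x else 0)" for x
    define r where "r x = (if x \<in> Y then 0 else v x)" for x
    define w where "w = kop (cstar k) v'"
    have bv: "bdd v" by (rule absum_bdd[OF v])
    have av': "absum v'"
      by (rule Bochner_Integration.integrable_bound[OF v]) (auto simp: v'_def AE_count_space)
    have ar: "absum r"
      by (rule Bochner_Integration.integrable_bound[OF v]) (auto simp: r_def AE_count_space)
    have bv': "bdd v'" by (rule absum_bdd[OF av'])
    have aw: "absum w" unfolding w_def by (rule absum_kop[OF Wc av'])
    have bw: "bdd w" by (rule absum_bdd[OF aw])
    \<comment> \<open>The hypothesis concerns the transpose while the form involves
      \<open>cstar k\<close>; conjugating the argument passes between them and preserves absolute
      values.\<close>
    have adjw: "kop (adj_kernel k) (\<lambda>x. cnj (v' x)) y = cnj (w y)" for y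
      by (simp add: w_def kop_cstar)
    have Tvx: "cnj (v x) * kop T v x = cnj (v' x) * kop k w x + of_real ((norm (r x))\<^sup>2)" for x
    proof -
      have "kop m v' = kop k w" unfolding m_def w_def by (rule kop_kop[OF k Wc bv', symmetric])
      then show ?thesis
        using Tv[OF bv, of x] complex_norm_square[of "v x"]
        by (auto simp: v'_def[abs_def] r_def mult.commute)
    qed
    have akw: "absum (\<lambda>x. cnj (v' x) * kop k w x)"
      using absum_mult_bdd[OF absum_kop[OF k aw] bdd_cnj[OF bv']] by (simp add: mult.commute)
    have pair: "?I (\<lambda>x. cnj (v' x) * kop k w x) = of_real (?I (\<lambda>x. (norm (w x))\<^sup>2))"
    proof -
      have "absum (\<lambda>x. cnj (v' x))" using av' by (simp add: absum_iff)
      then have "(\<Sum>\<^sub>\<infinity>x. cnj (v' x) * kop k w x) = (\<Sum>\<^sub>\<infinity>y. kop (adj_kernel k) (\<lambda>x. cnj (v' x)) y * w y)"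
        by (rule kop_pairing_absum[OF k _ bw])
      also have "\<dots> = (\<Sum>\<^sub>\<infinity>y. of_real ((norm (w y))\<^sup>2))"
        unfolding adjw using complex_norm_square by (metis mult.commute)
      finally have "?I (\<lambda>x. cnj (v' x) * kop k w x) = (\<Sum>\<^sub>\<infinity>y. of_real ((norm (w y))\<^sup>2))"
        using infsum_eq_integral[OF akw] by simp
      also have "\<dots> = ?I (\<lambda>y. of_real ((norm (w y))\<^sup>2))"
        by (rule infsum_eq_integral) (rule integrable_of_real[OF absum_sq[OF aw]])
      also have "\<dots> = of_real (?I (\<lambda>x. (norm (w x))\<^sup>2))"
        by (rule integral_of_real[OF absum_sq[OF aw]])
      finally show ?thesis .
    qed
    have "?I (\<lambda>x. cnj (v x) * kop T v x) = ?I (\<lambda>x. cnj (v' x) * kop k w x) + ?I (\<lambda>x. complex_of_real ((norm (r x))\<^sup>2))"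
      unfolding Tvx by (rule Bochner_Integration.integral_add[OF akw integrable_of_real[OF absum_sq[OF ar]]])
    also have "\<dots> = of_real (?I (\<lambda>x. (norm (w x))\<^sup>2) + ?I (\<lambda>x. (norm (r x))\<^sup>2))"
      unfolding pair integral_of_real[OF absum_sq[OF ar]] by simp
    finally have Req: "Re (?I (\<lambda>x. cnj (v x) * kop T v x)) = ?I (\<lambda>x. (norm (w x))\<^sup>2) + ?I (\<lambda>x. (norm (r x))\<^sup>2)"
      by simp
    have "pn 2 (\<lambda>x. cnj (v' x)) \<le> ennreal C * pn 2 (kop (adj_kernel k) (\<lambda>x. cnj (v' x)))"
      by (rule C(2)[OF bdd_cnj[OF bv']]) (simp add: v'_def)
    then have "pn 2 v' \<le> ennreal C * pn 2 w"
      by (simp add: pn_def adjw)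
    then have "?I (\<lambda>x. (norm (v' x))\<^sup>2) \<le> C * ?I (\<lambda>x. (norm (w x))\<^sup>2)"
      using C(1) by (simp add: pn2_eq[OF av'] pn2_eq[OF aw] ennreal_mult'[symmetric] integral_nonneg)
    then have "c * ?I (\<lambda>x. (norm (v' x))\<^sup>2) \<le> c * (C * ?I (\<lambda>x. (norm (w x))\<^sup>2))"
      using c by (intro mult_left_mono) auto
    also have "\<dots> \<le> 1 * ?I (\<lambda>x. (norm (w x))\<^sup>2)"
      unfolding mult.assoc[symmetric] by (rule mult_right_mono[OF c(3)]) (simp add: integral_nonneg)
    finally have 1: "c * ?I (\<lambda>x. (norm (v' x))\<^sup>2) \<le> ?I (\<lambda>x. (norm (w x))\<^sup>2)" by simp
    have 2: "c * ?I (\<lambda>x. (norm (r x))\<^sup>2) \<le> 1 * ?I (\<lambda>x. (norm (r x))\<^sup>2)"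
      by (rule mult_right_mono[OF c(2)]) (simp add: integral_nonneg)
    have "(norm (v x))\<^sup>2 = (norm (v' x))\<^sup>2 + (norm (r x))\<^sup>2" for x by (simp add: v'_def r_def)
    then have "?I (\<lambda>x. (norm (v x))\<^sup>2) = ?I (\<lambda>x. (norm (v' x))\<^sup>2) + ?I (\<lambda>x. (norm (r x))\<^sup>2)"
      using absum_sq[OF av'] absum_sq[OF ar] by simp
    then show ?thesis unfolding Req using 1 2 by (simp add: distrib_left)
  qed
  obtain s where s: "Wk s" "kmul T s = kid"
    using coercive_invertible[OF WT c(1) co] by blast
  define b where "b = kmul (cstar k) s"
  have "kmul k b x y = kid x y" if x: "x \<in> Y" and y: "y \<in> Y" for x y
  proof -
    have bs: "bdd (\<lambda>z. s z y)" by (rule Wk_column_bdd[OF s(1)])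
    have sT: "kop T (\<lambda>z. s z y) z = kid z y" for z
      using s(2) by (simp add: kmul_column[symmetric])
    \<comment> \<open>Off \<open>Y\<close> the operator acts as the identity, so a column of its
      inverse with index in \<open>Y\<close> vanishes there and is not changed by restriction to
      \<open>Y\<close>.\<close>
    have "s z y = 0" if "z \<notin> Y" for z
      using sT[of z] Tv[OF bs, of z] that y by (auto simp: kid_def)
    then have sY: "(\<lambda>z. if z \<in> Y then s z y else 0) = (\<lambda>z. s z y)" by auto
    have "kmul k b x y = kop k (kop (cstar k) (\<lambda>z. s z y)) x"
      by (simp add: b_def kmul_column)
    also have "\<dots> = kop m (\<lambda>z. s z y) x" unfolding m_def by (simp add: kop_kop[OF k Wc bs])
    also have "\<dots> = kop T (\<lambda>z. s z y) x" using Tv[OF bs, of x] x by (simp add: sY)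
    finally show ?thesis by (simp add: sT)
  qed
  moreover have "Wk b" unfolding b_def by (rule Wk_kmul[OF Wc s(1)])
  ultimately show ?thesis by blast
qed

lemma kmul_adj: "kmul (adj_kernel k) (adj_kernel l) = adj_kernel (kmul l k)"
  by (simp add: kmul_def adj_kernel_def mult.commute)

text \<open>Obtained by transposing a right regularizer of the transpose.\<close>

corollary left_regularizer:
  assumes k: "Wk k" and lb: "LBinf Y k"
  shows "\<exists>b. Wk b \<and> (\<forall>x\<in>Y. \<forall>y\<in>Y. kmul b k x y = kid x y)"
proof -
  obtain b where b: "Wk b" "\<And>x y. x \<in> Y \<Longrightarrow> y \<in> Y \<Longrightarrow> kmul (adj_kernel k) b x y = kid x y"
    using right_regularizer[OF Wk_adj[OF k], of Y] lb by auto
  have "kmul (adj_kernel b) k x y = kid x y" if "x \<in> Y" "y \<in> Y" for x y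
    using b(2)[OF that(2,1)] kmul_adj[of k "adj_kernel b"] by (simp add: adj_kernel_def kid_def)
  then show ?thesis using Wk_adj[OF b(1)] by blast
qed

end

subsection \<open>The spaces of p-summable functions\<close>

lemma lp_iff: "u \<in> lp (ereal p) \<longleftrightarrow> pn p u < top"
  by (simp add: lp_def pn_def summable_on_nonneg_iff(1))

lemma lp_norm_eq: "lp_norm (ereal p) u = enn2real (pn p u) powr (1 / p)"
  by (simp add: lp_norm_def pn_def summable_on_nonneg_iff(2))

lemma lp_norm_nonneg: "0 \<le> lp_norm (ereal p) u"
  by (simp add: lp_norm_eq)

lemma pn_eq_lp_norm: "0 < p \<Longrightarrow> u \<in> lp (ereal p) \<Longrightarrow> pn p u = ennreal (lp_norm (ereal p) u powr p)"
  by (simp add: lp_iff lp_norm_eq powr_powr ennreal_enn2real_if)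

lemma lp_norm_leI:
  assumes "0 < p" "0 \<le> C" "pn p u \<le> ennreal (C powr p)"
  shows "lp_norm (ereal p) u \<le> C"
proof -
  have "enn2real (pn p u) \<le> C powr p"
    using enn2real_mono[OF assms(3)] by simp
  then have "enn2real (pn p u) powr (1/p) \<le> (C powr p) powr (1/p)"
    using assms(1) by (intro powr_mono2) auto
  then show ?thesis using assms(1,2) by (simp add: lp_norm_eq powr_powr)
qed

lemma norm_le_lp_norm:
  assumes "0 < p" "u \<in> lp (ereal p)"
  shows "norm (u x) \<le> lp_norm (ereal p) u"
proof -
  have "ennreal (norm (u x) powr p) \<le> pn p u"
    unfolding pn_def by (rule nsum_ge)
  then have "norm (u x) powr p \<le> lp_norm (ereal p) u powr p"
    using assms by (simp add: pn_eq_lp_norm)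
  then show ?thesis
    using powr_less_mono2[OF assms(1) lp_norm_nonneg] by (meson not_le)
qed

lemma lp_bdd: "0 < p \<Longrightarrow> u \<in> lp (ereal p) \<Longrightarrow> bdd u"
  by (rule bddI) (rule norm_le_lp_norm)

lemma lp_norm_mono:
  assumes "0 < p" "v \<in> lp (ereal p)" "\<And>x. norm (u x) \<le> norm (v x)"
  shows "u \<in> lp (ereal p)" "lp_norm (ereal p) u \<le> lp_norm (ereal p) v"
proof -
  have le: "pn p u \<le> pn p v" by (rule pn_mono) (use assms in auto)
  then show "u \<in> lp (ereal p)" using assms(2) by (auto simp: lp_iff intro: le_less_trans)
  show "lp_norm (ereal p) u \<le> lp_norm (ereal p) v"
    by (rule lp_norm_leI) (use assms le in \<open>auto simp: lp_norm_nonneg pn_eq_lp_norm\<close>)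
qed

lemma lp_zero: "0 < p \<Longrightarrow> (\<lambda>x. 0) \<in> lp (ereal p)" "0 < p \<Longrightarrow> lp_norm (ereal p) (\<lambda>x. 0) = 0"
  by (simp_all add: lp_iff lp_norm_eq pn_def)

lemma lp_finite_support:
  assumes "0 < p" "finite {x. u x \<noteq> 0}"
  shows "u \<in> lp (ereal p)"
  unfolding lp_iff pn_def using assms by (subst nsum_finite_support[of "{x. u x \<noteq> 0}"]) auto

lemma lp_cmult:
  assumes "0 < p" "u \<in> lp (ereal p)"
  shows "(\<lambda>x. c * u x) \<in> lp (ereal p)" "lp_norm (ereal p) (\<lambda>x. c * u x) = norm c * lp_norm (ereal p) u"
proof -
  show "(\<lambda>x. c * u x) \<in> lp (ereal p)"
    using assms by (simp add: lp_iff pn_cmult ennreal_mult_less_top)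
  have "pn p (\<lambda>x. c * u x) = ennreal ((norm c * lp_norm (ereal p) u) powr p)"
    using assms by (simp add: pn_cmult pn_eq_lp_norm powr_mult lp_norm_nonneg ennreal_mult)
  then show "lp_norm (ereal p) (\<lambda>x. c * u x) = norm c * lp_norm (ereal p) u"
    using assms(1) by (simp add: lp_norm_eq[of p "\<lambda>x. c * u x"] powr_powr lp_norm_nonneg)
qed

lemma lp_add:
  assumes "1 \<le> p" "u \<in> lp (ereal p)" "v \<in> lp (ereal p)"
  shows "(\<lambda>x. u x + v x) \<in> lp (ereal p)"
  using pn_add_le[OF assms(1), of u v] assms(2,3) by (auto simp: lp_iff ennreal_mult_less_top intro: le_less_trans)

lemma lp_diff:
  assumes "1 \<le> p" "u \<in> lp (ereal p)" "v \<in> lp (ereal p)"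
  shows "(\<lambda>x. u x - v x) \<in> lp (ereal p)"
  using pn_diff_le[OF assms(1), of u v] assms(2,3) by (auto simp: lp_iff ennreal_mult_less_top intro: le_less_trans)

lemma convex_powr:
  fixes l a b p :: real
  assumes p: "1 \<le> p" and l: "0 \<le> l" "l \<le> 1" and "0 \<le> a" "0 \<le> b"
  shows "(l * a + (1 - l) * b) powr p \<le> l * a powr p + (1 - l) * b powr p"
proof (cases "l * a + (1 - l) * b = 0")
  case True
  then show ?thesis using assms by simp
next
  case False
  define m where "m = l * a + (1 - l) * b"
  have m: "0 < m" using False assms by (simp add: m_def order_less_le)
  have "l * (p * m powr (p - 1) * a) + (1 - l) * (p * m powr (p - 1) * b)
      \<le> l * (a powr p + (p - 1) * m powr p) + (1 - l) * (b powr p + (p - 1) * m powr p)"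
    by (intro add_mono mult_left_mono young_tangent) (use assms m in auto)
  moreover have "l * (p * m powr (p - 1) * a) + (1 - l) * (p * m powr (p - 1) * b) = p * m powr p"
  proof -
    have "m powr (p - 1) * m = m powr p"
      using m powr_mult_base[of m "p - 1"] by (simp add: mult.commute)
    moreover have "l * (p * m powr (p - 1) * a) + (1 - l) * (p * m powr (p - 1) * b) = p * (m powr (p - 1) * m)"
      unfolding m_def by (simp add: algebra_simps)
    ultimately show ?thesis by simp
  qed
  moreover have "l * (a powr p + (p - 1) * m powr p) + (1 - l) * (b powr p + (p - 1) * m powr p)
    = l * a powr p + (1 - l) * b powr p + p * m powr p - m powr p" by (simp add: algebra_simps)
  ultimately have "m powr p \<le> l * a powr p + (1 - l) * b powr p" by linarith
  then show ?thesis by (simp only: m_def)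
qed

lemma lp_norm_zero_imp:
  assumes "0 < p" "u \<in> lp (ereal p)" "lp_norm (ereal p) u = 0"
  shows "u = (\<lambda>x. 0)"
  using norm_le_lp_norm[OF assms(1,2)] assms(3) by auto

text \<open>Minkowski's inequality: if both norms are positive, \<open>u + v\<close> is
  \<open>s + t\<close> times the convex combination of \<open>u / s\<close> and \<open>v / t\<close>
  with weight \<open>s / (s + t)\<close>, and convexity of the power is summed over the
  points.\<close>

lemma lp_norm_triangle:
  assumes p: "1 \<le> p" and u: "u \<in> lp (ereal p)" and v: "v \<in> lp (ereal p)"
  shows "lp_norm (ereal p) (\<lambda>x. u x + v x) \<le> lp_norm (ereal p) u + lp_norm (ereal p) v"
proof -
  define s where "s = lp_norm (ereal p) u"
  define t where "t = lp_norm (ereal p) v"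
  have p0: "0 < p" using p by simp
  consider "s = 0" | "t = 0" | "0 < s" "0 < t"
    using lp_norm_nonneg[of p u] lp_norm_nonneg[of p v] by (force simp: s_def t_def)
  then show ?thesis
  proof cases
    case 1
    then show ?thesis using lp_norm_zero_imp[OF p0 u] lp_norm_nonneg[of p u] by (simp add: s_def)
  next
    case 2
    then show ?thesis using lp_norm_zero_imp[OF p0 v] lp_norm_nonneg[of p v] by (simp add: t_def)
  next
    case 3
    define l where "l = s / (s + t)"
    have l: "0 \<le> l" "l \<le> 1" "1 - l = t / (s + t)" using 3 by (auto simp: l_def field_simps)
    have "ennreal (norm (u x + v x) powr p)
      \<le> ennreal ((s + t) powr p * (l / s powr p)) * ennreal (norm (u x) powr p)
        + ennreal ((s + t) powr p * ((1 - l) / t powr p)) * ennreal (norm (v x) powr p)" for x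
    proof -
      have "norm (u x + v x) \<le> (s + t) * (l * (norm (u x) / s) + (1 - l) * (norm (v x) / t))"
      proof -
        have st: "s + t \<noteq> 0" "s \<noteq> 0" "t \<noteq> 0" using 3 by auto
        have "(s + t) * (l * (norm (u x) / s)) = norm (u x)" using st by (simp add: l_def)
        moreover have "(s + t) * ((1 - l) * (norm (v x) / t)) = norm (v x)" using st by (simp add: l(3))
        ultimately show ?thesis using norm_triangle_ineq[of "u x" "v x"] by (simp only: distrib_left)
      qed
      then have "norm (u x + v x) powr p \<le> ((s + t) * (l * (norm (u x) / s) + (1 - l) * (norm (v x) / t))) powr p"
        using p by (intro powr_mono2) auto
      also have "\<dots> = (s + t) powr p * (l * (norm (u x) / s) + (1 - l) * (norm (v x) / t)) powr p"
        by (rule powr_mult)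
      also have "\<dots> \<le> (s + t) powr p * (l * (norm (u x) / s) powr p + (1 - l) * (norm (v x) / t) powr p)"
        by (intro mult_left_mono convex_powr p l) (use 3 in auto)
      also have "\<dots> = (s + t) powr p * (l / s powr p) * norm (u x) powr p + (s + t) powr p * ((1 - l) / t powr p) * norm (v x) powr p"
        using 3 by (simp add: powr_divide distrib_left)
      finally show ?thesis
        using l 3 by (simp add: ennreal_mult[symmetric] ennreal_plus[symmetric] ennreal_leI del: ennreal_plus)
    qed
    then have "pn p (\<lambda>x. u x + v x) \<le> ennreal ((s + t) powr p * (l / s powr p)) * pn p u
        + ennreal ((s + t) powr p * ((1 - l) / t powr p)) * pn p v"
      unfolding pn_def by (subst (1 2) nn_integral_cmult[symmetric], simp, simp, subst nn_integral_add[symmetric]) (auto intro!: nn_integral_mono)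
    also have "\<dots> = ennreal ((s + t) powr p * (l / s powr p) * s powr p + (s + t) powr p * ((1 - l) / t powr p) * t powr p)"
      using l 3 by (simp add: pn_eq_lp_norm[OF p0 u] pn_eq_lp_norm[OF p0 v] s_def[symmetric] t_def[symmetric] ennreal_mult[symmetric] ennreal_plus[symmetric] del: ennreal_plus)
    also have "(s + t) powr p * (l / s powr p) * s powr p + (s + t) powr p * ((1 - l) / t powr p) * t powr p = (s + t) powr p"
      using 3 by (simp add: field_simps)
    finally show ?thesis
      unfolding s_def[symmetric] t_def[symmetric] using 3 p0 by (intro lp_norm_leI) auto
  qed
qed

lemma lp_norm_minus_commute: "lp_norm (ereal p) (\<lambda>x. u x - v x) = lp_norm (ereal p) (\<lambda>x. v x - u x)"
  by (simp add: lp_norm_eq pn_def norm_minus_commute)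

lemma lp_sum:
  assumes p: "1 \<le> p" and "finite F" "\<And>f. f \<in> F \<Longrightarrow> g f \<in> lp (ereal p)"
  shows "(\<lambda>x. \<Sum>f\<in>F. c f * g f x) \<in> lp (ereal p)"
    "lp_norm (ereal p) (\<lambda>x. \<Sum>f\<in>F. c f * g f x) \<le> (\<Sum>f\<in>F. norm (c f) * lp_norm (ereal p) (g f))"
proof -
  have p0: "0 < p" using p by simp
  have "(\<lambda>x. \<Sum>f\<in>F. c f * g f x) \<in> lp (ereal p) \<and>
    lp_norm (ereal p) (\<lambda>x. \<Sum>f\<in>F. c f * g f x) \<le> (\<Sum>f\<in>F. norm (c f) * lp_norm (ereal p) (g f))"
    using assms(2,3)
  proof (induction F rule: finite_induct)
    case empty
    show ?case by (simp add: lp_zero[OF p0])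
  next
    case (insert f F)
    then show ?case
      using lp_add[OF p lp_cmult(1)[OF p0, of "g f" "c f"], of "\<lambda>x. \<Sum>f\<in>F. c f * g f x"]
        lp_norm_triangle[OF p lp_cmult(1)[OF p0, of "g f" "c f"], of "\<lambda>x. \<Sum>f\<in>F. c f * g f x"]
        lp_cmult(2)[OF p0, of "g f" "c f"]
      by simp
  qed
  then show "(\<lambda>x. \<Sum>f\<in>F. c f * g f x) \<in> lp (ereal p)"
    "lp_norm (ereal p) (\<lambda>x. \<Sum>f\<in>F. c f * g f x) \<le> (\<Sum>f\<in>F. norm (c f) * lp_norm (ereal p) (g f))" by auto
qed

text \<open>Each function added to the spanning set adds at most one dimension to \<open>Z\<close>, which is accounted for by
  evaluation at a point where the new direction does not vanish.\<close>

lemma finite_dim_interpolation: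
  assumes "finite F" "Z \<subseteq> fin_span F"
    and "\<And>u v. u \<in> Z \<Longrightarrow> v \<in> Z \<Longrightarrow> (\<lambda>x. u x + v x) \<in> Z" "\<And>c u. u \<in> Z \<Longrightarrow> (\<lambda>x. c * u x) \<in> Z"
  shows "\<exists>S e. finite S \<and> (\<forall>z\<in>Z. \<forall>s\<in>S. e s \<in> Z) \<and> (\<forall>z\<in>Z. z = (\<lambda>x. \<Sum>s\<in>S. z s * e s x))"
  using assms
proof (induction F arbitrary: Z rule: finite_induct)
  case empty
  then have "\<And>z. z \<in> Z \<Longrightarrow> z = (\<lambda>x. 0)" by (auto simp: fin_span_def)
  then show ?case by (intro exI[of _ "{}"]) auto
next
  case (insert f F)
  define Z' where "Z' = Z \<inter> fin_span F"
  have span_add: "(\<lambda>x. u x + v x) \<in> fin_span F" if uv: "u \<in> fin_span F" "v \<in> fin_span F" for u v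
  proof -
    obtain c where "u = (\<lambda>x. \<Sum>f\<in>F. c f * f x)" using uv(1) unfolding fin_span_def by blast
    moreover obtain d where "v = (\<lambda>x. \<Sum>f\<in>F. d f * f x)" using uv(2) unfolding fin_span_def by blast
    ultimately have "(\<lambda>x. u x + v x) = (\<lambda>x. \<Sum>f\<in>F. (c f + d f) * f x)" by (simp add: sum.distrib distrib_right)
    then show ?thesis unfolding fin_span_def by (auto intro!: exI[of _ "\<lambda>f. c f + d f"])
  qed
  have span_cmult: "(\<lambda>x. a * u x) \<in> fin_span F" if u: "u \<in> fin_span F" for a u
  proof -
    obtain c where "u = (\<lambda>x. \<Sum>f\<in>F. c f * f x)" using u unfolding fin_span_def by blast
    then have "(\<lambda>x. a * u x) = (\<lambda>x. \<Sum>f\<in>F. (a * c f) * f x)" by (simp add: sum_distrib_left mult.assoc)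
    then show ?thesis unfolding fin_span_def by (auto intro!: exI[of _ "\<lambda>f. a * c f"])
  qed
  have "\<exists>S e. finite S \<and> (\<forall>z\<in>Z'. \<forall>s\<in>S. e s \<in> Z') \<and> (\<forall>z\<in>Z'. z = (\<lambda>x. \<Sum>s\<in>S. z s * e s x))"
    by (rule insert.IH) (use insert.prems span_add span_cmult in \<open>auto simp: Z'_def\<close>)
  then obtain S e where S: "finite S" "\<And>z s. z \<in> Z' \<Longrightarrow> s \<in> S \<Longrightarrow> e s \<in> Z'" "\<And>z. z \<in> Z' \<Longrightarrow> z = (\<lambda>x. \<Sum>s\<in>S. z s * e s x)"
    by metis
  show ?case
  proof (cases "Z \<subseteq> Z'")
    case True
    then have "Z = Z'" by (auto simp: Z'_def)
    then show ?thesis using S by blast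
  next
    case False
    then obtain z0 where z0: "z0 \<in> Z" "z0 \<notin> Z'" by blast
    have zero: "(\<lambda>x. 0) \<in> Z'"
      using insert.prems(3)[OF z0(1), of 0] by (auto simp: Z'_def fin_span_def intro!: exI[of _ "\<lambda>_. 0"])
    have eZ: "e s \<in> Z" if "s \<in> S" for s using S(2)[OF zero that] by (auto simp: Z'_def)
    have lin: "(\<lambda>x. u x - a * v x) \<in> Z" if "u \<in> Z" "v \<in> Z" for u v a
      using insert.prems(2)[OF that(1) insert.prems(3)[OF that(2), of "- a"]] by simp
    have Zsum: "(\<lambda>x. \<Sum>s\<in>S. c s * e s x) \<in> Z" for c
      using S(1) eZ
    proof (induction S rule: finite_induct)
      case empty
      then show ?case using zero by (simp add: Z'_def)
    next
      case (insert s S)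
      then show ?case using insert.prems \<open>\<And>u v. u \<in> Z \<Longrightarrow> v \<in> Z \<Longrightarrow> (\<lambda>x. u x + v x) \<in> Z\<close> \<open>\<And>c u. u \<in> Z \<Longrightarrow> (\<lambda>x. c * u x) \<in> Z\<close> by simp
    qed
    have split: "\<exists>a. \<exists>g\<in>fin_span F. z = (\<lambda>x. a * f x + g x)" if z: "z \<in> Z" for z
    proof -
      obtain c where "z = (\<lambda>x. \<Sum>f\<in>insert f F. c f * f x)" using z insert.prems(1) unfolding fin_span_def by blast
      then have "z = (\<lambda>x. c f * f x + (\<Sum>f\<in>F. c f * f x))" using insert.hyps by simp
      moreover have "(\<lambda>x. \<Sum>f\<in>F. c f * f x) \<in> fin_span F" by (auto simp: fin_span_def)
      ultimately show ?thesis by (intro exI[of _ "c f"] bexI[of _ "\<lambda>x. \<Sum>f\<in>F. c f * f x"])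
    qed
    obtain c0 g0 where g0: "g0 \<in> fin_span F" "z0 = (\<lambda>x. c0 * f x + g0 x)" using split[OF z0(1)] by blast
    have c0: "c0 \<noteq> 0" using g0 z0 by (auto simp: Z'_def)
    \<comment> \<open>The interpolation defect of \<open>z0\<close>. Every element of
      \<open>Z\<close> differs from its interpolation at \<open>S\<close> by a multiple of
      \<open>z1\<close>, so one further evaluation point determines it.\<close>
    define z1 where "z1 x = z0 x - (\<Sum>s\<in>S. z0 s * e s x)" for x
    have z1Z: "z1 \<in> Z" using lin[OF z0(1) Zsum[of z0], of 1] by (simp add: z1_def[abs_def])
    have dec: "\<exists>l. z = (\<lambda>x. l * z1 x + (\<Sum>s\<in>S. z s * e s x))" if z: "z \<in> Z" for z
    proof -
      obtain c g where g: "g \<in> fin_span F" "z = (\<lambda>x. c * f x + g x)" using split[OF z] by blast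
      define l where "l = c / c0"
      have eq: "(\<lambda>x. z x - l * z0 x) = (\<lambda>x. g x + (- l) * g0 x)"
        using c0 by (subst g(2), subst g0(2)) (simp add: l_def fun_eq_iff algebra_simps)
      have in': "(\<lambda>x. z x - l * z0 x) \<in> Z'"
        unfolding Z'_def using lin[OF z z0(1), of l] span_add[OF g(1) span_cmult[OF g0(1), of "- l"]]
        by (simp only: eq Int_iff)
      have "z x = l * z1 x + (\<Sum>s\<in>S. z s * e s x)" for x
         using fun_cong[OF S(3)[OF in'], of x] by (simp add: z1_def left_diff_distrib sum_subtractf sum_distrib_left algebra_simps)
      then show ?thesis by blast
    qed
    have "z1 \<noteq> (\<lambda>x. 0)"
    proof
      assume "z1 = (\<lambda>x. 0)"
      then have "z0 x - (\<Sum>s\<in>S. z0 s * e s x) = 0" for x unfolding z1_def by (rule fun_cong)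
      then have eq: "z0 = (\<lambda>x. \<Sum>s\<in>S. z0 s * e s x)"
        by (intro ext) (rule eq_iff_diff_eq_0[THEN iffD2])
      have "(\<lambda>x. \<Sum>s\<in>S. c s * e s x) \<in> fin_span F" for c
        using S(1) S(2)[OF zero]
      proof (induction S rule: finite_induct)
        case empty
        then show ?case using zero by (simp add: Z'_def)
      next
        case (insert s S)
        then show ?case using span_add span_cmult by (auto simp: Z'_def)
      qed
      then have "z0 \<in> fin_span F" using eq by metis
      then show False using z0 by (simp add: Z'_def)
    qed
    then obtain t where t: "z1 t \<noteq> 0" by auto
    \<comment> \<open>Extension by zero makes the formula for \<open>E\<close> correct whether or
      not \<open>t\<close> already lies in \<open>S\<close>. The coefficient of \<open>z1\<close>,
      read off at \<open>t\<close>, is built into \<open>E\<close>.\<close>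
    define e0 where "e0 s = (if s \<in> S then e s else (\<lambda>x. 0))" for s
    define E where "E s x = (e0 s x - e0 s t / z1 t * z1 x) + (if s = t then 1 / z1 t else 0) * z1 x" for s x
    have e0Z: "e0 s \<in> Z" for s using eZ zero by (simp add: e0_def Z'_def)
    have EZ: "E s \<in> Z" for s
      using insert.prems(2)[OF lin[OF e0Z z1Z, of s "e0 s t / z1 t"] insert.prems(3)[OF z1Z, of "if s = t then 1 / z1 t else 0"]]
      by (simp add: E_def[abs_def])
    have "z = (\<lambda>x. \<Sum>s\<in>insert t S. z s * E s x)" if z: "z \<in> Z" for z
    proof
      fix x
      obtain l where l: "\<And>x. z x = l * z1 x + (\<Sum>s\<in>S. z s * e s x)" using dec[OF z] by metis
      have sum0: "(\<Sum>s\<in>insert t S. z s * e0 s y) = (\<Sum>s\<in>S. z s * e s y)" for y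
        using S(1) by (intro sum.mono_neutral_cong_right) (auto simp: e0_def)
      have "(\<Sum>s\<in>insert t S. z s * E s x)
        = (\<Sum>s\<in>insert t S. z s * e0 s x) - (\<Sum>s\<in>insert t S. z s * e0 s t) / z1 t * z1 x
          + (\<Sum>s\<in>insert t S. if s = t then z s / z1 t * z1 x else 0)"
        unfolding E_def sum_divide_distrib sum_distrib_right sum_subtractf[symmetric] sum.distrib[symmetric]
        by (rule sum.cong) (auto simp: algebra_simps)
      also have "(\<Sum>s\<in>insert t S. if s = t then z s / z1 t * z1 x else 0) = z t / z1 t * z1 x"
        using S(1) by simp
      also have "(\<Sum>s\<in>insert t S. z s * e0 s x) - (\<Sum>s\<in>insert t S. z s * e0 s t) / z1 t * z1 x + z t / z1 t * z1 x
         = (\<Sum>s\<in>S. z s * e s x) + (z t - (\<Sum>s\<in>S. z s * e s t)) / z1 t * z1 x"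
        unfolding sum0 using t by (simp add: diff_divide_distrib algebra_simps)
      also have "z t - (\<Sum>s\<in>S. z s * e s t) = l * z1 t" using l[of t] by simp
      finally show "z x = (\<Sum>s\<in>insert t S. z s * E s x)" using l[of x] t by simp
    qed
    then show ?thesis using S(1) EZ by (intro exI[of _ "insert t S"] exI[of _ E]) auto
  qed
qed

context cells
begin

lemma kop_lp:
  assumes "1 \<le> p" "Wk k" "u \<in> lp (ereal p)"
  shows "kop k u \<in> lp (ereal p)"
proof -
  obtain W where W: "0 < W" "\<And>x. nsum (\<lambda>y. en (k x y)) \<le> ennreal W" "\<And>y. nsum (\<lambda>x. en (k x y)) \<le> ennreal W"
    using Wk_bounds[OF assms(2)] by metis
  have "pn p (kop k u) \<le> ennreal (W powr p) * pn p u"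
    by (rule pn_kop_le) (use assms W in auto)
  also have "\<dots> < top" using assms by (simp add: lp_iff ennreal_mult_less_top)
  finally show ?thesis by (simp add: lp_iff)
qed

lemma kop_lp_norm:
  assumes "Wk k"
  obtains W where "0 < W" "\<And>p u. 1 \<le> p \<Longrightarrow> u \<in> lp (ereal p) \<Longrightarrow> lp_norm (ereal p) (kop k u) \<le> W * lp_norm (ereal p) u"
proof -
  obtain W where W: "0 < W" "\<And>x. nsum (\<lambda>y. en (k x y)) \<le> ennreal W" "\<And>y. nsum (\<lambda>x. en (k x y)) \<le> ennreal W"
    using Wk_bounds[OF assms] by metis
  show ?thesis
  proof (rule that[OF W(1)])
    fix p and u :: "'x \<Rightarrow> complex" assume p: "1 \<le> p" and u: "u \<in> lp (ereal p)"
    have "pn p (kop k u) \<le> ennreal (W powr p) * pn p u"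
      by (rule pn_kop_le) (use p W in auto)
    then show "lp_norm (ereal p) (kop k u) \<le> W * lp_norm (ereal p) u"
      using p u W by (intro lp_norm_leI) (auto simp: lp_norm_nonneg pn_eq_lp_norm powr_mult ennreal_mult)
  qed
qed

lemma bounded_op_kop: "1 \<le> p \<Longrightarrow> Wk k \<Longrightarrow> bounded_op (ereal p) (kop k)"
proof -
  assume p: "1 \<le> p" and k: "Wk k"
  then have p0: "0 < p" by simp
  obtain W where W: "0 < W" "\<And>p u. 1 \<le> p \<Longrightarrow> u \<in> lp (ereal p) \<Longrightarrow> lp_norm (ereal p) (kop k u) \<le> W * lp_norm (ereal p) u"
    using kop_lp_norm[OF k] by metis
  show ?thesis
    unfolding bounded_op_def
    by (intro conjI ballI allI exI[of _ W] kop_lp[OF p k] kop_add[OF k] kop_cmult W(2)[OF p] lp_bdd[OF p0])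
qed

text \<open>A null function is determined by its values on \<open>F\<close>, as the left regularizer
  recovers the others. The right regularizer solves the equation up to functions supported in
  \<open>F\<close>, which bounds the cokernel. The range is closed since its part supported in
  \<open>F\<close> is finite-dimensional and therefore closed under pointwise limits.\<close>

lemma fredholm_of_regularizers:
  assumes p: "1 \<le> p" and k: "Wk k" and F: "finite F"
    and a: "Wk a" "\<And>x y. x \<notin> F \<Longrightarrow> y \<notin> F \<Longrightarrow> kmul k a x y = kid x y"
    and b: "Wk b" "\<And>x y. x \<notin> F \<Longrightarrow> y \<notin> F \<Longrightarrow> kmul b k x y = kid x y"
  shows "fredholm_on (ereal p) (kop k)"
proof -
  have p0: "0 < p" using p by simp
  let ?L = "lp (ereal p) :: ('x \<Rightarrow> complex) set"
  have "\<exists>G. finite G \<and> {u \<in> ?L. kop k u = (\<lambda>x. 0)} \<subseteq> fin_span G"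
  proof -
    \<comment> \<open>\<open>kmul b k\<close> annihilates a null function and has identity entries
      off \<open>F\<close>; separating its columns in \<open>F\<close> gives these coefficient
      functions.\<close>
    define f where "f y x = (if x \<in> F then kid x y else - kmul b k x y)" for y x
    have "u \<in> fin_span (f ` F)" if u: "u \<in> ?L" "kop k u = (\<lambda>x. 0)" for u
    proof -
      have bu: "bdd u" by (rule lp_bdd[OF p0 u(1)])
      have Wbk: "Wk (kmul b k)" by (rule Wk_kmul[OF b(1) k])
      have ux: "u x = (\<Sum>y\<in>F. u y * f y x)" for x
      proof (cases "x \<in> F")
        case True
        then have "(\<Sum>y\<in>F. u y * f y x) = (\<Sum>y\<in>F. if y = x then u x else 0)"
          by (intro sum.cong) (auto simp: f_def kid_def)
        then show ?thesis using True F by simp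
      next
        case False
        define v where "v y = (if y \<in> F then 0 else u y)" for y
        define w where "w y = (if y \<in> F then u y else 0)" for y
        have bv: "bdd v" "bdd w" by (rule bdd_mono[OF bu], simp add: v_def w_def)+
        have "u = (\<lambda>y. v y + w y)" by (auto simp: v_def w_def)
        then have "kop (kmul b k) u x = kop (kmul b k) v x + kop (kmul b k) w x"
          using kop_add[OF Wbk bv] by simp
        moreover have "kop (kmul b k) u x = 0"
          using kop_kop[OF b(1) k bu] u(2) by (metis kop_zero)
        moreover have "kop (kmul b k) v x = kop kid v x"
          unfolding kop_def using False b(2) by (intro infsum_cong) (auto simp: v_def)
        moreover have "kop (kmul b k) w x = (\<Sum>y\<in>F. kmul b k x y * u y)"
          by (subst kop_finite_support[OF F]) (auto simp: w_def)
        ultimately have "u x = - (\<Sum>y\<in>F. kmul b k x y * u y)"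
          using False by (simp add: v_def eq_neg_iff_add_eq_0)
        then show ?thesis using False by (simp add: f_def sum_negf mult.commute)
      qed
      \<comment> \<open>\<open>fin_span\<close> sums over a set of functions, so coefficients
        indexed by points carry over only if distinct points give distinct functions.\<close>
      have inj: "inj_on f F"
      proof (rule inj_onI)
        fix y z assume "y \<in> F" "z \<in> F" "f y = f z"
        then have "f y y = f z y" by simp
        then show "y = z" using \<open>y \<in> F\<close> by (auto simp: f_def kid_def split: if_splits)
      qed
      have "(\<Sum>g\<in>f ` F. u (inv_into F f g) * g x) = (\<Sum>y\<in>F. u y * f y x)" for x
        by (simp add: sum.reindex[OF inj] inv_into_f_f[OF inj])
      then have "u = (\<lambda>x. \<Sum>g\<in>f ` F. u (inv_into F f g) * g x)"
        by (intro ext) (rule trans[OF ux], simp)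
      then show ?thesis unfolding fin_span_def by (rule_tac CollectI, intro exI conjI) auto
    qed
    then show ?thesis using F by (intro exI[of _ "f ` F"]) auto
  qed note ker = this
  define P where "P v x = (if x \<in> F then 0 else v x :: complex)" for v x
  have P: "P v \<in> ?L" "lp_norm (ereal p) (P v) \<le> lp_norm (ereal p) v" if "v \<in> ?L" for v
    by (rule lp_norm_mono[OF p0 that], simp add: P_def)+
  have kP: "kop k (kop a (P v)) x = v x" if "v \<in> ?L" "x \<notin> F" for v x
  proof -
    have "kop k (kop a (P v)) x = kop (kmul k a) (P v) x"
      by (simp add: kop_kop[OF k a(1) lp_bdd[OF p0 P(1)[OF that(1)]]])
    also have "\<dots> = kop kid (P v) x"
      unfolding kop_def using that a(2) by (intro infsum_cong) (auto simp: P_def)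
    finally show ?thesis using that by (simp add: P_def)
  qed
  have aP: "kop a (P v) \<in> ?L" if "v \<in> ?L" for v by (rule kop_lp[OF p a(1) P(1)[OF that]])
  have kadd: "kop k (\<lambda>x. u x + v x) = (\<lambda>x. kop k u x + kop k v x)" if "u \<in> ?L" "v \<in> ?L" for u v
    using kop_add[OF k lp_bdd[OF p0 that(1)] lp_bdd[OF p0 that(2)]] .
  have ran_add: "(\<lambda>x. u x + v x) \<in> kop k ` ?L" if uv: "u \<in> kop k ` ?L" "v \<in> kop k ` ?L" for u v
  proof -
    obtain a b where ab: "a \<in> ?L" "u = kop k a" "b \<in> ?L" "v = kop k b" using uv by blast
    then show ?thesis using kadd[OF ab(1,3)] by (intro image_eqI[OF _ lp_add[OF p ab(1,3)]]) simp
  qed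
  have ran_cmult: "(\<lambda>x. c * u x) \<in> kop k ` ?L" if u: "u \<in> kop k ` ?L" for u c
  proof -
    obtain a where a: "a \<in> ?L" "u = kop k a" using u by blast
    then show ?thesis using kop_cmult[of k c a] by (intro image_eqI[OF _ lp_cmult(1)[OF p0 a(1), of c]]) (simp add: a(2))
  qed
  have supp_span: "z \<in> fin_span (kid ` F)" if "\<And>x. x \<notin> F \<Longrightarrow> z x = 0" for z :: "'x \<Rightarrow> complex"
  proof -
    have inj: "inj_on (kid :: 'x \<Rightarrow> 'x \<Rightarrow> complex) F"
    proof (rule inj_onI)
      fix y z :: 'x assume "kid y = kid z"
      then have "kid y y = kid z y" by simp
      then show "y = z" by (simp add: kid_def split: if_splits)
    qed
    have zx: "z x = (\<Sum>y\<in>F. z y * kid y x)" for x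
    proof -
      have "(\<Sum>y\<in>F. z y * kid y x) = (\<Sum>y\<in>F. if y = x then z x else 0)"
        by (intro sum.cong) (auto simp: kid_def)
      then show ?thesis using F that by auto
    qed
    have "(\<Sum>g\<in>kid ` F. z (inv_into F kid g) * g x) = (\<Sum>y\<in>F. z y * kid y x)" for x
      by (simp add: sum.reindex[OF inj] inv_into_f_f[OF inj])
    then have "z = (\<lambda>x. \<Sum>g\<in>kid ` F. z (inv_into F kid g) * g x)"
      by (intro ext) (rule trans[OF zx], simp)
    then show ?thesis unfolding fin_span_def by (rule_tac CollectI, intro exI conjI) auto
  qed
  have cok: "\<exists>G. finite G \<and> G \<subseteq> ?L \<and> ?L \<subseteq> {(\<lambda>x. r x + s x) | r s. r \<in> kop k ` ?L \<and> s \<in> fin_span G}"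
  proof (intro exI[of _ "kid ` F"] conjI subsetI)
    fix w assume w: "w \<in> ?L"
    have "(\<lambda>x. w x - kop k (kop a (P w)) x) \<in> fin_span (kid ` F)"
      by (rule supp_span) (simp add: kP[OF w])
    moreover have "w = (\<lambda>x. kop k (kop a (P w)) x + (w x - kop k (kop a (P w)) x))" by simp
    ultimately show "w \<in> {(\<lambda>x. r x + s x) | r s. r \<in> kop k ` ?L \<and> s \<in> fin_span (kid ` F)}"
      using aP[OF w]
      by (intro CollectI exI[of _ "kop k (kop a (P w))"] exI[of _ "\<lambda>x. w x - kop k (kop a (P w)) x"]) simp
  next
    fix g assume "g \<in> kid ` F"
    then obtain y where "g = kid y" by blast
    moreover have "{x. kid y x \<noteq> 0} \<subseteq> {y}" by (auto simp: kid_def)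
    ultimately show "g \<in> ?L" by (intro lp_finite_support[OF p0]) (auto intro: finite_subset)
  qed (use F in auto)
  have closed: "w \<in> kop k ` ?L"
    if v: "\<And>m::nat. v m \<in> kop k ` ?L" and w: "w \<in> ?L" and lim: "(\<lambda>m. lp_norm (ereal p) (\<lambda>x. v m x - w x)) \<longlonglongrightarrow> 0" for v w
  proof -
    \<comment> \<open>Interpolation expresses each element of \<open>V\<close> through finitely many
      of its own values, a formula that survives pointwise limits.\<close>
    define V where "V = {z \<in> kop k ` ?L. \<forall>x. x \<notin> F \<longrightarrow> z x = 0}"
    have "\<exists>S e. finite S \<and> (\<forall>z\<in>V. \<forall>s\<in>S. e s \<in> V) \<and> (\<forall>z\<in>V. z = (\<lambda>x. \<Sum>s\<in>S. z s * e s x))"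
      by (rule finite_dim_interpolation[of "kid ` F"])
        (use F ran_add ran_cmult supp_span in \<open>auto simp: V_def\<close>)
    then obtain S e where S: "finite S" "\<forall>z\<in>V. \<forall>s\<in>S. e s \<in> V" "\<forall>z\<in>V. z = (\<lambda>x. \<Sum>s\<in>S. z s * e s x)"
      by (elim exE conjE)
    have vL: "v m \<in> ?L" for m
    proof -
      obtain u where "u \<in> ?L" "v m = kop k u" using v[of m] by (elim imageE)
      then show ?thesis using kop_lp[OF p k] by simp
    qed
    \<comment> \<open>The defect of the approximate right inverse: supported in \<open>F\<close>,
      continuous in \<open>u\<close>, and equal to \<open>u\<close> modulo the range.\<close>
    define d where "d u x = u x - kop k (kop a (P u)) x" for u :: "'x \<Rightarrow> complex" and x
    have dV: "d (v m) \<in> V" for m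
    proof -
      have "(\<lambda>x. (-1) * kop k (kop a (P (v m))) x) \<in> kop k ` ?L"
        by (rule ran_cmult) (use aP[OF vL] in blast)
      from ran_add[OF v this] show ?thesis using kP[OF vL] by (simp add: V_def d_def[abs_def])
    qed
    obtain W1 where W1: "0 < W1" "\<And>p u. 1 \<le> p \<Longrightarrow> u \<in> lp (ereal p) \<Longrightarrow> lp_norm (ereal p) (kop k u) \<le> W1 * lp_norm (ereal p) u"
      using kop_lp_norm[OF k] by metis
    obtain W2 where W2: "0 < W2" "\<And>p u. 1 \<le> p \<Longrightarrow> u \<in> lp (ereal p) \<Longrightarrow> lp_norm (ereal p) (kop a u) \<le> W2 * lp_norm (ereal p) u"
      using kop_lp_norm[OF a(1)] by metis
    have dlim: "(\<lambda>m. d (v m) x) \<longlonglongrightarrow> d w x" for x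
    proof -
      have bd: "norm (d (v m) x - d w x) \<le> (1 + W1 * W2) * lp_norm (ereal p) (\<lambda>x. v m x - w x)" for m
      proof -
        let ?r = "\<lambda>x. v m x - w x"
        have r: "?r \<in> ?L" by (rule lp_diff[OF p vL w])
        have Pr: "P ?r = (\<lambda>x. P (v m) x - P w x)" by (auto simp: P_def)
        have "kop k (kop a (P ?r)) = (\<lambda>x. kop k (kop a (P (v m))) x - kop k (kop a (P w)) x)"
          unfolding Pr kop_diff[OF a(1) lp_bdd[OF p0 P(1)[OF vL]] lp_bdd[OF p0 P(1)[OF w]]]
          by (rule kop_diff[OF k lp_bdd[OF p0 aP[OF vL]] lp_bdd[OF p0 aP[OF w]]])
        then have "d (v m) x - d w x = ?r x - kop k (kop a (P ?r)) x" by (simp add: d_def)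
        then have "norm (d (v m) x - d w x) \<le> norm (?r x) + norm (kop k (kop a (P ?r)) x)"
          using norm_triangle_ineq4 by metis
        also have "\<dots> \<le> lp_norm (ereal p) ?r + lp_norm (ereal p) (kop k (kop a (P ?r)))"
          by (intro add_mono norm_le_lp_norm[OF p0] r kop_lp[OF p k] aP)
        also have "lp_norm (ereal p) (kop k (kop a (P ?r))) \<le> W1 * (W2 * lp_norm (ereal p) ?r)"
        proof -
          have "lp_norm (ereal p) (kop k (kop a (P ?r))) \<le> W1 * lp_norm (ereal p) (kop a (P ?r))"
            by (rule W1(2)[OF p aP[OF r]])
          also have "\<dots> \<le> W1 * (W2 * lp_norm (ereal p) (P ?r))"
            using W1(1) W2(2)[OF p P(1)[OF r]] by (intro mult_left_mono) auto
          also have "\<dots> \<le> W1 * (W2 * lp_norm (ereal p) ?r)"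
            using W1(1) W2(1) P(2)[OF r] by (intro mult_left_mono) auto
          finally show ?thesis .
        qed
        finally show ?thesis by (simp add: algebra_simps)
      qed
      have "(\<lambda>m. (1 + W1 * W2) * lp_norm (ereal p) (\<lambda>x. v m x - w x)) \<longlonglongrightarrow> 0"
        using tendsto_mult_right_zero[OF lim] by simp
      then have "(\<lambda>m. d (v m) x - d w x) \<longlonglongrightarrow> 0"
        by (rule Lim_null_comparison[OF always_eventually[OF allI[OF bd]]])
      then show ?thesis by (simp add: LIM_zero_iff)
    qed
    have "d w x = (\<Sum>s\<in>S. d w s * e s x)" for x
    proof -
      have "(\<lambda>m. \<Sum>s\<in>S. d (v m) s * e s x) \<longlonglongrightarrow> (\<Sum>s\<in>S. d w s * e s x)"
        by (intro tendsto_intros dlim)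
      moreover have "(\<lambda>m. \<Sum>s\<in>S. d (v m) s * e s x) = (\<lambda>m. d (v m) x)"
        by (intro ext) (rule fun_cong[OF bspec[OF S(3) dV], symmetric])
      ultimately show ?thesis using dlim[of x] LIMSEQ_unique by metis
    qed
    then have dw: "d w = (\<lambda>x. \<Sum>s\<in>S. d w s * e s x)" by (rule ext)
    have "(\<lambda>x. \<Sum>s\<in>S. c s * e s x) \<in> kop k ` ?L" for c
      using S(1) bspec[OF S(2) dV[of 0]]
    proof (induction S rule: finite_induct)
      case empty
      show ?case by (rule image_eqI[OF _ lp_zero(1)[OF p0]]) simp
    next
      case (insert s S)
      then show ?case using ran_add ran_cmult by (simp add: V_def)
    qed
    then have "d w \<in> kop k ` ?L" by (subst dw)
    moreover have "w = (\<lambda>x. d w x + kop k (kop a (P w)) x)" by (simp add: d_def)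
    ultimately show ?thesis using ran_add[of "d w" "kop k (kop a (P w))"] aP[OF w] by auto
  qed
  show ?thesis
    unfolding fredholm_on_def
    using bounded_op_kop[OF p k] ker cok closed by blast
qed

end

subsection \<open>Open mapping theorem\<close>

lemma lp_memI: "pn p u \<le> ennreal B \<Longrightarrow> u \<in> lp (ereal p)"
  unfolding lp_iff by (rule le_less_trans[OF _ ennreal_less_top])

lemma pn_fatou:
  assumes p: "0 < p" and lim: "\<And>x. (\<lambda>j::nat. u j x) \<longlonglongrightarrow> v x" and B: "\<And>j. pn p (u j) \<le> B"
  shows "pn p v \<le> B"
proof -
  have "(\<lambda>j. ennreal (norm (u j x) powr p)) \<longlonglongrightarrow> ennreal (norm (v x) powr p)" for x
    by (intro tendsto_intros lim tendsto_ennrealI tendsto_powr2) (use p in auto)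
  then have "ennreal (norm (v x) powr p) = liminf (\<lambda>j. ennreal (norm (u j x) powr p))" for x
    by (metis lim_imp_Liminf sequentially_bot)
  then have "pn p v = nsum (\<lambda>x. liminf (\<lambda>j. ennreal (norm (u j x) powr p)))"
    by (simp add: pn_def)
  also have "\<dots> \<le> liminf (\<lambda>j. pn p (u j))"
    unfolding pn_def by (rule nn_integral_liminf) simp
  also have "\<dots> \<le> B"
    by (rule Liminf_le) (use B in auto)
  finally show ?thesis .
qed

lemma tendsto_infsum_dominated:
  fixes G :: "'a \<Rightarrow> complex"
  assumes G: "absum G" and lim: "\<And>y. (\<lambda>j::nat. f j y :: complex) \<longlonglongrightarrow> g y" and bd: "\<And>j y. norm (f j y) \<le> norm (G y)"
  shows "(\<lambda>j. infsum (f j) UNIV) \<longlonglongrightarrow> infsum g UNIV"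
proof -
  have bg: "norm (g y) \<le> norm (G y)" for y
    by (rule LIMSEQ_le_const2[OF tendsto_norm[OF lim]]) (use bd in auto)
  have af: "absum (f j)" for j
    by (rule Bochner_Integration.integrable_bound[OF G]) (use bd in auto)
  have ag: "absum g"
    by (rule Bochner_Integration.integrable_bound[OF G]) (use bg in auto)
  have "(\<lambda>j. \<integral>y. f j y \<partial>count_space UNIV) \<longlonglongrightarrow> (\<integral>y. g y \<partial>count_space UNIV)"
    by (rule integral_dominated_convergence[where w = "\<lambda>y. norm (G y)"])
      (use lim bd integrable_norm[OF G] in auto)
  then show ?thesis by (simp add: infsum_eq_integral af ag)
qed

text \<open>The limit is taken pointwise, and Fatou's lemma carries the Cauchy bound over to
  it.\<close>

lemma lp_Cauchy_converges:
  fixes \<sigma> :: "nat \<Rightarrow> 'x \<Rightarrow> complex"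
  assumes p: "1 \<le> p" and \<sigma>: "\<And>n. \<sigma> n \<in> lp (ereal p)"
    and cau: "\<And>\<epsilon>. 0 < \<epsilon> \<Longrightarrow> \<exists>N. \<forall>m n. N \<le> m \<longrightarrow> N \<le> n \<longrightarrow> lp_norm (ereal p) (\<lambda>x. \<sigma> m x - \<sigma> n x) < \<epsilon>"
  shows "\<exists>w \<in> lp (ereal p). (\<lambda>n. lp_norm (ereal p) (\<lambda>x. \<sigma> n x - w x)) \<longlonglongrightarrow> 0"
proof -
  have p0: "0 < p" using p by simp
  have C: "Cauchy (\<lambda>n. \<sigma> n x)" for x
  proof (rule metric_CauchyI)
    fix e :: real assume "0 < e"
    then obtain N where N: "\<And>m n. N \<le> m \<Longrightarrow> N \<le> n \<Longrightarrow> lp_norm (ereal p) (\<lambda>x. \<sigma> m x - \<sigma> n x) < e" using cau by blast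
    have "dist (\<sigma> m x) (\<sigma> n x) < e" if "N \<le> m" "N \<le> n" for m n
      using norm_le_lp_norm[OF p0 lp_diff[OF p \<sigma>[of m] \<sigma>[of n]], of x] N[OF that] by (simp add: dist_norm)
    then show "\<exists>M. \<forall>m\<ge>M. \<forall>n\<ge>M. dist (\<sigma> m x) (\<sigma> n x) < e" by blast
  qed
  define w where "w x = lim (\<lambda>n. \<sigma> n x)" for x
  have w: "(\<lambda>n. \<sigma> n x) \<longlonglongrightarrow> w x" for x
    using Cauchy_convergent[OF C] by (simp add: w_def convergent_LIMSEQ_iff)
  have key: "\<exists>N. \<forall>n\<ge>N. (\<lambda>x. \<sigma> n x - w x) \<in> lp (ereal p) \<and> lp_norm (ereal p) (\<lambda>x. \<sigma> n x - w x) \<le> e" if e: "0 < e" for e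
  proof -
    obtain N where N: "\<And>m n. N \<le> m \<Longrightarrow> N \<le> n \<Longrightarrow> lp_norm (ereal p) (\<lambda>x. \<sigma> m x - \<sigma> n x) < e" using cau[OF e] by blast
    have "pn p (\<lambda>x. \<sigma> n x - w x) \<le> ennreal (e powr p)" if n: "N \<le> n" for n
    proof (rule pn_fatou[OF p0, where u = "\<lambda>j x. \<sigma> n x - \<sigma> (j + N) x"])
      show "(\<lambda>j. \<sigma> n x - \<sigma> (j + N) x) \<longlonglongrightarrow> \<sigma> n x - w x" for x
        by (intro tendsto_intros LIMSEQ_ignore_initial_segment w)
      show "pn p (\<lambda>x. \<sigma> n x - \<sigma> (j + N) x) \<le> ennreal (e powr p)" for j
        unfolding pn_eq_lp_norm[OF p0 lp_diff[OF p \<sigma> \<sigma>]]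
        by (intro ennreal_leI powr_mono2) (use p N[OF n, of "j + N"] in \<open>auto simp: lp_norm_nonneg\<close>)
    qed
    then have "\<forall>n\<ge>N. (\<lambda>x. \<sigma> n x - w x) \<in> lp (ereal p) \<and> lp_norm (ereal p) (\<lambda>x. \<sigma> n x - w x) \<le> e"
      using e p0 by (auto intro: lp_memI lp_norm_leI)
    then show ?thesis by blast
  qed
  obtain N where "(\<lambda>x. \<sigma> N x - w x) \<in> lp (ereal p)" using key[of 1] by auto
  from lp_diff[OF p \<sigma>[of N] this] have "w \<in> lp (ereal p)" by simp
  moreover have "(\<lambda>n. lp_norm (ereal p) (\<lambda>x. \<sigma> n x - w x)) \<longlonglongrightarrow> 0"
  proof (rule metric_LIMSEQ_I)
    fix r :: real assume "0 < r"
    then obtain N where N: "\<And>n. N \<le> n \<Longrightarrow> lp_norm (ereal p) (\<lambda>x. \<sigma> n x - w x) \<le> r / 2" using key[of "r/2"] by auto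
    have "dist (lp_norm (ereal p) (\<lambda>x. \<sigma> n x - w x)) 0 < r" if "N \<le> n" for n
      using N[OF that] \<open>0 < r\<close> lp_norm_nonneg[of p "\<lambda>x. \<sigma> n x - w x"] by (simp add: dist_real_def)
    then show "\<exists>no. \<forall>n\<ge>no. dist (lp_norm (ereal p) (\<lambda>x. \<sigma> n x - w x)) 0 < r" by blast
  qed
  ultimately show ?thesis by blast
qed

text \<open>Mirrors the closed range clause of \<open>fredholm_on\<close>, for an arbitrary set in
  place of the range.\<close>

definition seq_closed :: "real \<Rightarrow> ('x \<Rightarrow> complex) set \<Rightarrow> bool" where
  "seq_closed p M \<longleftrightarrow> (\<forall>v w. (\<forall>m::nat. v m \<in> M) \<longrightarrow> w \<in> lp (ereal p) \<longrightarrow>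
     (\<lambda>m. lp_norm (ereal p) (\<lambda>x. v m x - w x)) \<longlonglongrightarrow> 0 \<longrightarrow> w \<in> M)"

lemma seq_closedD:
  "seq_closed p M \<Longrightarrow> (\<And>m::nat. v m \<in> M) \<Longrightarrow> w \<in> lp (ereal p) \<Longrightarrow>
    (\<lambda>m. lp_norm (ereal p) (\<lambda>x. v m x - w x)) \<longlonglongrightarrow> 0 \<Longrightarrow> w \<in> M"
  unfolding seq_closed_def by blast

text \<open>Baire's theorem inside \<open>M\<close>, which is complete as a closed subset of l^p;
  the resulting ball is relative to \<open>M\<close>.\<close>

lemma lp_baire:
  fixes M :: "('x \<Rightarrow> complex) set" and K :: "nat \<Rightarrow> ('x \<Rightarrow> complex) set"
  assumes p: "1 \<le> p" and M: "M \<subseteq> lp (ereal p)" "M \<noteq> {}" "seq_closed p M"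
    and K: "\<And>n. seq_closed p (K n)" "(\<Union>n. K n) = M"
  shows "\<exists>n w \<epsilon>. 0 < \<epsilon> \<and> w \<in> M \<and> (\<forall>v\<in>M. lp_norm (ereal p) (\<lambda>x. w x - v x) < \<epsilon> \<longrightarrow> v \<in> K n)"
proof -
  have p0: "0 < p" using p by simp
  let ?d = "\<lambda>u v. lp_norm (ereal p) (\<lambda>x. u x - v x)"
  interpret Metric_space M ?d
  proof
    fix x y z :: "'x \<Rightarrow> complex"
    show "0 \<le> ?d x y" by (rule lp_norm_nonneg)
    show "?d x y = ?d y x" by (rule lp_norm_minus_commute)
    show "(?d x y = 0) = (x = y)" if "x \<in> M" "y \<in> M"
    proof
      assume "?d x y = 0"
      then have "(\<lambda>t. x t - y t) = (\<lambda>t. 0)" using M(1) that by (intro lp_norm_zero_imp[OF p0 lp_diff[OF p]]) auto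
      then have "x t - y t = 0" for t by (rule fun_cong)
      then show "x = y" by auto
    qed (simp add: lp_zero[OF p0])
    show "?d x z \<le> ?d x y + ?d y z" if "x \<in> M" "y \<in> M" "z \<in> M"
      using lp_norm_triangle[OF p lp_diff[OF p, of x y] lp_diff[OF p, of y z]] M(1) that by auto
  qed
  have lim: "limitin mtopology s l sequentially \<longleftrightarrow> l \<in> M \<and> (\<lambda>n. ?d (s n) l) \<longlonglongrightarrow> 0" if "range s \<subseteq> M" for s :: "nat \<Rightarrow> 'x \<Rightarrow> complex" and l
  proof -
    have "s n \<in> M" for n using that by auto
    then show ?thesis unfolding limit_metric_sequentially LIMSEQ_def
      by (simp add: dist_real_def lp_norm_nonneg)
  qed
  have complete: "mcomplete"
    unfolding mcomplete_def
  proof (intro allI impI)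
    fix s assume s: "MCauchy s"
    then have sM: "range s \<subseteq> M" by (simp add: MCauchy_def)
    have "\<exists>w \<in> lp (ereal p). (\<lambda>n. ?d (s n) w) \<longlonglongrightarrow> 0"
    proof (rule lp_Cauchy_converges[OF p])
      show "s n \<in> lp (ereal p)" for n using sM M(1) by auto
      show "\<exists>N. \<forall>m n. N \<le> m \<longrightarrow> N \<le> n \<longrightarrow> ?d (s m) (s n) < \<epsilon>" if "0 < \<epsilon>" for \<epsilon>
        using s that unfolding MCauchy_def by blast
    qed
    then obtain w where w: "w \<in> lp (ereal p)" "(\<lambda>n. ?d (s n) w) \<longlonglongrightarrow> 0" by blast
    have "w \<in> M" using range_subsetD[OF sM] by (rule seq_closedD[OF M(3) _ w])
    then show "\<exists>x. limitin mtopology s x sequentially" using lim[OF sM] w by blast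
  qed
  have KM: "K n \<subseteq> M" for n using K(2) by blast
  have closedin: "closedin mtopology (K n)" for n
    unfolding metric_closedin_iff_sequentially_closed
  proof (intro conjI allI impI)
    fix s l assume *: "range s \<subseteq> K n \<and> limitin mtopology s l sequentially"
    then have sK: "range s \<subseteq> K n" by blast
    then have "range s \<subseteq> M" using KM by (rule subset_trans)
    from lim[OF this] * have l: "l \<in> M" "(\<lambda>n. ?d (s n) l) \<longlonglongrightarrow> 0" by blast+
    show "l \<in> K n"
    proof (rule seq_closedD[OF K(1) _ _ l(2)])
      show "s m \<in> K n" for m using sK by (rule range_subsetD)
      show "l \<in> lp (ereal p)" using l(1) M(1) by (rule rev_subsetD)
    qed
  qed (rule KM)
  have "\<exists>n. mtopology interior_of (K n) \<noteq> {}"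
  proof (rule ccontr)
    assume "\<not> ?thesis"
    then have "mtopology interior_of \<Union> (range K) = {}"
      using closedin by (intro metric_Baire_category_alt complete) auto
    moreover have "\<Union> (range K) = M" using K(2) by simp
    moreover have "mtopology interior_of M = M"
      using interior_of_topspace[of mtopology] by simp
    ultimately show False using M(2) by simp
  qed
  then obtain n w where "w \<in> mtopology interior_of (K n)" by blast
  then obtain \<epsilon> where "w \<in> M" "0 < \<epsilon>" "mball w \<epsilon> \<subseteq> K n" by (auto simp: metric_interior_of)
  then show ?thesis by (intro exI[of _ n] exI[of _ w] exI[of _ \<epsilon>]) (auto simp: mball_def)
qed

context cells
begin

lemma kop_pointwise_limit:
  assumes k: "Wk k" and U: "\<And>j y. norm (u j y) \<le> U" and lim: "\<And>y. (\<lambda>j::nat. u j y) \<longlonglongrightarrow> v y"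
  shows "(\<lambda>j. kop k (u j) x) \<longlonglongrightarrow> kop k v x"
  unfolding kop_def
proof (rule tendsto_infsum_dominated[where G = "\<lambda>y. k x y * of_real U"])
  have "0 \<le> U" using U norm_ge_zero order_trans by blast
  then show "absum (\<lambda>y. k x y * of_real U)" using absum_row[OF k] by simp
  show "norm (k x y * u j y) \<le> norm (k x y * of_real U)" for j y
    using U \<open>0 \<le> U\<close> by (simp add: norm_mult mult_left_mono)
qed (intro tendsto_intros lim)

text \<open>The set \<open>F\<close> will be empty when the range itself is studied, and will span a
  complement of the range modulo it when the sums are to fill the whole space.\<close>

definition ball_image :: "real \<Rightarrow> ('x \<Rightarrow> 'x \<Rightarrow> complex) \<Rightarrow> ('x \<Rightarrow> complex) set \<Rightarrow> real \<Rightarrow> ('x \<Rightarrow> complex) set" where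
  "ball_image p k F r = {(\<lambda>x. kop k u x + (\<Sum>f\<in>F. c f * f x)) | u c.
     u \<in> lp (ereal p) \<and> lp_norm (ereal p) u \<le> r \<and> (\<forall>f\<in>F. norm (c f) \<le> r)}"

text \<open>Bounded sequences in \<open>l\<^sup>p\<close> have pointwise convergent subsequences, so images of balls are closed.\<close>

lemma seq_closed_ball_image:
  assumes p: "1 \<le> p" and k: "Wk k" and F: "finite F" and FL: "F \<subseteq> lp (ereal p)"
  shows "seq_closed p (ball_image p k F r)"
  unfolding seq_closed_def
proof (intro allI impI)
  fix v w
  assume v: "\<forall>m::nat. v m \<in> ball_image p k F r" and w: "w \<in> lp (ereal p)"
    and lim: "(\<lambda>m. lp_norm (ereal p) (\<lambda>x. v m x - w x)) \<longlonglongrightarrow> 0"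
  have p0: "0 < p" using p by simp
  have "\<forall>m. \<exists>u c. v m = (\<lambda>x. kop k u x + (\<Sum>f\<in>F. c f * f x)) \<and> u \<in> lp (ereal p) \<and> lp_norm (ereal p) u \<le> r \<and> (\<forall>f\<in>F. norm (c f) \<le> r)"
    using v unfolding ball_image_def by blast
  from choice[OF this] obtain u where "\<forall>m. \<exists>c. v m = (\<lambda>x. kop k (u m) x + (\<Sum>f\<in>F. c f * f x)) \<and> u m \<in> lp (ereal p) \<and> lp_norm (ereal p) (u m) \<le> r \<and> (\<forall>f\<in>F. norm (c f) \<le> r)"
    by (elim exE)
  from choice[OF this] obtain c where uc': "\<forall>m. v m = (\<lambda>x. kop k (u m) x + (\<Sum>f\<in>F. c m f * f x)) \<and> u m \<in> lp (ereal p) \<and> lp_norm (ereal p) (u m) \<le> r \<and> (\<forall>f\<in>F. norm (c m f) \<le> r)"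
    by (elim exE)
  have uc: "\<And>m. v m = (\<lambda>x. kop k (u m) x + (\<Sum>f\<in>F. c m f * f x))"
    "\<And>m. u m \<in> lp (ereal p)" "\<And>m. lp_norm (ereal p) (u m) \<le> r" "\<And>m f. f \<in> F \<Longrightarrow> norm (c m f) \<le> r"
    using uc' by blast+
  have r0: "0 \<le> r" using uc(3) lp_norm_nonneg order_trans by blast
  have ub: "norm (u m x) \<le> r" for m x using norm_le_lp_norm[OF p0 uc(2)] uc(3) order_trans by blast
  \<comment> \<open>The index set joins the points with the elements of \<open>F\<close>, so one
    diagonal subsequence serves the functions and their coefficients.\<close>
  obtain s where s: "strict_mono s" "\<And>i. i \<in> range Inl \<union> Inr ` F \<Longrightarrow> \<exists>l. (\<lambda>n. case_sum (u (s n)) (c (s n)) i) \<longlonglongrightarrow> l"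
  proof (rule function_convergent_subsequence[where f = "\<lambda>n. case_sum (u n) (c n)" and M = r and S = "range Inl \<union> Inr ` F"])
    show "countable (range Inl \<union> Inr ` F :: ('x + ('x \<Rightarrow> complex)) set)"
      using countable_points[of UNIV] F by (auto intro: countable_finite)
  qed (use ub uc(4) in auto)
  define u' where "u' x = lim (\<lambda>n. u (s n) x)" for x
  define c' where "c' f = lim (\<lambda>n. c (s n) f)" for f
  have u': "(\<lambda>n. u (s n) x) \<longlonglongrightarrow> u' x" for x
    using s(2)[of "Inl x"] by (simp add: u'_def convergent_LIMSEQ_iff[symmetric] convergent_def)
  have c': "(\<lambda>n. c (s n) f) \<longlonglongrightarrow> c' f" if "f \<in> F" for f
    using s(2)[of "Inr f"] that by (simp add: c'_def convergent_LIMSEQ_iff[symmetric] convergent_def)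
  have "pn p u' \<le> ennreal (r powr p)"
  proof (rule pn_fatou[OF p0 u'])
    show "pn p (u (s j)) \<le> ennreal (r powr p)" for j
      unfolding pn_eq_lp_norm[OF p0 uc(2)] using uc(3) p by (intro ennreal_leI powr_mono2) (auto simp: lp_norm_nonneg)
  qed
  then have "u' \<in> lp (ereal p)" "lp_norm (ereal p) u' \<le> r"
    using r0 p0 by (auto intro: lp_memI lp_norm_leI)
  moreover have "norm (c' f) \<le> r" if "f \<in> F" for f
    by (rule LIMSEQ_le_const2[OF tendsto_norm[OF c'[OF that]]]) (use uc(4) that in auto)
  moreover have "w = (\<lambda>x. kop k u' x + (\<Sum>f\<in>F. c' f * f x))"
  proof
    fix x
    have vL: "v m \<in> lp (ereal p)" for m
      unfolding uc(1) using FL by (intro lp_add[OF p] kop_lp[OF p k uc(2)] lp_sum[OF p F]) auto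
    have "(\<lambda>m. v m x - w x) \<longlonglongrightarrow> 0"
      by (rule Lim_null_comparison[OF always_eventually lim], rule allI)
        (rule norm_le_lp_norm[OF p0 lp_diff[OF p vL w]])
    then have "(\<lambda>m. v m x) \<longlonglongrightarrow> w x" by (simp add: LIM_zero_iff)
    then have "(\<lambda>m. v (s m) x) \<longlonglongrightarrow> w x" using LIMSEQ_subseq_LIMSEQ[OF _ s(1)] by (simp add: o_def)
    moreover have "(\<lambda>m. v (s m) x) \<longlonglongrightarrow> kop k u' x + (\<Sum>f\<in>F. c' f * f x)"
      unfolding uc(1) by (intro tendsto_intros kop_pointwise_limit[OF k ub u'] c')
    ultimately show "w x = kop k u' x + (\<Sum>f\<in>F. c' f * f x)" by (rule LIMSEQ_unique)
  qed
  ultimately show "w \<in> ball_image p k F r" unfolding ball_image_def by blast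
qed

end

section \<open>Duality of exponents, open mappings, and lower bounds from Fredholmness\<close>

lemma conj_exp_props:
  assumes "1 < p"
  shows "1 < conj_exp p" "1 / p + 1 / conj_exp p = 1" "(conj_exp p - 1) * p = conj_exp p" "conj_exp (conj_exp p) = p"
  using assms by (auto simp: conj_exp_def field_simps)

text \<open>Young's inequality for the normalized functions \<open>a / A\<close> and
  \<open>u / B\<close>, multiplied by \<open>A * B\<close> and summed.\<close>

lemma nsum_holder:
  assumes p: "1 < p" "1 < q" "1 / p + 1 / q = 1" and a: "a \<in> lp (ereal q)" and u: "u \<in> lp (ereal p)"
  shows "nsum (\<lambda>x. en (a x * u x)) \<le> ennreal (lp_norm (ereal q) a * lp_norm (ereal p) u)"
proof -
  define A where "A = lp_norm (ereal q) a"
  define B where "B = lp_norm (ereal p) u"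
  have AB0: "0 \<le> A" "0 \<le> B" by (auto simp: A_def B_def lp_norm_nonneg)
  have p0: "0 < p" "0 < q" using p by auto
  show ?thesis
  proof (cases "A = 0 \<or> B = 0")
    case True
    then have "a = (\<lambda>x. 0) \<or> u = (\<lambda>x. 0)"
      using lp_norm_zero_imp[OF p0(2) a] lp_norm_zero_imp[OF p0(1) u] by (auto simp: A_def B_def)
    then show ?thesis by auto
  next
    case False
    then have AB: "0 < A" "0 < B" using AB0 by auto
    have "en (a x * u x) \<le> ennreal (A * B / q / A powr q) * ennreal (norm (a x) powr q) + ennreal (A * B / p / B powr p) * ennreal (norm (u x) powr p)" for x
    proof -
      have "norm (a x) / A * (norm (u x) / B) \<le> (norm (a x) / A) powr q / q + (norm (u x) / B) powr p / p"
        by (rule Youngs_inequality) (use p AB in auto)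
      then have "A * B * (norm (a x) / A * (norm (u x) / B)) \<le> A * B * ((norm (a x) / A) powr q / q + (norm (u x) / B) powr p / p)"
        using AB by (intro mult_left_mono) auto
      moreover have "A * B * (norm (a x) / A * (norm (u x) / B)) = norm (a x * u x)"
        using AB by (simp add: norm_mult)
      moreover have "A * B * ((norm (a x) / A) powr q / q + (norm (u x) / B) powr p / p)
        = A * B / q / A powr q * norm (a x) powr q + A * B / p / B powr p * norm (u x) powr p"
        using AB by (simp add: powr_divide distrib_left mult_ac)
      ultimately have "norm (a x * u x) \<le> A * B / q / A powr q * norm (a x) powr q + A * B / p / B powr p * norm (u x) powr p" by simp
      then show ?thesis
        using AB p0 by (simp add: ennreal_mult[symmetric] ennreal_plus[symmetric] ennreal_leI del: ennreal_plus)
    qed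
    then have "nsum (\<lambda>x. en (a x * u x)) \<le> nsum (\<lambda>x. ennreal (A * B / q / A powr q) * ennreal (norm (a x) powr q) + ennreal (A * B / p / B powr p) * ennreal (norm (u x) powr p))"
      by (rule nn_integral_mono)
    also have "\<dots> = ennreal (A * B / q / A powr q) * pn q a + ennreal (A * B / p / B powr p) * pn p u"
      by (simp add: pn_def nn_integral_add nn_integral_cmult)
    also have "\<dots> = ennreal (A * B / q / A powr q * A powr q + A * B / p / B powr p * B powr p)"
      using AB p0 by (simp add: pn_eq_lp_norm[OF p0(1) u] pn_eq_lp_norm[OF p0(2) a] A_def[symmetric] B_def[symmetric] ennreal_mult[symmetric] ennreal_plus[symmetric] del: ennreal_plus)
    also have "A * B / q / A powr q * A powr q + A * B / p / B powr p * B powr p = A * B * (1 / p + 1 / q)"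
      using AB by (simp add: distrib_left)
    finally show ?thesis using p(3) by (simp add: A_def B_def)
  qed
qed

lemma norm_infsum_holder:
  assumes "1 < p" "1 < q" "1 / p + 1 / q = 1" "a \<in> lp (ereal q)" "u \<in> lp (ereal p)"
  shows "norm (\<Sum>\<^sub>\<infinity>x. a x * u x) \<le> lp_norm (ereal q) a * lp_norm (ereal p) u"
  using order_trans[OF en_infsum_le nsum_holder[OF assms]]
  by (simp add: lp_norm_nonneg)

lemma LBpI:
  assumes p: "0 < p" and B: "0 < B"
    and le: "\<And>u. finite {x. u x \<noteq> 0} \<Longrightarrow> (\<And>x. x \<notin> Y \<Longrightarrow> u x = 0) \<Longrightarrow>
      kop k u \<in> lp (ereal p) \<and> lp_norm (ereal p) u \<le> B * lp_norm (ereal p) (kop k u)"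
  shows "LBp p Y k"
  unfolding LBp_def
proof (intro exI[of _ "1 / B powr p"] conjI allI impI)
  fix u :: "'a \<Rightarrow> complex"
  assume fs: "finite {x. u x \<noteq> 0}" and Y: "\<forall>x. x \<notin> Y \<longrightarrow> u x = 0"
  have u: "u \<in> lp (ereal p)" by (rule lp_finite_support[OF p fs])
  have ku: "kop k u \<in> lp (ereal p)" "lp_norm (ereal p) u \<le> B * lp_norm (ereal p) (kop k u)"
    using le[OF fs] Y by auto
  have "lp_norm (ereal p) u powr p \<le> (B * lp_norm (ereal p) (kop k u)) powr p"
    using ku(2) p by (intro powr_mono2) (auto simp: lp_norm_nonneg)
  also have "\<dots> = B powr p * lp_norm (ereal p) (kop k u) powr p" by (rule powr_mult)
  finally have "1 / B powr p * lp_norm (ereal p) u powr p \<le> lp_norm (ereal p) (kop k u) powr p"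
    using B by (simp add: field_simps)
  then show "ennreal (1 / B powr p) * pn p u \<le> pn p (kop k u)"
    using B by (simp add: pn_eq_lp_norm[OF p u] pn_eq_lp_norm[OF p ku(1)] ennreal_mult'[symmetric] ennreal_leI)
qed (use B in auto)

context cells
begin

text \<open>Because images of balls are themselves closed, the ball given by Baire's theorem
  consists of exact images; this replaces the usual successive approximation. \<open>M\<close> will
  be the range or the whole space.\<close>

lemma open_mapping:
  assumes p: "1 \<le> p" and k: "Wk k" and F: "finite F" "F \<subseteq> lp (ereal p)"
    and M: "M = {(\<lambda>x. kop k u x + (\<Sum>f\<in>F. c f * f x)) | u c. u \<in> lp (ereal p)}"
    and closed: "seq_closed p M"
  shows "\<exists>C\<ge>0. \<forall>w\<in>M. \<exists>u c. u \<in> lp (ereal p) \<and> w = (\<lambda>x. kop k u x + (\<Sum>f\<in>F. c f * f x)) \<and>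
    lp_norm (ereal p) u \<le> C * lp_norm (ereal p) w \<and> (\<forall>f\<in>F. norm (c f) \<le> C * lp_norm (ereal p) w)"
proof -
  have p0: "0 < p" using p by simp
  let ?N = "lp_norm (ereal p)"
  define E where "E u c = (\<lambda>x. kop k u x + (\<Sum>f\<in>F. c f * f x))" for u c
  have M': "w \<in> M \<longleftrightarrow> (\<exists>u c. u \<in> lp (ereal p) \<and> w = E u c)" for w
    unfolding M E_def by blast
  have EM: "E u c \<in> M" if "u \<in> lp (ereal p)" for u c using that unfolding M' by blast
  have EL: "E u c \<in> lp (ereal p)" if "u \<in> lp (ereal p)" for u c
    unfolding E_def using F(2) by (intro lp_add[OF p] kop_lp[OF p k that] lp_sum(1)[OF p F(1)]) auto
  have Elin: "E (\<lambda>x. a * u x + b * u' x) (\<lambda>f. a * c f + b * c' f) = (\<lambda>x. a * E u c x + b * E u' c' x)"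
    if "u \<in> lp (ereal p)" "u' \<in> lp (ereal p)" for u u' c c' a b
    unfolding E_def
      kop_add[OF k lp_bdd[OF p0 lp_cmult(1)[OF p0 that(1)]] lp_bdd[OF p0 lp_cmult(1)[OF p0 that(2)]]] kop_cmult
    by (simp add: sum.distrib distrib_left distrib_right sum_distrib_left mult.assoc add_ac)
  have BI: "w \<in> ball_image p k F r \<longleftrightarrow> (\<exists>u c. w = E u c \<and> u \<in> lp (ereal p) \<and> ?N u \<le> r \<and> (\<forall>f\<in>F. norm (c f) \<le> r))" for w r
    unfolding ball_image_def E_def by blast
  have "(\<Union>n. ball_image p k F (real n)) = M"
  proof (intro equalityI subsetI)
    fix w assume "w \<in> (\<Union>n. ball_image p k F (real n))"
    then obtain n where "w \<in> ball_image p k F (real n)" by blast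
    then obtain u c where "w = E u c" "u \<in> lp (ereal p)" unfolding BI by blast
    then show "w \<in> M" using EM by simp
  next
    fix w assume "w \<in> M"
    then obtain u c where u: "u \<in> lp (ereal p)" "w = E u c" unfolding M' by blast
    obtain n :: nat where n: "?N u + (\<Sum>f\<in>F. norm (c f)) \<le> real n" using real_arch_simple by blast
    have s: "0 \<le> (\<Sum>f\<in>F. norm (c f))" by (intro sum_nonneg) auto
    have "norm (c f) \<le> real n" if "f \<in> F" for f
      using member_le_sum[of f F "\<lambda>f. norm (c f)"] F(1) that n lp_norm_nonneg[of p u] by simp
    moreover have "?N u \<le> real n" using n s by simp
    ultimately have "w \<in> ball_image p k F (real n)" unfolding BI using u by blast
    then show "w \<in> (\<Union>n. ball_image p k F (real n))" by blast
  qed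
  moreover have "M \<subseteq> lp (ereal p)"
  proof
    fix w assume "w \<in> M"
    then obtain u c where "u \<in> lp (ereal p)" "w = E u c" unfolding M' by blast
    then show "w \<in> lp (ereal p)" using EL by simp
  qed
  moreover have "M \<noteq> {}" using EM[OF lp_zero(1)[OF p0]] by blast
  ultimately obtain n w0 \<epsilon> where \<epsilon>: "0 < \<epsilon>" and w0: "w0 \<in> M"
    and ball: "\<And>v. v \<in> M \<Longrightarrow> ?N (\<lambda>x. w0 x - v x) < \<epsilon> \<Longrightarrow> v \<in> ball_image p k F (real n)"
    using lp_baire[OF p _ _ closed, of "\<lambda>n. ball_image p k F (real n)"] seq_closed_ball_image[OF p k F] by blast
  have "w0 \<in> ball_image p k F (real n)" by (rule ball[OF w0]) (use \<epsilon> in \<open>simp add: lp_zero[OF p0]\<close>)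
  then obtain u0 c0 where 0: "w0 = E u0 c0" "u0 \<in> lp (ereal p)" "?N u0 \<le> real n" "\<And>f. f \<in> F \<Longrightarrow> norm (c0 f) \<le> real n"
    unfolding BI by blast
  \<comment> \<open>A multiple \<open>a * w\<close> of norm \<open>\<epsilon> / 2\<close> is a
    difference of two elements of the ball image of radius \<open>n\<close>. Dividing by
    \<open>a\<close> turns the radius \<open>2 * n\<close> into \<open>4 * n / \<epsilon>\<close>
    times the norm of \<open>w\<close>.\<close>
  define C where "C = 4 * real n / \<epsilon>"
  have C0: "0 \<le> C" using \<epsilon> by (simp add: C_def)
  have "\<exists>u c. u \<in> lp (ereal p) \<and> w = E u c \<and> ?N u \<le> C * ?N w \<and> (\<forall>f\<in>F. norm (c f) \<le> C * ?N w)" if w: "w \<in> M" for w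
  proof (cases "?N w = 0")
    case True
    have wL: "w \<in> lp (ereal p)" using w EL unfolding M' by blast
    have "w = (\<lambda>x. 0)" by (rule lp_norm_zero_imp[OF p0 wL True])
    then have "w = E (\<lambda>x. 0) (\<lambda>f. 0)" by (simp add: E_def)
    then show ?thesis using True by (intro exI[of _ "\<lambda>x. 0"] exI[of _ "\<lambda>f. 0"]) (simp add: lp_zero[OF p0])
  next
    case False
    obtain u2 c2 where u2: "u2 \<in> lp (ereal p)" "w = E u2 c2" using w unfolding M' by blast
    have wL: "w \<in> lp (ereal p)" unfolding u2(2) by (rule EL[OF u2(1)])
    have t: "0 < ?N w" using False lp_norm_nonneg[of p w] by simp
    define a where "a = \<epsilon> / (2 * ?N w)"
    have a: "0 < a" "a * ?N w = \<epsilon> / 2" using \<epsilon> t by (auto simp: a_def)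
    define v where "v = E (\<lambda>x. 1 * u0 x + of_real a * u2 x) (\<lambda>f. 1 * c0 f + of_real a * c2 f)"
    have vx: "v = (\<lambda>x. 1 * w0 x + of_real a * w x)"
      unfolding v_def Elin[OF 0(2) u2(1)] 0(1) u2(2) ..
    have "v \<in> M" unfolding v_def
      by (intro EM lp_add[OF p] lp_cmult(1)[OF p0] 0(2) u2(1))
    moreover have "?N (\<lambda>x. w0 x - v x) < \<epsilon>"
    proof -
      have "(\<lambda>x. w0 x - v x) = (\<lambda>x. (- of_real a) * w x)" unfolding vx by (simp add: fun_eq_iff)
      then show ?thesis using lp_cmult(2)[OF p0 wL, of "- of_real a"] a \<epsilon> by simp
    qed
    ultimately have "v \<in> ball_image p k F (real n)" by (rule ball)
    then obtain u1 c1 where 1: "v = E u1 c1" "u1 \<in> lp (ereal p)" "?N u1 \<le> real n" "\<And>f. f \<in> F \<Longrightarrow> norm (c1 f) \<le> real n"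
      unfolding BI by blast
    let ?i = "complex_of_real (1 / a)"
    let ?u = "\<lambda>x. ?i * u1 x + (- ?i) * u0 x" and ?c = "\<lambda>f. ?i * c1 f + (- ?i) * c0 f"
    have bound: "\<bar>1 / a\<bar> * real n + \<bar>1 / a\<bar> * real n = C * ?N w"
      using a \<epsilon> t by (simp add: C_def a_def)
    have "w = E ?u ?c"
      unfolding Elin[OF 1(2) 0(2)] 1(1)[symmetric] 0(1)[symmetric] vx using a by (simp add: fun_eq_iff field_simps)
    moreover have "?u \<in> lp (ereal p)" by (intro lp_add[OF p] lp_cmult(1)[OF p0] 1(2) 0(2))
    moreover have "?N ?u \<le> C * ?N w"
    proof -
      have "?N ?u \<le> norm ?i * ?N u1 + norm (- ?i) * ?N u0"
        using lp_norm_triangle[OF p lp_cmult(1)[OF p0 1(2), of ?i] lp_cmult(1)[OF p0 0(2), of "- ?i"]]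
          lp_cmult(2)[OF p0 1(2), of ?i] lp_cmult(2)[OF p0 0(2), of "- ?i"] by simp
      also have "\<dots> \<le> \<bar>1 / a\<bar> * real n + \<bar>1 / a\<bar> * real n"
        unfolding norm_minus_cancel norm_of_real by (intro add_mono mult_left_mono 1(3) 0(3)) auto
      finally show ?thesis unfolding bound .
    qed
    moreover have "norm (?c f) \<le> C * ?N w" if "f \<in> F" for f
    proof -
      have "norm (?c f) \<le> norm ?i * norm (c1 f) + norm (- ?i) * norm (c0 f)"
        using norm_triangle_ineq[of "?i * c1 f" "(- ?i) * c0 f"] unfolding norm_mult .
      also have "\<dots> \<le> \<bar>1 / a\<bar> * real n + \<bar>1 / a\<bar> * real n"
        unfolding norm_minus_cancel norm_of_real by (intro add_mono mult_left_mono 1(4) 0(4) that) auto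
      finally show ?thesis unfolding bound .
    qed
    ultimately show ?thesis by blast
  qed
  then show ?thesis using C0 unfolding E_def by blast
qed

text \<open>Replace \<open>u\<close> by a preimage \<open>u'\<close> of \<open>kop k u\<close> with
  controlled norm. The difference is a null function, hence determined by its values on the
  interpolation set \<open>S\<close>. There \<open>u\<close> vanishes, so these are values of
  \<open>- u'\<close>, and the difference is controlled too.\<close>

lemma fredholm_LBp:
  assumes p: "1 \<le> p" and k: "Wk k" and fr: "fredholm_on (ereal p) (kop k)"
  shows "\<exists>S. finite S \<and> LBp p (- S) k"
proof -
  have p0: "0 < p" using p by simp
  let ?N = "lp_norm (ereal p)"
  define M where "M = {(\<lambda>x. kop k u x + (\<Sum>f\<in>{}. c f * f x)) | u c. u \<in> lp (ereal p)}"
  have Mi: "M = kop k ` lp (ereal p)" unfolding M_def by auto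
  have "seq_closed p M" using fr unfolding fredholm_on_def seq_closed_def Mi by blast
  from open_mapping[OF p k finite.emptyI empty_subsetI M_def this]
  obtain C where C: "0 \<le> C" "\<And>w. w \<in> M \<Longrightarrow> \<exists>u. u \<in> lp (ereal p) \<and> w = kop k u \<and> ?N u \<le> C * ?N w"
    by auto
  define Z where "Z = {u \<in> lp (ereal p). kop k u = (\<lambda>x. 0)}"
  obtain F where F: "finite F" "Z \<subseteq> fin_span F" using fr unfolding fredholm_on_def Z_def by blast
  have "\<exists>S e. finite S \<and> (\<forall>z\<in>Z. \<forall>s\<in>S. e s \<in> Z) \<and> (\<forall>z\<in>Z. z = (\<lambda>x. \<Sum>s\<in>S. z s * e s x))"
  proof (rule finite_dim_interpolation[OF F])
    fix u v assume "u \<in> Z" "v \<in> Z"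
    then show "(\<lambda>x. u x + v x) \<in> Z"
      unfolding Z_def using kop_add[OF k lp_bdd[OF p0, of u] lp_bdd[OF p0, of v]] lp_add[OF p, of u v] by simp
  next
    fix u c assume "u \<in> Z"
    then show "(\<lambda>x. c * u x) \<in> Z"
      unfolding Z_def using kop_cmult[of k c u] lp_cmult(1)[OF p0, of u c] by simp
  qed
  then obtain S e where S: "finite S" "\<forall>z\<in>Z. \<forall>s\<in>S. e s \<in> Z" "\<forall>z\<in>Z. z = (\<lambda>x. \<Sum>s\<in>S. z s * e s x)"
    by (elim exE conjE)
  have zero: "(\<lambda>x. 0) \<in> Z" unfolding Z_def by (simp add: lp_zero[OF p0])
  have eL: "e s \<in> lp (ereal p)" if "s \<in> S" for s
    using bspec[OF bspec[OF S(2) zero] that] by (simp add: Z_def)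
  define D where "D = (\<Sum>s\<in>S. ?N (e s))"
  have D0: "0 \<le> D" unfolding D_def by (intro sum_nonneg) (simp add: lp_norm_nonneg)
  define B where "B = (1 + D) * C + 1"
  have "LBp p (- S) k"
  proof (rule LBpI[OF p0, of B])
    show "0 < B" using C(1) D0 unfolding B_def by (smt (verit) mult_nonneg_nonneg)
    fix u :: "'x \<Rightarrow> complex"
    assume fs: "finite {x. u x \<noteq> 0}" and uS: "\<And>x. x \<notin> - S \<Longrightarrow> u x = 0"
    have u: "u \<in> lp (ereal p)" by (rule lp_finite_support[OF p0 fs])
    have "kop k u \<in> M" unfolding Mi using u by blast
    from C(2)[OF this] obtain u' where u': "u' \<in> lp (ereal p)" "kop k u = kop k u'" "?N u' \<le> C * ?N (kop k u)" by blast
    define z where "z x = u x - u' x" for x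
    have zL: "z \<in> lp (ereal p)" unfolding z_def[abs_def] by (rule lp_diff[OF p u u'(1)])
    have zZ: "z \<in> Z"
      unfolding Z_def using zL kop_diff[OF k lp_bdd[OF p0 u] lp_bdd[OF p0 u'(1)]] u'(2) by (simp add: z_def[abs_def])
    have "?N z \<le> D * ?N u'"
    proof -
      have "?N z = ?N (\<lambda>x. \<Sum>s\<in>S. z s * e s x)" by (rule arg_cong[OF bspec[OF S(3) zZ]])
      also have "\<dots> \<le> (\<Sum>s\<in>S. norm (z s) * ?N (e s))" by (rule lp_sum(2)[OF p S(1) eL])
      also have "\<dots> \<le> (\<Sum>s\<in>S. ?N u' * ?N (e s))"
      proof (intro sum_mono mult_right_mono)
        fix s assume "s \<in> S"
        then show "norm (z s) \<le> ?N u'" using norm_le_lp_norm[OF p0 u'(1), of s] uS[of s] by (simp add: z_def)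
      qed (simp add: lp_norm_nonneg)
      finally show ?thesis by (simp add: D_def sum_distrib_left mult.commute)
    qed
    moreover have "?N u \<le> ?N u' + ?N z"
      using lp_norm_triangle[OF p u'(1) zL] by (simp add: z_def)
    ultimately have "?N u \<le> (1 + D) * ?N u'" by (simp add: distrib_right)
    also have "\<dots> \<le> (1 + D) * (C * ?N (kop k u))" using D0 u'(3) by (intro mult_left_mono) auto
    also have "\<dots> \<le> B * ?N (kop k u)" unfolding B_def using lp_norm_nonneg[of p "kop k u"] by (simp add: distrib_right mult.assoc)
    finally show "kop k u \<in> lp (ereal p) \<and> ?N u \<le> B * ?N (kop k u)" using kop_lp[OF p k u] by blast
  qed
  then show ?thesis using S(1) by blast
qed

text \<open>For \<open>v\<close> supported far away, pair \<open>v\<close> with its extremal function \<open>w = \<bar>v\<bar>\<^bsup>q-1\<^esup> sgn v\<close>, written as an element of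
  the range of \<open>A\<close> with controlled preimage plus a combination of the finitely many cokernel functions,
  which are small far away.\<close>

lemma fredholm_LBp_adj:
  assumes p: "1 < p" and k: "Wk k" and fr: "fredholm_on (ereal p) (kop k)"
  shows "\<exists>S. finite S \<and> LBp (conj_exp p) (- S) (adj_kernel k)"
proof -
  define q where "q = conj_exp p"
  have q: "1 < q" "1 / p + 1 / q = 1" "(q - 1) * p = q" using conj_exp_props[OF p] by (auto simp: q_def)
  have p0: "0 < p" "1 \<le> p" "0 < q" "1 \<le> q" using p q by auto
  let ?N = "lp_norm (ereal p)" and ?Q = "lp_norm (ereal q)"
  obtain G where G: "finite G" "G \<subseteq> lp (ereal p)"
    "lp (ereal p) \<subseteq> {(\<lambda>x. r x + s x) | r s. r \<in> kop k ` lp (ereal p) \<and> s \<in> fin_span G}"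
    using fr unfolding fredholm_on_def by blast
  have M: "lp (ereal p) = {(\<lambda>x. kop k u x + (\<Sum>f\<in>G. c f * f x)) | u c. u \<in> lp (ereal p)}" (is "_ = ?R")
  proof (intro equalityI subsetI)
    fix w :: "'x \<Rightarrow> complex" assume "w \<in> lp (ereal p)"
    then have "w \<in> {(\<lambda>x. r x + s x) | r s. r \<in> kop k ` lp (ereal p) \<and> s \<in> fin_span G}" using G(3) by (rule rev_subsetD)
    then obtain r s where rs: "w = (\<lambda>x. r x + s x)" "r \<in> kop k ` lp (ereal p)" "s \<in> fin_span G" by blast
    obtain u where u: "u \<in> lp (ereal p)" "r = kop k u" using rs(2) by blast
    obtain c where c: "s = (\<lambda>x. \<Sum>f\<in>G. c f * f x)" using rs(3) unfolding fin_span_def by blast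
    show "w \<in> ?R" unfolding rs(1) u(2) c using u(1) by blast
  next
    fix w assume "w \<in> ?R"
    then obtain u c where uc: "w = (\<lambda>x. kop k u x + (\<Sum>f\<in>G. c f * f x))" "u \<in> lp (ereal p)" by blast
    show "w \<in> lp (ereal p)"
      unfolding uc(1) using G(2) by (intro lp_add[OF p0(2)] kop_lp[OF p0(2) k uc(2)] lp_sum(1)[OF p0(2) G(1)]) auto
  qed
  have "seq_closed p (lp (ereal p) :: ('x \<Rightarrow> complex) set)" by (simp add: seq_closed_def)
  from open_mapping[OF p0(2) k G(1,2) M this]
  obtain C where C: "0 \<le> C" "\<forall>w\<in>lp (ereal p). \<exists>u c. u \<in> lp (ereal p) \<and> w = (\<lambda>x. kop k u x + (\<Sum>f\<in>G. c f * f x)) \<and>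
    ?N u \<le> C * ?N w \<and> (\<forall>f\<in>G. norm (c f) \<le> C * ?N w)" by blast
  \<comment> \<open>Chosen so that the tails of the cokernel functions contribute at most half of
    the norm of \<open>v\<close>, which is then absorbed; the added 1 keeps the denominator
    positive.\<close>
  define \<delta> where "\<delta> = 1 / (2 * (real (card G) * C + 1))"
  have gC: "0 \<le> real (card G) * C" using C(1) by simp
  have \<delta>: "0 < \<delta>" using gC by (simp add: \<delta>_def)
  have "real (card G) * C * \<delta> = (real (card G) * C / (real (card G) * C + 1)) / 2"
    by (simp add: \<delta>_def)
  also have "\<dots> \<le> 1 / 2" using gC by simp
  finally have \<delta>2: "real (card G) * C * \<delta> \<le> 1 / 2" .
  have "\<exists>T. finite T \<and> nsum (\<lambda>x. if x \<in> T then 0 else ennreal (norm (g x) powr p)) \<le> ennreal (\<delta> powr p)" if "g \<in> G" for g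
    using that G(2) \<delta> by (intro nsum_tail) (auto simp: lp_iff pn_def)
  then obtain T where T: "\<And>g. g \<in> G \<Longrightarrow> finite (T g)"
    "\<And>g. g \<in> G \<Longrightarrow> nsum (\<lambda>x. if x \<in> T g then 0 else ennreal (norm (g x) powr p)) \<le> ennreal (\<delta> powr p)" by metis
  define S where "S = (\<Union>g\<in>G. T g)"
  have S: "finite S" using G(1) T(1) by (auto simp: S_def)
  define g' where "g' g x = (if x \<in> S then 0 else g x)" for g :: "'x \<Rightarrow> complex" and x
  have g': "g' g \<in> lp (ereal p)" "?N (g' g) \<le> \<delta>" if g: "g \<in> G" for g
  proof -
    have "pn p (g' g) \<le> nsum (\<lambda>x. if x \<in> T g then 0 else ennreal (norm (g x) powr p))"
      unfolding pn_def using g by (intro nn_integral_mono) (auto simp: g'_def S_def)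
    also note T(2)[OF g]
    finally have "pn p (g' g) \<le> ennreal (\<delta> powr p)" .
    then show "g' g \<in> lp (ereal p)" "?N (g' g) \<le> \<delta>" using \<delta> p0 by (auto intro: lp_memI lp_norm_leI)
  qed
  have "LBp q (- S) (adj_kernel k)"
  proof (rule LBpI[OF p0(3), of "2 * C + 1"])
    show "0 < 2 * C + 1" using C(1) by simp
    fix v :: "'x \<Rightarrow> complex"
    assume fs: "finite {x. v x \<noteq> 0}" and vS: "\<And>x. x \<notin> - S \<Longrightarrow> v x = 0"
    have v: "v \<in> lp (ereal q)" by (rule lp_finite_support[OF p0(3) fs])
    have av: "absum v" by (rule absum_finite_support[OF fs])
    have kv: "kop (adj_kernel k) v \<in> lp (ereal q)" by (rule kop_lp[OF p0(4) Wk_adj[OF k] v])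
    define V where "V = ?Q v"
    have V0: "0 \<le> V" by (simp add: V_def lp_norm_nonneg)
    have "V \<le> (2 * C + 1) * ?Q (kop (adj_kernel k) v)"
    proof (cases "V = 0")
      case True
      then show ?thesis using C(1) by (simp add: lp_norm_nonneg)
    next
      case False
      then have V: "0 < V" using V0 by simp
      define w where "w x = cnj (sgn (v x)) * of_real (norm (v x) powr (q - 1))" for x
      have nw: "norm (w x) = norm (v x) powr (q - 1)" for x
        by (simp add: w_def norm_mult norm_sgn)
      have "{x. w x \<noteq> 0} \<subseteq> {x. v x \<noteq> 0}" by (auto simp: w_def)
      then have w: "w \<in> lp (ereal p)" by (intro lp_finite_support[OF p0(1)] finite_subset[OF _ fs])
      have vw: "v x * w x = of_real (norm (v x) powr q)" for x
      proof -
        have "v x * w x = (v x * cnj (sgn (v x))) * of_real (norm (v x) powr (q - 1))" by (simp add: w_def)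
        also have "v x * cnj (sgn (v x)) = of_real (norm (v x))"
          by (cases "v x = 0") (simp_all add: sgn_eq complex_norm_square[symmetric] power2_eq_square field_simps)
        also have "complex_of_real (norm (v x)) * of_real (norm (v x) powr (q - 1)) = of_real (norm (v x) powr q)"
          unfolding of_real_mult[symmetric] by (subst powr_mult_base) auto
        finally show ?thesis .
      qed
      have "pn p w = pn q v" by (simp add: pn_def nw powr_powr q(3))
      then have "pn p w = ennreal ((V powr (q - 1)) powr p)"
        by (simp add: pn_eq_lp_norm[OF p0(3) v] V_def powr_powr q(3))
      then have Nw: "?N w \<le> V powr (q - 1)" by (intro lp_norm_leI p0) auto
      have sumvw: "(\<Sum>\<^sub>\<infinity>x. v x * w x) = of_real (V powr q)"
      proof -
        let ?T = "{x. v x \<noteq> 0}"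
        have "(\<Sum>\<^sub>\<infinity>x. v x * w x) = (\<Sum>\<^sub>\<infinity>x\<in>?T. v x * w x)"
          by (rule infsum_cong_neutral) auto
        also have "\<dots> = of_real (\<Sum>x\<in>?T. norm (v x) powr q)"
          using fs by (simp add: vw)
        also have "(\<Sum>x\<in>?T. norm (v x) powr q) = enn2real (pn q v)"
          unfolding pn_def using fs p0 by (subst nsum_finite_support[of ?T]) (auto simp: sum_nonneg)
        also have "\<dots> = V powr q" by (simp add: pn_eq_lp_norm[OF p0(3) v] V_def)
        finally show ?thesis .
      qed
      from bspec[OF C(2) w] obtain u c where uc: "u \<in> lp (ereal p)" "w = (\<lambda>x. kop k u x + (\<Sum>f\<in>G. c f * f x))"
        "?N u \<le> C * ?N w" "\<forall>f\<in>G. norm (c f) \<le> C * ?N w" by blast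
      have CN: "C * ?N w \<le> C * V powr (q - 1)" by (rule mult_left_mono[OF Nw C(1)])
      have bu: "bdd u" by (rule lp_bdd[OF p0(1) uc(1)])
      have sm1: "(\<lambda>x. v x * kop k u x) summable_on UNIV"
        using absum_mult_bdd[OF av bdd_kop[OF k bu]] by (simp add: absum_iff_summable)
      have ab2: "absum (\<lambda>x. c g * (v x * g x))" if "g \<in> G" for g
        using absum_mult_bdd[OF av lp_bdd[OF p0(1), of g]] G(2) that by auto
      have abs: "absum (\<lambda>x. \<Sum>g\<in>G. c g * (v x * g x))"
        by (rule Bochner_Integration.integrable_sum[OF ab2])
      have "(\<Sum>\<^sub>\<infinity>x. v x * w x) = (\<Sum>\<^sub>\<infinity>x. v x * kop k u x + (\<Sum>g\<in>G. c g * (v x * g x)))"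
        by (subst uc(2)) (simp add: distrib_left sum_distrib_left mult.left_commute)
      also have "\<dots> = (\<Sum>\<^sub>\<infinity>x. v x * kop k u x) + (\<Sum>\<^sub>\<infinity>x. \<Sum>g\<in>G. c g * (v x * g x))"
        by (rule infsum_add[OF sm1]) (use abs in \<open>simp add: absum_iff_summable\<close>)
      also have "(\<Sum>\<^sub>\<infinity>x. \<Sum>g\<in>G. c g * (v x * g x)) = (\<Sum>g\<in>G. \<Sum>\<^sub>\<infinity>x. c g * (v x * g x))"
        using infsum_eq_integral[OF abs] infsum_eq_integral[OF ab2] ab2 by (simp add: Bochner_Integration.integral_sum)
      also have "\<dots> = (\<Sum>g\<in>G. c g * (\<Sum>\<^sub>\<infinity>x. v x * g' g x))"
      proof (rule sum.cong)
        fix g assume "g \<in> G"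
        \<comment> \<open>Since \<open>v\<close> vanishes on \<open>S\<close>, each cokernel
          function may be replaced by its small tail.\<close>
        have "(\<lambda>x. v x * g x) = (\<lambda>x. v x * g' g x)" using vS by (auto simp: g'_def fun_eq_iff)
        then have "(\<Sum>\<^sub>\<infinity>x. v x * g x) = (\<Sum>\<^sub>\<infinity>x. v x * g' g x)" by (rule arg_cong)
        then show "(\<Sum>\<^sub>\<infinity>x. c g * (v x * g x)) = c g * (\<Sum>\<^sub>\<infinity>x. v x * g' g x)"
          by (simp add: infsum_cmult_right')
      qed simp
      also have "(\<Sum>\<^sub>\<infinity>x. v x * kop k u x) = (\<Sum>\<^sub>\<infinity>y. kop (adj_kernel k) v y * u y)"
        by (rule kop_pairing_absum[OF k av bu])
      finally have "V powr q = norm ((\<Sum>\<^sub>\<infinity>y. kop (adj_kernel k) v y * u y) + (\<Sum>g\<in>G. c g * (\<Sum>\<^sub>\<infinity>x. v x * g' g x)))"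
        unfolding sumvw by (metis norm_of_real abs_of_nonneg powr_ge_zero)
      also have "\<dots> \<le> norm (\<Sum>\<^sub>\<infinity>y. kop (adj_kernel k) v y * u y) + (\<Sum>g\<in>G. norm (c g * (\<Sum>\<^sub>\<infinity>x. v x * g' g x)))"
        by (rule order_trans[OF norm_triangle_ineq add_left_mono[OF norm_sum]])
      also have "\<dots> \<le> ?Q (kop (adj_kernel k) v) * (C * V powr (q - 1)) + (\<Sum>g\<in>G. C * V powr (q - 1) * (V * \<delta>))"
      proof (intro add_mono sum_mono)
        have "norm (\<Sum>\<^sub>\<infinity>y. kop (adj_kernel k) v y * u y) \<le> ?Q (kop (adj_kernel k) v) * ?N u"
          by (rule norm_infsum_holder[OF p q(1,2) kv uc(1)])
        also have "\<dots> \<le> ?Q (kop (adj_kernel k) v) * (C * V powr (q - 1))"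
          using uc(3) CN by (intro mult_left_mono) (auto simp: lp_norm_nonneg)
        finally show "norm (\<Sum>\<^sub>\<infinity>y. kop (adj_kernel k) v y * u y) \<le> ?Q (kop (adj_kernel k) v) * (C * V powr (q - 1))" .
        fix g assume g: "g \<in> G"
        have "norm (\<Sum>\<^sub>\<infinity>x. v x * g' g x) \<le> V * ?N (g' g)"
          unfolding V_def by (rule norm_infsum_holder[OF p q(1,2) v g'(1)[OF g]])
        also have "\<dots> \<le> V * \<delta>" using g'(2)[OF g] V by (intro mult_left_mono) auto
        finally show "norm (c g * (\<Sum>\<^sub>\<infinity>x. v x * g' g x)) \<le> C * V powr (q - 1) * (V * \<delta>)"
          unfolding norm_mult using uc(4) g CN C(1) V by (intro mult_mono) (auto intro: order_trans)
      qed
      also have "\<dots> = V powr (q - 1) * (C * ?Q (kop (adj_kernel k) v) + (real (card G) * C * \<delta>) * V)"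
        by (simp add: algebra_simps)
      also have "\<dots> \<le> V powr (q - 1) * (C * ?Q (kop (adj_kernel k) v) + (1/2) * V)"
        using \<delta>2 V by (intro mult_left_mono add_left_mono mult_right_mono) auto
      finally have "V powr (q - 1) * V \<le> V powr (q - 1) * (C * ?Q (kop (adj_kernel k) v) + (1/2) * V)"
        using V powr_mult_base[of V "q - 1"] by (simp add: mult.commute)
      then have "V \<le> C * ?Q (kop (adj_kernel k) v) + (1/2) * V" using V by simp
      then have "V \<le> 2 * C * ?Q (kop (adj_kernel k) v)" by simp
      then show ?thesis using lp_norm_nonneg[of q "kop (adj_kernel k) v"] by (simp add: distrib_right)
    qed
    then show "kop (adj_kernel k) v \<in> lp (ereal q) \<and> ?Q v \<le> (2 * C + 1) * ?Q (kop (adj_kernel k) v)"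
      using kv by (simp add: V_def)
  qed
  then show ?thesis using S by (auto simp: q_def)
qed

end

subsection \<open>Limit operators\<close>

text \<open>The generating function of \<open>shift_conj act \<alpha> (kop k)\<close>.\<close>

definition translate_kernel :: "(int^'n \<Rightarrow> 'x \<Rightarrow> 'x) \<Rightarrow> int^'n \<Rightarrow> ('x \<Rightarrow> 'x \<Rightarrow> complex) \<Rightarrow> 'x \<Rightarrow> 'x \<Rightarrow> complex" where
  "translate_kernel act \<alpha> k = (\<lambda>x y. k (act \<alpha> x) (act \<alpha> y))"

lemma LBinf_mono: "LBinf Y k \<Longrightarrow> Z \<subseteq> Y \<Longrightarrow> LBinf Z k"
  unfolding LBinf_def by (meson subsetD)

context cells
begin

text \<open>Jensen's inequality bounds the \<open>p\<close>-mass of the difference by a double sum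
  whose terms are linear in the kernel entries. The common dominating function then permits
  dominated convergence over pairs of points.\<close>

lemma strong_conv_of_pointwise:
  assumes p: "1 \<le> p" and dk: "\<And>m. domk h (\<kappa> m)" and lim: "\<And>x y. (\<lambda>m. \<kappa> m x y) \<longlonglongrightarrow> k' x y"
  shows "domk h k'" "strong_conv (ereal p) (\<lambda>m. kop (\<kappa> m)) (kop k')"
proof -
  have p0: "0 < p" using p by simp
  have hfin: "nsum h < top" using dk by (simp add: domk_def)
  have "en (k' x y) \<le> h (\<pi> x - \<pi> y)" for x y
    by (rule LIMSEQ_le_const2[OF tendsto_ennrealI[OF tendsto_norm[OF lim]]]) (use dk in \<open>auto simp: domk_def\<close>)
  then show dk': "domk h k'" using hfin by (simp add: domk_def)
  have W: "Wk k'" "\<And>m. Wk (\<kappa> m)" using dk dk' by (auto simp: Wk_def)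
  show "strong_conv (ereal p) (\<lambda>m. kop (\<kappa> m)) (kop k')"
    unfolding strong_conv_def
  proof
    fix u :: "'x \<Rightarrow> complex" assume u: "u \<in> lp (ereal p)"
    define \<delta> where "\<delta> m x y = \<kappa> m x y - k' x y" for m x y
    have \<delta>h: "en (\<delta> m x y) \<le> 2 * h (\<pi> x - \<pi> y)" for m x y
    proof -
      have "en (\<delta> m x y) \<le> en (\<kappa> m x y) + en (k' x y)"
        unfolding \<delta>_def by (simp add: ennreal_plus[symmetric] norm_triangle_ineq4 del: ennreal_plus)
      also have "\<dots> \<le> h (\<pi> x - \<pi> y) + h (\<pi> x - \<pi> y)"
        using dk dk' by (intro add_mono) (auto simp: domk_def)
      finally show ?thesis by (simp add: mult_2)
    qed
    have d\<delta>: "domk (\<lambda>\<gamma>. 2 * h \<gamma>) (\<delta> m)" for m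
      using \<delta>h hfin by (simp add: domk_def nn_integral_cmult ennreal_mult_less_top)
    obtain V where V: "0 < V" "of_nat N * nsum (\<lambda>\<gamma>. 2 * h \<gamma>) \<le> ennreal V" using domk_total[OF d\<delta>] by metis
    define I where "I m = nsum (\<lambda>z. case z of (x, y) \<Rightarrow> ennreal (norm (\<delta> m x y) * norm (u y) powr p))" for m
    have pnI: "pn p (kop (\<delta> m) u) \<le> ennreal (V powr (p - 1)) * I m" for m
    proof -
      have "pn p (kop (\<delta> m) u) \<le> nsum (\<lambda>x. ennreal (V powr (p - 1)) * nsum (\<lambda>y. ennreal (norm (\<delta> m x y) * norm (u y) powr p)))"
        unfolding pn_def
        by (intro nn_integral_mono weighted_power_mean p en_kop_le order_trans[OF domk_row[OF d\<delta>] V(2)]) (use V in auto)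
      also have "\<dots> = ennreal (V powr (p - 1)) * I m"
        unfolding I_def nn_integral_fst_count_space[symmetric] by (simp add: nn_integral_cmult)
      finally show ?thesis .
    qed
    have "I \<longlonglongrightarrow> nsum (\<lambda>z::'x \<times> 'x. 0)"
      unfolding I_def
    proof (rule nn_integral_dominated_convergence[where w = "\<lambda>z. case z of (x, y) \<Rightarrow> 2 * h (\<pi> x - \<pi> y) * ennreal (norm (u y) powr p)"])
      have "nsum (\<lambda>z. case z of (x, y) \<Rightarrow> 2 * h (\<pi> x - \<pi> y) * ennreal (norm (u y) powr p))
        = nsum (\<lambda>y. nsum (\<lambda>x. 2 * h (\<pi> x - \<pi> y)) * ennreal (norm (u y) powr p))"
        unfolding nn_integral_snd_count_space[symmetric] by (simp add: nn_integral_multc)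
      also have "\<dots> \<le> nsum (\<lambda>y. ennreal V * ennreal (norm (u y) powr p))"
        by (intro nn_integral_mono mult_right_mono order_trans[OF nsum_col V(2)]) auto
      also have "\<dots> = ennreal V * pn p u" by (simp add: pn_def nn_integral_cmult)
      also have "\<dots> < top" using u by (simp add: lp_iff ennreal_mult_less_top)
      finally show "nsum (\<lambda>z. case z of (x, y) \<Rightarrow> 2 * h (\<pi> x - \<pi> y) * ennreal (norm (u y) powr p)) < \<infinity>" by simp
      show "AE z in count_space UNIV. (case z of (x, y) \<Rightarrow> ennreal (norm (\<delta> m x y) * norm (u y) powr p))
          \<le> (case z of (x, y) \<Rightarrow> 2 * h (\<pi> x - \<pi> y) * ennreal (norm (u y) powr p))" for m
        using \<delta>h by (auto simp: AE_count_space ennreal_mult intro: mult_right_mono)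
      have "(\<lambda>m. ennreal (norm (\<delta> m x y) * norm (u y) powr p)) \<longlonglongrightarrow> ennreal (0 * norm (u y) powr p)" for x y
        unfolding \<delta>_def by (intro tendsto_ennrealI tendsto_mult tendsto_const tendsto_norm_zero LIM_zero lim)
      then show "AE z in count_space UNIV. (\<lambda>m. case z of (x, y) \<Rightarrow> ennreal (norm (\<delta> m x y) * norm (u y) powr p)) \<longlonglongrightarrow> 0"
        by (auto simp: AE_count_space)
    qed auto
    then have I0: "I \<longlonglongrightarrow> 0" by simp
    have eq: "(\<lambda>x. kop (\<kappa> m) u x - kop k' u x) = kop (\<delta> m) u" for m
      unfolding \<delta>_def[abs_def] using kop_kernel_diff[OF W(2,1) lp_bdd[OF p0 u]] by simp
    show "(\<lambda>m. lp_norm (ereal p) (\<lambda>x. kop (\<kappa> m) u x - kop k' u x)) \<longlonglongrightarrow> 0"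
      unfolding eq
    proof (rule metric_LIMSEQ_I)
      fix r :: real assume r: "0 < r"
      define e where "e = (r / 2) powr p / V powr (p - 1)"
      have e: "0 < e" using r V by (simp add: e_def)
      then have "\<forall>\<^sub>F m in sequentially. I m < ennreal e" using order_tendstoD(2)[OF I0, of "ennreal e"] by simp
      then obtain n where n: "\<And>m. n \<le> m \<Longrightarrow> I m < ennreal e" by (auto simp: eventually_sequentially)
      have "dist (lp_norm (ereal p) (kop (\<delta> m) u)) 0 < r" if "n \<le> m" for m
      proof -
        have "pn p (kop (\<delta> m) u) \<le> ennreal (V powr (p - 1)) * ennreal e"
          using pnI[of m] n[OF that] by (meson less_imp_le mult_left_mono order_trans zero_le)
        also have "\<dots> = ennreal ((r / 2) powr p)"
          using V e by (subst ennreal_mult[symmetric]) (auto simp: e_def)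
        finally have "lp_norm (ereal p) (kop (\<delta> m) u) \<le> r / 2" using r p0 by (intro lp_norm_leI) auto
        then show ?thesis using r lp_norm_nonneg[of p "kop (\<delta> m) u"] by (simp add: dist_real_def)
      qed
      then show "\<exists>n. \<forall>m\<ge>n. dist (lp_norm (ereal p) (kop (\<delta> m) u)) 0 < r" by blast
    qed
  qed
qed

text \<open>The right side does not mention \<open>p\<close>; independence of the essential spectrum
  from the exponent is read off from it.\<close>

lemma fredholm_iff_LBinf:
  assumes p: "1 < p" and k: "Wk k"
  shows "fredholm_on (ereal p) (kop k) \<longleftrightarrow> (\<exists>F. finite F \<and> LBinf (- F) k \<and> LBinf (- F) (adj_kernel k))"
proof
  assume fr: "fredholm_on (ereal p) (kop k)"
  obtain h h' where h: "domk h k" "domk h' (adj_kernel k)" using k Wk_adj[OF k] by (auto simp: Wk_def)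
  obtain S where S: "finite S" "LBp p (- S) k" using fredholm_LBp[OF _ k fr] p by auto
  obtain T where T: "finite T" "LBp (conj_exp p) (- T) (adj_kernel k)" using fredholm_LBp_adj[OF p k fr] by auto
  have "LBinf (- S) k" by (rule LBp_imp_LBinf[OF h(1) _ S(2)]) (use p in simp)
  moreover have "LBinf (- T) (adj_kernel k)"
    by (rule LBp_imp_LBinf[OF h(2) _ T(2)]) (use conj_exp_props(1)[OF p] in simp)
  ultimately show "\<exists>F. finite F \<and> LBinf (- F) k \<and> LBinf (- F) (adj_kernel k)"
    using S(1) T(1) by (intro exI[of _ "S \<union> T"]) (auto elim: LBinf_mono)
next
  assume "\<exists>F. finite F \<and> LBinf (- F) k \<and> LBinf (- F) (adj_kernel k)"
  then obtain F where F: "finite F" "LBinf (- F) k" "LBinf (- F) (adj_kernel k)" by blast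
  obtain a where a: "Wk a" "\<forall>x\<in>-F. \<forall>y\<in>-F. kmul k a x y = kid x y" using right_regularizer[OF k F(3)] by blast
  obtain b where b: "Wk b" "\<forall>x\<in>-F. \<forall>y\<in>-F. kmul b k x y = kid x y" using left_regularizer[OF k F(2)] by blast
  show "fredholm_on (ereal p) (kop k)"
    by (rule fredholm_of_regularizers[OF _ k F(1) a(1) _ b(1)]) (use p a(2) b(2) in auto)
qed

text \<open>With \<open>Y\<close> the whole space the regularizers become a right and a left
  inverse, and these agree on bounded functions.\<close>

lemma invertible_of_LBinf:
  assumes p: "1 \<le> p" and k: "Wk k" and lb: "LBinf UNIV k" "LBinf UNIV (adj_kernel k)"
  shows "invertible_on (ereal p) (kop k)"
proof -
  have p0: "0 < p" using p by simp
  obtain a where a: "Wk a" "kmul k a = kid" using right_regularizer[OF k lb(2)] by (auto simp: fun_eq_iff)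
  obtain b where b: "Wk b" "kmul b k = kid" using left_regularizer[OF k lb(1)] by (auto simp: fun_eq_iff)
  have ka: "kop k (kop a u) = u" if "bdd u" for u using kop_kop[OF k a(1) that] a(2) by simp
  have bk: "kop b (kop k u) = u" if "bdd u" for u using kop_kop[OF b(1) k that] b(2) by simp
  have ab: "kop a u = kop b u" if "bdd u" for u
    using bk[OF bdd_kop[OF a(1) that]] ka[OF that] by simp
  have "kop a (kop k u) = u \<and> kop k (kop a u) = u" if "u \<in> lp (ereal p)" for u
    using ka bk ab[OF bdd_kop[OF k]] lp_bdd[OF p0 that] by simp
  then show ?thesis
    unfolding invertible_on_def using bounded_op_kop[OF p k] bounded_op_kop[OF p a(1)] by blast
qed

lemma LBinf_UNIV_injective:
  assumes "LBinf UNIV k" "bdd u" "kop k u = (\<lambda>x. 0)"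
  shows "u = (\<lambda>x. 0)"
proof -
  obtain c where c: "0 < c" "\<And>u t x. bdd u \<Longrightarrow> (\<And>x. norm (kop k u x) \<le> t) \<Longrightarrow> c * norm (u x) \<le> t"
    using assms(1) unfolding LBinf_def by auto
  have "c * norm (u x) \<le> 0" for x using c(2)[OF assms(2), of 0 x] assms(3) by simp
  then have "norm (u x) \<le> 0" for x using c(1) by (simp add: mult_le_0_iff)
  then show ?thesis by auto
qed

lemma lp_infinity: "u \<in> lp \<infinity> \<longleftrightarrow> bdd u"
  by (auto simp: lp_def bdd_def bdd_above_def)

lemma kid_lp: "0 < p \<Longrightarrow> kid y \<in> lp (ereal p)"
  by (rule lp_finite_support) (auto simp: kid_def)

text \<open>The bounded inverse gives a lower bound, directly if \<open>p\<close> is infinite and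
  through \<open>LBp_imp_LBinf\<close> otherwise. Its values at the unit vectors then form a kernel
  with decay, which acts on all the spaces, whereas the given inverse is known on one only.\<close>

lemma invertible_inverse_kernel:
  assumes p: "1 \<le> p" and k: "Wk k" and inv: "invertible_on p (kop k)"
  shows "LBinf UNIV k" "\<exists>b. Wk b \<and> kmul k b = kid"
proof -
  obtain B' where B': "bounded_op p B'" "\<And>u. u \<in> lp p \<Longrightarrow> B' (kop k u) = u" "\<And>u. u \<in> lp p \<Longrightarrow> kop k (B' u) = u"
    using inv unfolding invertible_on_def by blast
  obtain C where C: "\<And>u. u \<in> lp p \<Longrightarrow> lp_norm p (B' u) \<le> C * lp_norm p u" and B'lp: "\<And>u. u \<in> lp p \<Longrightarrow> B' u \<in> lp p"
    using B'(1) unfolding bounded_op_def by blast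
  have klp: "\<And>u. u \<in> lp p \<Longrightarrow> kop k u \<in> lp p"
    using inv unfolding invertible_on_def bounded_op_def by blast
  \<comment> \<open>The operator bound \<open>C\<close> may fail to be positive, but a lower bound
    needs a positive constant.\<close>
  define D where "D = max C 1"
  have D: "0 < D" "C \<le> D" by (auto simp: D_def)
  obtain h where h: "domk h k" using k by (auto simp: Wk_def)
  have "LBinf UNIV k \<and> (\<forall>u :: 'x \<Rightarrow> complex. u \<in> lp p \<longrightarrow> bdd u) \<and> (\<forall>y :: 'x. kid y \<in> lp p)"
  proof (cases p)
    case (real q)
    have q: "1 \<le> q" "0 < q" using p real by auto
    have "LBp q UNIV k"
    proof (rule LBpI[OF q(2) D(1)])
      fix u :: "'x \<Rightarrow> complex" assume "finite {x. u x \<noteq> 0}"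
      then have u: "u \<in> lp p" unfolding real by (rule lp_finite_support[OF q(2)])
      have "lp_norm p u \<le> C * lp_norm p (kop k u)" using C[OF klp[OF u]] B'(2)[OF u] by simp
      also have "\<dots> \<le> D * lp_norm p (kop k u)" using D(2) lp_norm_nonneg[of q] by (intro mult_right_mono) (auto simp: real)
      finally show "kop k u \<in> lp (ereal q) \<and> lp_norm (ereal q) u \<le> D * lp_norm (ereal q) (kop k u)"
        using klp[OF u] by (simp add: real)
    qed
    then have "LBinf UNIV k" by (rule LBp_imp_LBinf[OF h q(1)])
    then show ?thesis by (auto simp: real intro: lp_bdd[OF q(2)] kid_lp[OF q(2)])
  next
    case PInf
    have lp: "lp_norm p v = (SUP x. norm (v x))" for v :: "'x \<Rightarrow> complex" by (simp add: PInf lp_norm_def)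
    have "LBinf UNIV k"
      unfolding LBinf_def
    proof (intro exI[of _ "1 / D"] conjI allI impI)
      fix u :: "'x \<Rightarrow> complex" and t x
      assume u: "bdd u" and t: "\<forall>x. norm (kop k u x) \<le> t"
      have uL: "u \<in> lp p" using u by (simp add: PInf lp_infinity)
      have t0: "0 \<le> t" using t norm_ge_zero order_trans by blast
      have "norm (u x) \<le> lp_norm p u"
        unfolding lp using u by (intro cSUP_upper) (auto simp: bdd_def bdd_above_def)
      also have "\<dots> \<le> C * lp_norm p (kop k u)" using C[OF klp[OF uL]] B'(2)[OF uL] by simp
      also have "\<dots> \<le> D * lp_norm p (kop k u)"
      proof (rule mult_right_mono[OF D(2)])
        have "bdd (kop k u)" by (rule bdd_kop[OF k u])
        then have "norm (kop k u x) \<le> lp_norm p (kop k u)"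
          unfolding lp by (intro cSUP_upper) (auto simp: bdd_def bdd_above_def)
        then show "0 \<le> lp_norm p (kop k u)" using norm_ge_zero order_trans by blast
      qed
      also have "\<dots> \<le> D * t" unfolding lp using t D(1) by (intro mult_left_mono cSUP_least) auto
      finally show "1 / D * norm (u x) \<le> t" using D(1) by (simp add: field_simps)
    qed (use D in auto)
    moreover have "bdd (kid y)" for y :: 'x by (rule bddI[of _ 1]) (simp add: kid_def)
    ultimately show ?thesis by (simp add: PInf lp_infinity)
  next
    case MInf
    then show ?thesis using p by simp
  qed
  then have L: "LBinf UNIV k" "\<And>u :: 'x \<Rightarrow> complex. u \<in> lp p \<Longrightarrow> bdd u" "\<And>y :: 'x. kid y \<in> lp p" by auto
  show "LBinf UNIV k" by (rule L(1))
  have "bdd (B' (kid y)) \<and> kop k (B' (kid y)) = kid y" for y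
    using L(2)[OF B'lp[OF L(3)]] B'(3)[OF L(3)] by blast
  then show "\<exists>b. Wk b \<and> kmul k b = kid"
    by (intro inverse_kernel[OF h L(1)]) blast
qed

text \<open>For the transpose, the transposed right inverse kernel is a left inverse. Since only
  kernels are involved, \<open>u\<close> may be any bounded function, also for finite
  \<open>p\<close>.\<close>

lemma invertible_injective:
  assumes p: "1 \<le> p" and k: "Wk k" and inv: "invertible_on p (kop k)" and u: "bdd u"
  shows "kop k u = (\<lambda>x. 0) \<Longrightarrow> u = (\<lambda>x. 0)" "kop (adj_kernel k) u = (\<lambda>x. 0) \<Longrightarrow> u = (\<lambda>x. 0)"
proof -
  show "kop k u = (\<lambda>x. 0) \<Longrightarrow> u = (\<lambda>x. 0)"
    using LBinf_UNIV_injective[OF invertible_inverse_kernel(1)[OF p k inv] u] .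
  obtain b where b: "Wk b" "kmul k b = kid" using invertible_inverse_kernel(2)[OF p k inv] by blast
  have "kmul (adj_kernel b) (adj_kernel k) = adj_kernel kid" by (simp add: kmul_adj b(2))
  also have "adj_kernel kid = kid" by (auto simp: adj_kernel_def kid_def fun_eq_iff)
  finally have "kop (adj_kernel b) (kop (adj_kernel k) u) = u"
    using kop_kop[OF Wk_adj[OF b(1)] Wk_adj[OF k] u] by simp
  then show "u = (\<lambda>x. 0)" if "kop (adj_kernel k) u = (\<lambda>x. 0)" using that by simp
qed

end

text \<open>Subtracting a scalar from \<open>kop k\<close> is known to be a kernel operator only
  where the sums converge, so properties have to be transferred between operators that agree on
  l^p.\<close>

lemma bounded_op_cong:
  assumes p: "1 \<le> p" and eq: "\<And>u. u \<in> lp (ereal p) \<Longrightarrow> A u = B u"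
  shows "bounded_op (ereal p) A \<longleftrightarrow> bounded_op (ereal p) B"
proof -
  have eqa: "A (\<lambda>x. u x + v x) = B (\<lambda>x. u x + v x)" if "u \<in> lp (ereal p)" "v \<in> lp (ereal p)" for u v
    by (rule eq[OF lp_add[OF p that]])
  have eqc: "A (\<lambda>x. c * u x) = B (\<lambda>x. c * u x)" if "u \<in> lp (ereal p)" for u c
    by (rule eq[OF lp_cmult(1)]) (use p that in auto)
  show ?thesis unfolding bounded_op_def by (simp add: eq eqa eqc cong: ball_cong)
qed

lemma invertible_on_cong:
  assumes p: "1 \<le> p" and eq: "\<And>u. u \<in> lp (ereal p) \<Longrightarrow> A u = B u"
  shows "invertible_on (ereal p) A \<longleftrightarrow> invertible_on (ereal p) B"
proof -
  have "(\<forall>u\<in>lp (ereal p). B' (A u) = u \<and> A (B' u) = u) \<longleftrightarrow> (\<forall>u\<in>lp (ereal p). B' (B u) = u \<and> B (B' u) = u)"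
    if "bounded_op (ereal p) B'" for B'
  proof (rule ball_cong[OF refl])
    fix u :: "'a \<Rightarrow> complex" assume u: "u \<in> lp (ereal p)"
    then have "B' u \<in> lp (ereal p)" using that unfolding bounded_op_def by blast
    then show "(B' (A u) = u \<and> A (B' u) = u) = (B' (B u) = u \<and> B (B' u) = u)"
      using eq[OF u] eq by simp
  qed
  then show ?thesis
    unfolding invertible_on_def by (intro conj_cong ex_cong1 bounded_op_cong[OF p] refl) (auto simp: eq)
qed

lemma fredholm_on_cong:
  assumes p: "1 \<le> p" and eq: "\<And>u. u \<in> lp (ereal p) \<Longrightarrow> A u = B u"
  shows "fredholm_on (ereal p) A \<longleftrightarrow> fredholm_on (ereal p) B"
proof -
  have "A ` lp (ereal p) = B ` lp (ereal p)" using eq by (rule image_cong[OF refl])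
  moreover have "{u \<in> lp (ereal p). A u = (\<lambda>x. 0)} = {u \<in> lp (ereal p). B u = (\<lambda>x. 0)}" using eq by auto
  ultimately show ?thesis
    unfolding fredholm_on_def using bounded_op_cong[OF p eq] by simp
qed

section \<open>Coordinates for the group action\<close>

locale periodic_space =
  fixes act :: "int^'n \<Rightarrow> 'x \<Rightarrow> 'x" and R :: "'x set"
  assumes act_zero: "act 0 x = x"
    and act_add: "act (\<alpha> + \<beta>) x = act \<alpha> (act \<beta> x)"
    and act_free: "act \<alpha> x = x \<Longrightarrow> \<alpha> = 0"
    and finite_orbits: "finite (range (orbit act))"
    and reps: "orbit_reps act R"
begin

definition rep :: "'x \<Rightarrow> 'x" where
  "rep x = (THE r. r \<in> R \<and> r \<in> orbit act x)"

text \<open>The orbit coordinate; freeness of the action makes it unique.\<close>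

definition cell :: "'x \<Rightarrow> int^'n" where
  "cell x = (THE \<alpha>. act \<alpha> (rep x) = x)"

lemma act_minus [simp]: "act (- \<alpha>) (act \<alpha> x) = x" "act \<alpha> (act (- \<alpha>) x) = x"
  using act_add[of "- \<alpha>" \<alpha> x] act_add[of \<alpha> "- \<alpha>" x] by (simp_all add: act_zero)

lemma act_inj: "act \<alpha> x = act \<beta> x \<Longrightarrow> \<alpha> = \<beta>"
proof -
  assume eq: "act \<alpha> x = act \<beta> x"
  have "act (- \<beta> + \<alpha>) x = x" unfolding act_add eq by (rule act_minus)
  then show "\<alpha> = \<beta>" using act_free by fastforce
qed

lemma bij_act: "bij (act \<alpha>)"
  by (rule bij_betwI[of _ _ _ "act (- \<alpha>)"]) auto

lemma rep: "rep x \<in> R" "rep x \<in> orbit act x"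
proof -
  have "\<exists>!r. r \<in> R \<and> r \<in> orbit act x" using reps by (simp add: orbit_reps_def)
  from theI'[OF this] show "rep x \<in> R" "rep x \<in> orbit act x" by (auto simp: rep_def)
qed

lemma rep_eqI: "r \<in> R \<Longrightarrow> r \<in> orbit act x \<Longrightarrow> rep x = r"
  using reps rep[of x] unfolding orbit_reps_def by blast

lemma act_cell: "act (cell x) (rep x) = x"
proof -
  obtain \<alpha> where "rep x = act \<alpha> x" using rep(2)[of x] by (auto simp: orbit_def)
  then have eq: "act (- \<alpha>) (rep x) = x" by simp
  then show ?thesis unfolding cell_def
  proof (rule theI)
    fix \<beta> assume "act \<beta> (rep x) = x"
    then have "act \<beta> (rep x) = act (- \<alpha>) (rep x)" using eq by (rule trans[OF _ sym])
    then show "\<beta> = - \<alpha>" by (rule act_inj)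
  qed
qed

lemma cell_eqI: "act \<alpha> (rep x) = x \<Longrightarrow> cell x = \<alpha>"
  by (rule act_inj[of _ "rep x"]) (simp add: act_cell)

lemma orbit_act: "orbit act (act \<alpha> x) = orbit act x"
  unfolding orbit_def
proof (intro equalityI subsetI)
  fix y assume "y \<in> range (\<lambda>\<beta>. act \<beta> (act \<alpha> x))"
  then show "y \<in> range (\<lambda>\<alpha>. act \<alpha> x)" by (auto simp: act_add[symmetric])
next
  fix y assume "y \<in> range (\<lambda>\<alpha>. act \<alpha> x)"
  then obtain \<beta> where "y = act \<beta> x" by blast
  then have "y = act (\<beta> - \<alpha>) (act \<alpha> x)" by (simp add: act_add[symmetric])
  then show "y \<in> range (\<lambda>\<beta>. act \<beta> (act \<alpha> x))" by blast
qed

lemma rep_act [simp]: "rep (act \<alpha> x) = rep x"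
  by (rule rep_eqI) (use rep[of x] in \<open>auto simp: orbit_act\<close>)

lemma cell_act [simp]: "cell (act \<alpha> x) = \<alpha> + cell x"
  by (rule cell_eqI) (simp add: act_add act_cell)

lemma self_orbit: "x \<in> orbit act x"
  unfolding orbit_def by (rule range_eqI[of _ _ 0]) (simp add: act_zero)

lemma rep_of_R: "r \<in> R \<Longrightarrow> rep r = r"
  by (rule rep_eqI) (simp_all add: self_orbit)

lemma cell_of_R: "r \<in> R \<Longrightarrow> cell r = 0"
  by (rule cell_eqI) (simp add: rep_of_R act_zero)

lemma finite_R: "finite R"
proof (rule finite_imageD)
  show "finite (orbit act ` R)" using finite_orbits by (rule finite_subset[rotated]) auto
  show "inj_on (orbit act) R"
  proof (rule inj_onI)
    fix r s assume rs: "r \<in> R" "s \<in> R" "orbit act r = orbit act s"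
    have "rep r = s" using rs by (intro rep_eqI) (auto simp: self_orbit)
    then show "r = s" using rep_of_R[OF rs(1)] by simp
  qed
qed

lemma cell_set: "{x. cell x = \<alpha>} = act \<alpha> ` R"
proof (intro equalityI subsetI)
  fix x assume "x \<in> {x. cell x = \<alpha>}"
  then show "x \<in> act \<alpha> ` R" using act_cell[of x] rep(1)[of x] by (intro image_eqI[of _ _ "rep x"]) auto
qed (auto simp: cell_of_R)

sublocale cells cell "card R"
  by unfold_locales (auto simp: cell_set finite_R intro: card_image_le)

text \<open>A single entry is at most the sum over representatives. Conversely that sum has
  \<open>card R\<close> terms with a common bound, because all representatives lie in cell
  0.\<close>

lemma in_W_iff: "in_W act R k \<longleftrightarrow> Wk k"
proof
  assume "in_W act R k"
  then obtain h where h: "(\<lambda>\<alpha>. norm (h \<alpha>)) summable_on UNIV"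
    "\<And>\<alpha> \<beta> j. j \<in> R \<Longrightarrow> (\<Sum>i\<in>R. norm (k (act \<alpha> i) (act \<beta> j))) \<le> h (\<alpha> - \<beta>)"
    unfolding in_W_def by blast
  have "nsum (\<lambda>\<gamma>. ennreal (h \<gamma>)) \<le> nsum (\<lambda>\<gamma>. ennreal (norm (h \<gamma>)))"
    by (intro nn_integral_mono ennreal_leI) simp
  also have "\<dots> < top" using h(1) by (subst (asm) summable_on_nonneg_iff(1)) auto
  finally have "nsum (\<lambda>\<gamma>. ennreal (h \<gamma>)) < top" .
  moreover have "en (k x y) \<le> ennreal (h (cell x - cell y))" for x y
  proof (rule ennreal_leI)
    have "norm (k x y) = norm (k (act (cell x) (rep x)) (act (cell y) (rep y)))" by (simp add: act_cell)
    also have "\<dots> \<le> (\<Sum>i\<in>R. norm (k (act (cell x) i) (act (cell y) (rep y))))"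
      by (rule member_le_sum) (auto simp: finite_R rep(1))
    also have "\<dots> \<le> h (cell x - cell y)" by (rule h(2)[OF rep(1)])
    finally show "norm (k x y) \<le> h (cell x - cell y)" .
  qed
  ultimately show "Wk k" unfolding Wk_def domk_def by blast
next
  assume "Wk k"
  then obtain h where h: "nsum h < top" "\<And>x y. en (k x y) \<le> h (cell x - cell y)" by (auto simp: Wk_def domk_def)
  have hr: "h \<gamma> = ennreal (enn2real (h \<gamma>))" for \<gamma> using le_less_trans[OF nsum_ge h(1), of \<gamma>] by simp
  have sm: "(\<lambda>\<gamma>. enn2real (h \<gamma>)) summable_on UNIV"
    using h(1) by (simp add: summable_on_nonneg_iff(1) hr[symmetric])
  show "in_W act R k"
    unfolding in_W_def
  proof (intro exI[of _ "\<lambda>\<gamma>. real (card R) * enn2real (h \<gamma>)"] conjI allI ballI)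
    show "(\<lambda>\<gamma>. norm (real (card R) * enn2real (h \<gamma>))) summable_on UNIV"
      using summable_on_cmult_right[OF sm, of "real (card R)"] by simp
    fix \<alpha> \<beta> j assume j: "j \<in> R"
    have "norm (k (act \<alpha> i) (act \<beta> j)) \<le> enn2real (h (\<alpha> - \<beta>))" if "i \<in> R" for i
    proof -
      have "en (k (act \<alpha> i) (act \<beta> j)) \<le> ennreal (enn2real (h (\<alpha> - \<beta>)))"
        using h(2)[of "act \<alpha> i" "act \<beta> j"] that j by (simp add: cell_of_R hr[symmetric])
      then show ?thesis by simp
    qed
    then show "(\<Sum>i\<in>R. norm (k (act \<alpha> i) (act \<beta> j))) \<le> real (card R) * enn2real (h (\<alpha> - \<beta>))"
      by (rule sum_bounded_above)
  qed
qed

lemma domk_translate: "domk h k \<Longrightarrow> domk h (translate_kernel act \<alpha> k)"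
  unfolding domk_def translate_kernel_def by (metis add_diff_cancel_left cell_act)

lemma kop_translate: "kop (translate_kernel act \<alpha> k) u x = kop k (shift act \<alpha> u) (act \<alpha> x)"
proof -
  have "kop k (shift act \<alpha> u) (act \<alpha> x) = (\<Sum>\<^sub>\<infinity>y. k (act \<alpha> x) (act \<alpha> y) * shift act \<alpha> u (act \<alpha> y))"
    unfolding kop_def by (rule infsum_reindex_bij_betw[OF bij_act, symmetric])
  then show ?thesis by (simp add: kop_def translate_kernel_def shift_def)
qed

lemma shift_conj_kop: "shift_conj act \<alpha> (kop k) = kop (translate_kernel act \<alpha> k)"
  by (rule ext)+ (simp add: shift_conj_def shift_def[of act "- \<alpha>"] kop_translate)

lemma translate_adj: "translate_kernel act \<alpha> (adj_kernel k) = adj_kernel (translate_kernel act \<alpha> k)"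
  by (simp add: translate_kernel_def adj_kernel_def)

lemma pn_translate: "pn p (\<lambda>x. u (act \<alpha> x)) = pn p u"
  unfolding pn_def by (rule nn_integral_bij_count_space[OF bij_act])

lemma limit_op_symmetric:
  assumes p: "1 < p" and lim: "is_limit_op act R (conj_exp p) (adj_kernel k) h k'"
  shows "is_limit_op act R p k h (adj_kernel k')"
  using lim Wk_adj conj_exp_props(4)[OF p] unfolding is_limit_op_def in_W_iff by simp

text \<open>Translates of a finitely supported \<open>w\<close> eventually leave \<open>F\<close>,
  so the lower bound of \<open>k\<close> applies to them with a constant independent of
  \<open>m\<close>, and strong convergence hands it on to \<open>k'\<close>.\<close>

lemma limit_lower_bound:
  assumes p: "1 \<le> p" and k: "Wk k" "Wk k'" and F: "finite F" "LBinf (- F) k"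
    and h: "tends_to_infinity h" and sc: "strong_conv (ereal p) (\<lambda>m. shift_conj act (h m) (kop k)) (kop k')"
  shows "LBinf UNIV k'"
proof -
  have p0: "0 < p" using p by simp
  let ?N = "lp_norm (ereal p)"
  obtain d d' where d: "domk d k" "domk d' k'" using k by (auto simp: Wk_def)
  obtain C where C: "0 < C" "\<And>u. bdd u \<Longrightarrow> (\<And>x. x \<notin> - F \<Longrightarrow> u x = 0) \<Longrightarrow> pn p u \<le> ennreal C * pn p (kop k u)"
    using LBinf_imp_pn_bound[OF d(1) F(2) p] by blast
  define B where "B = C powr (1 / p)"
  have B: "0 < B" "B powr p = C" using C p0 by (auto simp: B_def powr_powr)
  have "LBp p UNIV k'"
  proof (rule LBpI[OF p0 B(1)])
    fix w :: "'x \<Rightarrow> complex" assume fs: "finite {x. w x \<noteq> 0}"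
    have w: "w \<in> lp (ereal p)" by (rule lp_finite_support[OF p0 fs])
    have kw: "kop k' w \<in> lp (ereal p)" by (rule kop_lp[OF p k(2) w])
    let ?A = "\<lambda>m. kop (translate_kernel act (h m) k) w"
    have Am: "?A m \<in> lp (ereal p)" for m
      by (rule kop_lp[OF p _ w]) (use domk_translate[OF d(1)] in \<open>auto simp: Wk_def\<close>)
    \<comment> \<open>If the translate of \<open>w\<close> by \<open>h m\<close> is nonzero at some
      point of \<open>F\<close>, then \<open>h m\<close> is one of these finitely many
      differences.\<close>
    have "finite ((\<lambda>(x, y). cell x - cell y) ` (F \<times> {x. w x \<noteq> 0}))"
      using F(1) fs by simp
    then have "\<forall>\<^sub>F m in sequentially. h m \<notin> (\<lambda>(x, y). cell x - cell y) ` (F \<times> {x. w x \<noteq> 0})"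
      using h unfolding tends_to_infinity_def by blast
    moreover have "?N w \<le> B * ?N (kop k' w) + B * ?N (\<lambda>x. ?A m x - kop k' w x)"
      if hm: "h m \<notin> (\<lambda>(x, y). cell x - cell y) ` (F \<times> {x. w x \<noteq> 0})" for m
    proof -
      let ?u = "shift act (h m) w"
      have "?u x = 0" if "x \<notin> - F" for x
      proof (rule ccontr)
        assume "?u x \<noteq> 0"
        then have "(x, act (- h m) x) \<in> F \<times> {x. w x \<noteq> 0}" using that by (simp add: shift_def)
        then have "h m \<in> (\<lambda>(x, y). cell x - cell y) ` (F \<times> {x. w x \<noteq> 0})"
          by (intro image_eqI[of _ _ "(x, act (- h m) x)"]) auto
        then show False using hm by simp
      qed
      moreover have "bdd ?u"
        using bdd_finite_support[OF fs] unfolding bdd_def shift_def by blast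
      ultimately have "pn p ?u \<le> ennreal C * pn p (kop k ?u)" by (intro C(2)) auto
      moreover have "pn p ?u = pn p w" unfolding shift_def by (rule pn_translate)
      moreover have "pn p (?A m) = pn p (kop k ?u)"
        unfolding kop_translate[abs_def] by (rule pn_translate)
      ultimately have "pn p w \<le> ennreal C * pn p (?A m)" by simp
      also have "\<dots> = ennreal ((B * ?N (?A m)) powr p)"
        using B C(1) by (simp add: pn_eq_lp_norm[OF p0 Am] powr_mult ennreal_mult)
      finally have "?N w \<le> B * ?N (?A m)"
        using B by (intro lp_norm_leI[OF p0]) (auto simp: lp_norm_nonneg)
      also have "?N (?A m) \<le> ?N (kop k' w) + ?N (\<lambda>x. ?A m x - kop k' w x)"
        using lp_norm_triangle[OF p kw lp_diff[OF p Am kw]] by simp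
      finally show ?thesis using B(1) by (simp add: distrib_left)
    qed
    ultimately have "\<forall>\<^sub>F m in sequentially. ?N w \<le> B * ?N (kop k' w) + B * ?N (\<lambda>x. ?A m x - kop k' w x)"
      by (rule eventually_mono)
    moreover have "(\<lambda>m. B * ?N (kop k' w) + B * ?N (\<lambda>x. ?A m x - kop k' w x)) \<longlonglongrightarrow> B * ?N (kop k' w) + B * 0"
      using sc w unfolding strong_conv_def shift_conj_kop by (intro tendsto_intros) blast
    ultimately have "?N w \<le> B * ?N (kop k' w) + B * 0"
      by (intro tendsto_lowerbound) auto
    then show "kop k' w \<in> lp (ereal p) \<and> ?N w \<le> B * ?N (kop k' w)" using kw by simp
  qed
  then show ?thesis by (rule LBp_imp_LBinf[OF d(2) p])
qed

lemma limit_op_invertible: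
  assumes p: "1 < p" and k: "Wk k" and fr: "fredholm_on (ereal p) (kop k)" and lim: "k' \<in> limit_ops act R p k"
  shows "invertible_on (ereal p) (kop k')"
proof -
  obtain F where F: "finite F" "LBinf (- F) k" "LBinf (- F) (adj_kernel k)"
    using fr fredholm_iff_LBinf[OF p k] by blast
  obtain h where h: "is_limit_op act R p k h k'" using lim by (auto simp: limit_ops_def)
  then have k': "Wk k'" and inf: "tends_to_infinity h"
    and sc: "strong_conv (ereal p) (\<lambda>m. shift_conj act (h m) (kop k)) (kop k')"
      "strong_conv (ereal (conj_exp p)) (\<lambda>m. shift_conj act (h m) (kop (adj_kernel k))) (kop (adj_kernel k'))"
    unfolding is_limit_op_def in_W_iff by auto
  have "LBinf UNIV k'" by (rule limit_lower_bound[OF _ k k' F(1,2) inf sc(1)]) (use p in simp)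
  moreover have "LBinf UNIV (adj_kernel k')"
    by (rule limit_lower_bound[OF _ Wk_adj[OF k] Wk_adj[OF k'] F(1,3) inf sc(2)]) (use conj_exp_props(1)[OF p] in simp)
  ultimately show ?thesis using p by (intro invertible_of_LBinf k') auto
qed

text \<open>All translates share one dominating function, so entrywise convergence already implies
  strong convergence, both for the kernel and for its transpose.\<close>

lemma pointwise_limit_op:
  assumes p: "1 < p" and k: "Wk k" and h: "tends_to_infinity h"
    and lim: "\<And>x y. (\<lambda>m. translate_kernel act (h m) k x y) \<longlonglongrightarrow> k' x y"
  shows "k' \<in> limit_ops act R p k"
proof -
  obtain d where d: "domk d k" using k by (auto simp: Wk_def)
  obtain d' where d': "domk d' (adj_kernel k)" using domk_adj[OF d] by blast
  have p1: "1 \<le> p" "1 \<le> conj_exp p" using p conj_exp_props(1)[OF p] by auto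
  have "domk d k'" by (rule strong_conv_of_pointwise(1)[OF p1(1) domk_translate[OF d] lim])
  moreover have "strong_conv (ereal p) (\<lambda>m. kop (translate_kernel act (h m) k)) (kop k')"
    by (rule strong_conv_of_pointwise(2)[OF p1(1) domk_translate[OF d] lim])
  moreover have "strong_conv (ereal (conj_exp p)) (\<lambda>m. kop (translate_kernel act (h m) (adj_kernel k))) (kop (adj_kernel k'))"
    by (rule strong_conv_of_pointwise(2)[OF p1(2) domk_translate[OF d']])
      (use lim in \<open>simp add: translate_adj\<close>, simp add: adj_kernel_def lim)
  ultimately show ?thesis
    using h by (auto simp: limit_ops_def is_limit_op_def in_W_iff shift_conj_kop Wk_def)
qed

text \<open>A counterexample is normalized by its supremum; as this need not be attained, some point
  carries at least half of it.\<close>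

lemma LBinf_failure_witness:
  assumes k: "Wk k" and nlb: "\<not> LBinf Y k" and e: "0 < e"
  shows "\<exists>v x. (\<forall>y. norm (v y) \<le> 1) \<and> (\<forall>y. y \<notin> Y \<longrightarrow> v y = 0) \<and> (\<forall>y. norm (kop k v y) \<le> e) \<and> 1/2 \<le> norm (v x)"
proof -
  obtain u t x0 where u: "bdd u" "\<And>x. x \<notin> Y \<Longrightarrow> u x = 0" "\<And>x. norm (kop k u x) \<le> t" "t < e * norm (u x0)"
    using nlb e unfolding LBinf_def by (meson not_le)
  define U where "U = (SUP x. norm (u x))"
  have bd: "bdd_above (range (\<lambda>x. norm (u x)))" using u(1) by (auto simp: bdd_def bdd_above_def)
  have uU: "norm (u x) \<le> U" for x unfolding U_def by (rule cSUP_upper[OF _ bd]) simp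
  have "0 \<le> t" using u(3) norm_ge_zero order_trans by blast
  then have "0 < e * norm (u x0)" using u(4) by linarith
  then have "0 < norm (u x0)" using e by (simp add: zero_less_mult_iff)
  then have U: "0 < U" using uU[of x0] by linarith
  obtain x where x: "U / 2 < norm (u x)"
    using less_cSUP_iff[of UNIV "\<lambda>x. norm (u x)" "U / 2"] bd U by (auto simp: U_def)
  have tU: "t \<le> e * U" using u(4) uU[of x0] e mult_left_mono[of "norm (u x0)" U e] by linarith
  define v where "v y = of_real (1 / U) * u y" for y
  have nv: "norm (v y) = norm (u y) / U" for y using U by (simp add: v_def norm_mult norm_divide)
  have kv: "norm (kop k v y) = norm (kop k u y) / U" for y
    using U by (simp add: v_def[abs_def] kop_cmult[of k "of_real (1 / U)"] norm_mult norm_divide del: of_real_divide)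
  show ?thesis
  proof (intro exI[of _ v] exI[of _ x] conjI allI impI)
    show "norm (v y) \<le> 1" for y using uU[of y] U by (simp add: nv)
    show "v y = 0" if "y \<notin> Y" for y using u(2)[OF that] by (simp add: v_def)
    show "norm (kop k v y) \<le> e" for y
      using u(3)[of y] tU U by (simp add: kv pos_divide_le_eq)
    show "1/2 \<le> norm (v x)" using x U by (simp add: nv pos_le_divide_eq)
  qed
qed

text \<open>If the lower bound fails off every finite set, translates of almost null functions concentrated far out
  converge along a subsequence to a bounded null function of a limit operator.\<close>

theorem LBinf_of_injective_limit_ops:
  assumes p: "1 < p" and k: "Wk k"
    and inj: "\<And>k' u. k' \<in> limit_ops act R p k \<Longrightarrow> bdd u \<Longrightarrow> kop k' u = (\<lambda>x. 0) \<Longrightarrow> u = (\<lambda>x. 0)"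
  shows "\<exists>F. finite F \<and> LBinf (- F) k"
proof (rule ccontr)
  assume "\<not> ?thesis"
  then have no: "\<not> LBinf (- F) k" if "finite F" for F using that by blast
  let ?i = "to_nat_on (UNIV :: 'x set)"
  \<comment> \<open>A finite exhaustion of the space from an enumeration; a function vanishing on
    \<open>F m\<close> has its large value at a point outside \<open>F m\<close>.\<close>
  define F where "F m = {x. ?i x < m}" for m
  have finF: "finite (F m)" for m
    using finite_vimage_IntI[of "{..<m}" ?i UNIV] inj_on_to_nat_on[OF countable_points[of UNIV]]
    by (simp add: F_def vimage_def)
  have "\<exists>v x. (\<forall>y. norm (v y) \<le> 1) \<and> (\<forall>y. y \<notin> - F m \<longrightarrow> v y = 0) \<and> (\<forall>y. norm (kop k v y) \<le> 1 / real (Suc m)) \<and> 1/2 \<le> norm (v x)" for m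
    by (rule LBinf_failure_witness[OF k no[OF finF]]) simp
  then obtain v X where v: "\<And>m y. norm (v m y) \<le> 1" "\<And>m y. y \<in> F m \<Longrightarrow> v m y = 0"
    "\<And>m y. norm (kop k (v m) y) \<le> 1 / real (Suc m)" "\<And>m. 1/2 \<le> norm (v m (X m))"
    unfolding Compl_iff not_not by metis
  \<comment> \<open>This translation moves the point \<open>X m\<close> to its representative, so
    the large value stays in the finite set \<open>R\<close>.\<close>
  define \<alpha> where "\<alpha> m = cell (X m)" for m
  define \<kappa> where "\<kappa> m = translate_kernel act (\<alpha> m) k" for m
  define w where "w m x = v m (act (\<alpha> m) x)" for m x
  have wshift: "shift act (\<alpha> m) (w m) = v m" for m by (auto simp: shift_def w_def)
  have \<kappa>w: "norm (kop (\<kappa> m) (w m) x) \<le> 1 / real (Suc m)" for m x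
    unfolding \<kappa>_def kop_translate wshift by (rule v(3))
  \<comment> \<open>The representative may vary with \<open>m\<close>; the sum over \<open>R\<close>
    gives a bound that passes to the limit.\<close>
  have wsum: "1/2 \<le> (\<Sum>r\<in>R. norm (w m r))" for m
  proof -
    have "1/2 \<le> norm (w m (rep (X m)))" using v(4)[of m] by (simp add: w_def \<alpha>_def act_cell)
    also have "\<dots> \<le> (\<Sum>r\<in>R. norm (w m r))" by (rule member_le_sum) (auto simp: rep(1) finite_R)
    finally show ?thesis .
  qed
  obtain d where d: "domk d k" using k by (auto simp: Wk_def)
  have d\<kappa>: "domk d (\<kappa> m)" for m unfolding \<kappa>_def by (rule domk_translate[OF d])
  obtain W where W: "0 < W" "\<And>x. nsum (\<lambda>y. en (k x y)) \<le> ennreal W" using Wk_bounds[OF k] by metis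
  have kW: "norm (k x y) \<le> W" for x y
    using order_trans[OF nsum_ge W(2), of x y] W(1) by simp
  \<comment> \<open>Kernel entries and function values form one countable family, so that both
    converge along the same subsequence.\<close>
  obtain s where s: "strict_mono s"
    "\<And>i. i \<in> UNIV \<Longrightarrow> \<exists>l. (\<lambda>n. case_sum (\<lambda>(x, y). \<kappa> (s n) x y) (w (s n)) i) \<longlonglongrightarrow> l"
  proof (rule function_convergent_subsequence[where f = "\<lambda>n. case_sum (\<lambda>(x, y). \<kappa> n x y) (w n)" and M = "max W 1" and S = UNIV])
    have "countable (UNIV \<times> UNIV :: ('x \<times> 'x) set)" by (intro countable_SIGMA countable_points)
    then show "countable (UNIV :: ('x \<times> 'x + 'x) set)"
      using countable_points[of UNIV] by (simp add: UNIV_sum)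
    fix n and i :: "'x \<times> 'x + 'x"
    show "norm (case_sum (\<lambda>(x, y). \<kappa> n x y) (w n) i) \<le> max W 1"
      using kW v(1) by (auto simp: \<kappa>_def translate_kernel_def w_def le_max_iff_disj split: sum.split)
  qed (rule that)
  define k' where "k' x y = lim (\<lambda>n. \<kappa> (s n) x y)" for x y
  define u where "u x = lim (\<lambda>n. w (s n) x)" for x
  have k': "(\<lambda>n. \<kappa> (s n) x y) \<longlonglongrightarrow> k' x y" for x y
    using s(2)[of "Inl (x, y)"] by (simp add: k'_def convergent_LIMSEQ_iff[symmetric] convergent_def)
  have u: "(\<lambda>n. w (s n) x) \<longlonglongrightarrow> u x" for x
    using s(2)[of "Inr x"] by (simp add: u_def convergent_LIMSEQ_iff[symmetric] convergent_def)
  have "tends_to_infinity (\<lambda>n. \<alpha> (s n))"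
    unfolding tends_to_infinity_def
  proof (intro allI impI)
    fix \<Phi> :: "(int^'n) set" assume \<Phi>: "finite \<Phi>"
    have "finite (\<Union>\<gamma>\<in>\<Phi>. {x. cell x = \<gamma>})" using \<Phi> finite_cell by blast
    then have fin: "finite {x. cell x \<in> \<Phi>}" by (rule finite_subset[rotated]) auto
    obtain n where n: "\<And>x. cell x \<in> \<Phi> \<Longrightarrow> ?i x < n"
      using finite_imageI[OF fin, of ?i] unfolding finite_nat_set_iff_bounded by blast
    have "\<alpha> (s m) \<notin> \<Phi>" if "n \<le> m" for m
    proof
      assume "\<alpha> (s m) \<in> \<Phi>"
      then have "?i (X (s m)) < n" by (intro n) (simp add: \<alpha>_def)
      also have "n \<le> s m" using that seq_suble[OF s(1), of m] by linarith
      finally have "v (s m) (X (s m)) = 0" by (intro v(2)) (simp add: F_def)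
      then show False using v(4)[of "s m"] by simp
    qed
    then show "\<forall>\<^sub>F m in sequentially. \<alpha> (s m) \<notin> \<Phi>" by (auto simp: eventually_sequentially)
  qed
  from pointwise_limit_op[OF p k this] have lop: "k' \<in> limit_ops act R p k" using k' by (simp add: \<kappa>_def)
  have bu: "bdd u"
    by (rule bddI[of _ 1]) (rule LIMSEQ_le_const2[OF tendsto_norm[OF u]], use v(1) in \<open>auto simp: w_def\<close>)
  have "kop k' u x = 0" for x
  proof -
    have dr: "d \<gamma> = ennreal (enn2real (d \<gamma>))" for \<gamma>
      using d le_less_trans[OF nsum_ge, of d top \<gamma>] by (simp add: domk_def)
    \<comment> \<open>Kernel and function vary together; the shared dominating function
      \<open>d\<close> is the majorant because the functions are bounded by 1.\<close>
    have "(\<lambda>n. kop (\<kappa> (s n)) (w (s n)) x) \<longlonglongrightarrow> kop k' u x"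
      unfolding kop_def
    proof (rule tendsto_infsum_dominated[where G = "\<lambda>y. of_real (enn2real (d (cell x - cell y)))"])
      have "nsum (\<lambda>y. d (cell x - cell y)) \<le> of_nat (card R) * nsum d" by (rule nsum_row)
      also have "\<dots> < top" using d by (simp add: domk_def ennreal_mult_less_top)
      finally show "absum (\<lambda>y. of_real (enn2real (d (cell x - cell y))))"
        by (simp add: absum_iff dr[symmetric])
      show "(\<lambda>n. \<kappa> (s n) x y * w (s n) y) \<longlonglongrightarrow> k' x y * u y" for y by (intro tendsto_mult k' u)
      fix n y
      have "en (\<kappa> (s n) x y) \<le> ennreal (enn2real (d (cell x - cell y)))"
        using d\<kappa>[of "s n"] by (simp add: domk_def dr[symmetric])
      then have "norm (\<kappa> (s n) x y) * norm (w (s n) y) \<le> enn2real (d (cell x - cell y)) * 1"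
        using v(1) by (intro mult_mono) (auto simp: w_def)
      then show "norm (\<kappa> (s n) x y * w (s n) y) \<le> norm (complex_of_real (enn2real (d (cell x - cell y))))"
        by (simp add: norm_mult)
    qed
    moreover have "(\<lambda>n. kop (\<kappa> (s n)) (w (s n)) x) \<longlonglongrightarrow> 0"
    proof (rule Lim_null_comparison[OF always_eventually], rule allI)
      show "norm (kop (\<kappa> (s n)) (w (s n)) x) \<le> 1 / real (Suc (s n))" for n by (rule \<kappa>w)
      show "(\<lambda>n. 1 / real (Suc (s n))) \<longlonglongrightarrow> 0"
        using LIMSEQ_subseq_LIMSEQ[OF LIMSEQ_inverse_real_of_nat s(1)] by (simp add: o_def inverse_eq_divide)
    qed
    ultimately show ?thesis by (rule LIMSEQ_unique)
  qed
  then have "u = (\<lambda>x. 0)" by (intro inj[OF lop bu]) auto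
  moreover have "1/2 \<le> (\<Sum>r\<in>R. norm (u r))"
    by (rule LIMSEQ_le_const[OF tendsto_sum[OF tendsto_norm[OF u]]]) (use wsum in auto)
  ultimately show False by simp
qed

text \<open>Limit operators of the transpose at the conjugate exponent are transposes of limit
  operators, so the compactness argument yields the lower bound for the transpose as well.\<close>

lemma fredholm_of_invertible_limit_ops:
  assumes p: "1 < p" and k: "Wk k" and p0: "1 \<le> p0"
    and inv: "\<And>k'. k' \<in> limit_ops act R p k \<Longrightarrow> invertible_on p0 (kop k')"
  shows "fredholm_on (ereal p) (kop k)"
proof -
  have W: "Wk k'" if "k' \<in> limit_ops act R q l" for k' q l
    using that by (auto simp: limit_ops_def is_limit_op_def in_W_iff)
  obtain F where F: "finite F" "LBinf (- F) k"
    using LBinf_of_injective_limit_ops[OF p k] invertible_injective(1)[OF p0 W inv] by blast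
  have q: "1 < conj_exp p" by (rule conj_exp_props(1)[OF p])
  obtain G where G: "finite G" "LBinf (- G) (adj_kernel k)"
  proof -
    have "u = (\<lambda>x. 0)" if k': "k' \<in> limit_ops act R (conj_exp p) (adj_kernel k)" and u: "bdd u" "kop k' u = (\<lambda>x. 0)" for k' u
    proof -
      have "adj_kernel k' \<in> limit_ops act R p k"
        using k' limit_op_symmetric[OF p] by (auto simp: limit_ops_def)
      then show ?thesis using invertible_injective(2)[OF p0 W inv u(1)] u(2) by force
    qed
    then show thesis using LBinf_of_injective_limit_ops[OF q Wk_adj[OF k]] that by blast
  qed
  have "LBinf (- (F \<union> G)) k" "LBinf (- (F \<union> G)) (adj_kernel k)"
    using F(2) G(2) by (auto elim: LBinf_mono)
  then show ?thesis using fredholm_iff_LBinf[OF p k] F(1) G(1) by blast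
qed

section \<open>Spectral parameters\<close>

definition sub_scalar :: "('x \<Rightarrow> 'x \<Rightarrow> complex) \<Rightarrow> complex \<Rightarrow> 'x \<Rightarrow> 'x \<Rightarrow> complex" where
  "sub_scalar k z = (\<lambda>x y. k x y - z * kid x y)"

lemma Wk_sub_scalar: "Wk k \<Longrightarrow> Wk (sub_scalar k z)"
  unfolding sub_scalar_def using Wk_add[of k "\<lambda>x y. - z * kid x y"] Wk_cmult[OF Wk_kid, of "- z"] by simp

lemma kop_sub_scalar: "Wk k \<Longrightarrow> bdd u \<Longrightarrow> kop (sub_scalar k z) u = (\<lambda>x. kop k u x - z * u x)"
  unfolding sub_scalar_def using kop_kernel_diff[OF _ Wk_cmult[OF Wk_kid], of k u z]
  by (simp add: kop_kernel_cmult)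

lemma adj_sub_scalar: "adj_kernel (sub_scalar k z) = sub_scalar (adj_kernel k) z"
  by (auto simp: sub_scalar_def adj_kernel_def kid_def fun_eq_iff)

lemma strong_conv_sub_scalar:
  assumes p: "0 < p" and k: "Wk k" "Wk k'"
  shows "strong_conv (ereal p) (\<lambda>m. shift_conj act (h m) (kop (sub_scalar k z))) (kop (sub_scalar k' z))
    \<longleftrightarrow> strong_conv (ereal p) (\<lambda>m. shift_conj act (h m) (kop k)) (kop k')"
  unfolding strong_conv_def
proof (rule ball_cong[OF refl])
  fix u :: "'x \<Rightarrow> complex" assume u: "u \<in> lp (ereal p)"
  have bu: "bdd u" by (rule lp_bdd[OF p u])
  have tr: "translate_kernel act \<alpha> (sub_scalar k z) = sub_scalar (translate_kernel act \<alpha> k) z" for \<alpha>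
  proof -
    have "act \<alpha> x = act \<alpha> y \<longleftrightarrow> x = y" for x y using bij_act[of \<alpha>] by (auto simp: bij_def inj_def)
    then show ?thesis by (simp add: translate_kernel_def sub_scalar_def kid_def)
  qed
  have Wt: "Wk (translate_kernel act \<alpha> k)" for \<alpha> using k(1) domk_translate unfolding Wk_def by blast
  have "(\<lambda>x. shift_conj act (h m) (kop (sub_scalar k z)) u x - kop (sub_scalar k' z) u x)
    = (\<lambda>x. shift_conj act (h m) (kop k) u x - kop k' u x)" for m
    unfolding shift_conj_kop tr kop_sub_scalar[OF Wt bu] kop_sub_scalar[OF k(2) bu] by simp
  then show "((\<lambda>m. lp_norm (ereal p) (\<lambda>x. shift_conj act (h m) (kop (sub_scalar k z)) u x - kop (sub_scalar k' z) u x)) \<longlonglongrightarrow> 0)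
    = ((\<lambda>m. lp_norm (ereal p) (\<lambda>x. shift_conj act (h m) (kop k) u x - kop k' u x)) \<longlonglongrightarrow> 0)" by simp
qed

text \<open>Scalars commute with shifts, and subtracting \<open>- z\<close> afterwards undoes the
  map, so one inclusion gives the other.\<close>

lemma limit_ops_sub_scalar:
  assumes p: "1 < p" and k: "Wk k"
  shows "limit_ops act R p (sub_scalar k z) = (\<lambda>k'. sub_scalar k' z) ` limit_ops act R p k"
proof -
  have fwd: "is_limit_op act R p l h l' \<Longrightarrow> is_limit_op act R p (sub_scalar l y) h (sub_scalar l' y)" if "Wk l" for l l' h y
    using strong_conv_sub_scalar[of p l l' h y] strong_conv_sub_scalar[of "conj_exp p" "adj_kernel l" "adj_kernel l'" h y]
      Wk_adj[of l] Wk_adj[of l'] Wk_sub_scalar[of l' y] conj_exp_props(1)[OF p] p that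
    by (simp add: is_limit_op_def in_W_iff adj_sub_scalar)
  have inv: "sub_scalar (sub_scalar l y) (- y) = l" for l y by (simp add: sub_scalar_def)
  show ?thesis
  proof (intro equalityI subsetI)
    fix l assume "l \<in> limit_ops act R p (sub_scalar k z)"
    then obtain h where "is_limit_op act R p (sub_scalar k z) h l" by (auto simp: limit_ops_def)
    from fwd[OF Wk_sub_scalar[OF k] this, of "- z"] have "sub_scalar l (- z) \<in> limit_ops act R p k"
      by (auto simp: limit_ops_def inv)
    moreover have "l = sub_scalar (sub_scalar l (- z)) z" using inv[of l "- z"] by simp
    ultimately show "l \<in> (\<lambda>k'. sub_scalar k' z) ` limit_ops act R p k"
      by (intro image_eqI[of l "\<lambda>k'. sub_scalar k' z" "sub_scalar l (- z)"])
  next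
    fix l assume "l \<in> (\<lambda>k'. sub_scalar k' z) ` limit_ops act R p k"
    then show "l \<in> limit_ops act R p (sub_scalar k z)" using fwd[OF k] by (auto simp: limit_ops_def)
  qed
qed

lemma ess_spectrum_iff:
  assumes p: "1 < p" and k: "Wk k"
  shows "z \<in> ess_spectrum_on (ereal p) (kop k) \<longleftrightarrow> \<not> fredholm_on (ereal p) (kop (sub_scalar k z))"
proof -
  have "fredholm_on (ereal p) (\<lambda>u x. kop k u x - z * u x) \<longleftrightarrow> fredholm_on (ereal p) (kop (sub_scalar k z))"
    by (rule fredholm_on_cong) (use p kop_sub_scalar[OF k lp_bdd[of p]] in auto)
  then show ?thesis by (simp add: ess_spectrum_on_def)
qed

lemma spectrum_iff:
  assumes p: "1 < p" and k: "Wk k"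
  shows "z \<in> spectrum_on (ereal p) (kop k) \<longleftrightarrow> \<not> invertible_on (ereal p) (kop (sub_scalar k z))"
proof -
  have "invertible_on (ereal p) (\<lambda>u x. kop k u x - z * u x) \<longleftrightarrow> invertible_on (ereal p) (kop (sub_scalar k z))"
    by (rule invertible_on_cong) (use p kop_sub_scalar[OF k lp_bdd[of p]] in auto)
  then show ?thesis by (simp add: spectrum_on_def)
qed

end

theorem theorem3p2:
  fixes \<rho> :: "'x \<Rightarrow> 'x \<Rightarrow> real" and act :: "int^'n \<Rightarrow> 'x \<Rightarrow> 'x"
    and R :: "'x set" and k :: "'x \<Rightarrow> 'x \<Rightarrow> complex"
  assumes "periodic_dms \<rho> act" and "orbit_reps act R" and "in_W act R k"
  shows "(\<forall>p::real. 1 < p \<longrightarrow>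
            (fredholm_on (ereal p) (kop k) \<longleftrightarrow>
             (\<exists>p0::ereal. 1 \<le> p0 \<and> (\<forall>k'\<in>limit_ops act R p k. invertible_on p0 (kop k')))))
       \<and> (\<forall>p q::real. 1 < p \<longrightarrow> 1 < q \<longrightarrow>
            ess_spectrum_on (ereal p) (kop k) = ess_spectrum_on (ereal q) (kop k))
       \<and> (\<forall>p::real. 1 < p \<longrightarrow>
            ess_spectrum_on (ereal p) (kop k) =
              (\<Union>k'\<in>limit_ops act R p k. spectrum_on (ereal p) (kop k')))"
proof -
  interpret periodic_space act R
    using assms(1,2) by unfold_locales (auto simp: periodic_dms_def)
  have k: "Wk k" using assms(3) by (simp add: in_W_iff)
  \<comment> \<open>The exponent \<open>p\<close> itself serves as \<open>p0\<close>. The kernel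
    \<open>l\<close> is arbitrary so that \<open>sub_scalar k z\<close> can be inserted for it
    later.\<close>
  have fredholm: "fredholm_on (ereal p) (kop l) \<longleftrightarrow> (\<forall>k'\<in>limit_ops act R p l. invertible_on (ereal p) (kop k'))"
    if "1 < p" "Wk l" for p l
    using limit_op_invertible[OF that] fredholm_of_invertible_limit_ops[OF that, of "ereal p"] that by auto
  have "fredholm_on (ereal p) (kop k) \<longleftrightarrow> (\<exists>p0. 1 \<le> p0 \<and> (\<forall>k'\<in>limit_ops act R p k. invertible_on p0 (kop k')))"
    if p: "1 < p" for p
  proof
    assume "fredholm_on (ereal p) (kop k)"
    then show "\<exists>p0. 1 \<le> p0 \<and> (\<forall>k'\<in>limit_ops act R p k. invertible_on p0 (kop k'))"
      using fredholm[OF p k] p by (intro exI[of _ "ereal p"]) auto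
  qed (use fredholm_of_invertible_limit_ops[OF p k] in blast)
  \<comment> \<open>For each spectral parameter both sides reduce to the same \<open>LBinf\<close>
    condition, which contains no exponent.\<close>
  moreover have "ess_spectrum_on (ereal p) (kop k) = ess_spectrum_on (ereal q) (kop k)" if "1 < p" "1 < q" for p q
    using ess_spectrum_iff[OF that(1) k] ess_spectrum_iff[OF that(2) k]
      fredholm_iff_LBinf[OF that(1) Wk_sub_scalar[OF k]] fredholm_iff_LBinf[OF that(2) Wk_sub_scalar[OF k]]
    by auto
  moreover have "ess_spectrum_on (ereal p) (kop k) = (\<Union>k'\<in>limit_ops act R p k. spectrum_on (ereal p) (kop k'))"
    if p: "1 < p" for p
  proof -
    have W: "Wk k'" if "k' \<in> limit_ops act R p k" for k'
      using that by (auto simp: limit_ops_def is_limit_op_def in_W_iff)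
    have "z \<in> ess_spectrum_on (ereal p) (kop k) \<longleftrightarrow> z \<in> (\<Union>k'\<in>limit_ops act R p k. spectrum_on (ereal p) (kop k'))" for z
      using ess_spectrum_iff[OF p k] fredholm[OF p Wk_sub_scalar[OF k]] limit_ops_sub_scalar[OF p k]
        spectrum_iff[OF p W] by auto
    then show ?thesis by blast
  qed
  ultimately show ?thesis by blast
qed

end
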